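(* Let $A$ be a polytope in $\mathbb{R}^d$ and let $L$ be a lattice in $\mathbb{R}^d$. Then $A$ tiles at some level $k$ (for some positive integer $k$) by translations with respect to $L$, i.e. $\sum_{\lambda\in L}\chi_A(x-\lambda)=k$ for almost every $x\in\mathbb{R}^d$, if and only if $H_{\Phi}(A,L)=0$ for every $r$-flag $\Phi$ with $0\le r\le d-1$.
   Context: A simplex in $\mathbb{R}^d$ is the convex hull of $d+1$ points not all lying in a hyperplane. A polytope in $\mathbb{R}^d$ is a union of finitely many simplices with pairwise disjoint interiors (not necessarily convex or connected). A lattice $L$ in $\mathbb{R}^d$ is the subgroup generated by $d$ linearly independent vectors. $\chi_A$ denotes the indicator function of $A$. For $0\le r\le d-1$, an $r$-flag $\Phi$ is a sequence of affine subspaces $V_r\subset V_{r+1}\subset\cdots\subset V_{d-1}\subset V_d=\mathbb{R}^d$ with $\dim V_j=j$, together with, for each $r\le j\le d-1$, a designation of one of the two half-spaces of $V_{j+1}$ bounded by $V_j$ as positive and the other as negative. Given a polytope $A$, consider chains of faces $F_r\subset F_{r+1}\subset\cdots\subset F_{d-1}\subset F_d=A$ where $F_j$ is a $j$-dimensional face of $A$ contained in $V_j$ ($r\le j\le d-1$); to each such chain assign $\varepsilon_j=+1$ if $F_{j+1}$ adjoins $V_j$ from the positive side and $\varepsilon_j=-1$ if from the negative side. Define $\omega_\Phi(A)=\sum \varepsilon_r\varepsilon_{r+1}\cdots\varepsilon_{d-1}\,\mathrm{Vol}_r(F_r)$, the sum over all such chains (and $\omega_\Phi(A)=0$ if there is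 none), where $\mathrm{Vol}_r$ is $r$-dimensional volume, and for $r=0$ a $0$-dimensional face is a vertex with volume $1$. The Hadwiger functional is $H_\Phi(A,L)=\sum_{\Psi}\omega_\Psi(A)$, where $\Psi$ runs over all distinct $r$-flags obtainable from $\Phi$ by translating all the subspaces $V_j$, together with their positive and negative half-spaces, by some vector $\lambda\in L$ (each such flag counted once). *)

theory Defs
  imports "HOL-Analysis.Analysis" "HOL-Computational_Algebra.Group_Closure"
begin

text \<open>The predicate \<open>polytope\<close> of the library means a convex polytope. Here polytopes need be neither
  convex nor connected. The empty union is not a polytope.\<close>

definition general_polytope :: "'a::euclidean_space set \<Rightarrow> bool" where
  "general_polytope A \<longleftrightarrow>
     (\<exists>T. finite T \<and> T \<noteq> {} \<and> (\<forall>S\<in>T. int DIM('a) simplex S) \<and>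
          pairwise (\<lambda>S S'. interior S \<inter> interior S' = {}) T \<and> A = \<Union>T)"

definition is_lattice :: "'a::euclidean_space set \<Rightarrow> bool" where
  "is_lattice L \<longleftrightarrow> (\<exists>B. independent B \<and> card B = DIM('a) \<and> L = group_closure B)"

definition tiles_at_level :: "'a::euclidean_space set \<Rightarrow> 'a set \<Rightarrow> nat \<Rightarrow> bool" where
  "tiles_at_level A L k \<longleftrightarrow>
     (AE x in lebesgue. ((\<lambda>l. indicator A (x - l) :: real) has_sum real k) L)"

text \<open>\<open>H\<close> is one of the two closed half-spaces of the affine space \<open>W\<close> bounded by its hyperplane \<open>V\<close>.\<close>

definition half_space_of :: "'a::euclidean_space set \<Rightarrow> 'a set \<Rightarrow> 'a set \<Rightarrow> bool" where
  "half_space_of W V H \<longleftrightarrow> V \<noteq> {} \<and> V \<noteq> W \<and>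
     (\<exists>a b. V = {x\<in>W. a \<bullet> x = b} \<and> H = {x\<in>W. a \<bullet> x \<ge> b})"

definition agree_near :: "'a::metric_space \<Rightarrow> 'a set \<Rightarrow> 'a set \<Rightarrow> bool" where
  "agree_near x P Q \<longleftrightarrow> (\<exists>e>0. P \<inter> ball x e = Q \<inter> ball x e)"

text \<open>The facets of a possibly non-convex polytope \<open>P\<close>, taken within its affine hull: near a point in
  the relative interior of a facet, \<open>P\<close> is a half-space, and the facets are the closures of the connected
  components of the set of all such points. A point at which \<open>P\<close> lies on both sides of a
  hyperplane is therefore not an inner point of a facet in that hyperplane.\<close>

definition facet_points :: "'a::euclidean_space set \<Rightarrow> 'a set" where
  "facet_points P =
     {x. \<exists>V H. half_space_of (affine hull P) V H \<and> x \<in> V \<and> agree_near x P H}"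

definition facets :: "'a::euclidean_space set \<Rightarrow> 'a set set" where
  "facets P = closure ` components (facet_points P)"

definition adjoins_from :: "'a::euclidean_space set \<Rightarrow> 'a set \<Rightarrow> 'a set \<Rightarrow> bool" where
  "adjoins_from P F H \<longleftrightarrow> (\<exists>x\<in>F. agree_near x P H)"

text \<open>The volume of \<open>F\<close> of dimension \<open>aff_dim F\<close>: Lebesgue measure in Cartesian coordinates on the
  affine hull of \<open>F\<close>. It does not depend on the frame chosen, and it is 1 if \<open>F\<close> is a single point.\<close>

definition orthonormal_frame :: "'a::euclidean_space set \<Rightarrow> 'a \<Rightarrow> 'a set \<Rightarrow> bool" where
  "orthonormal_frame V p B \<longleftrightarrow>
     pairwise orthogonal B \<and> (\<forall>b\<in>B. norm b = 1) \<and> V = (\<lambda>v. p + v) ` span B"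

definition rel_volume :: "'a::euclidean_space set \<Rightarrow> real" where
  "rel_volume F =
     (let (p, B) = (SOME (p, B). orthonormal_frame (affine hull F) p B);
          M = (\<Pi>\<^sub>M b\<in>B. (lborel :: real measure))
      in measure M {t \<in> space M. p + (\<Sum>b\<in>B. t b *\<^sub>R b) \<in> F})"

text \<open>A flag is a pair \<open>(V, H)\<close>, where \<open>V j\<close> is the subspace of dimension \<open>j\<close> and \<open>H j\<close> is the positive
  half-space of \<open>V (Suc j)\<close> bounded by \<open>V j\<close>. Both are empty at the unused indices, so that two
  flags are the same exactly if the pairs are equal.\<close>

type_synonym 'a flag = "(nat \<Rightarrow> 'a set) \<times> (nat \<Rightarrow> 'a set)"

definition is_flag :: "nat \<Rightarrow> 'a::euclidean_space flag \<Rightarrow> bool" where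
  "is_flag r \<Phi> \<longleftrightarrow> (case \<Phi> of (V, H) \<Rightarrow>
     (\<forall>j\<in>{r..DIM('a)}. affine (V j) \<and> aff_dim (V j) = int j) \<and> V (DIM('a)) = UNIV \<and>
     (\<forall>j\<in>{r..<DIM('a)}. V j \<subseteq> V (Suc j) \<and> half_space_of (V (Suc j)) (V j) (H j)) \<and>
     (\<forall>j. j \<notin> {r..DIM('a)} \<longrightarrow> V j = {}) \<and> (\<forall>j. j \<notin> {r..<DIM('a)} \<longrightarrow> H j = {}))"

definition translate_flag :: "'a::euclidean_space \<Rightarrow> 'a flag \<Rightarrow> 'a flag" where
  "translate_flag l \<Phi> = (case \<Phi> of (V, H) \<Rightarrow> (\<lambda>j. (+) l ` V j, \<lambda>j. (+) l ` H j))"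

text \<open>A face of a non-convex polytope may meet another face in only a part of a facet of the latter, so
  \<open>F j\<close> is required to be a facet of \<open>F (Suc j)\<close>. For faces of a convex polytope this is the same
  as inclusion.\<close>

definition face_chains :: "nat \<Rightarrow> 'a::euclidean_space flag \<Rightarrow> 'a set \<Rightarrow> (nat \<Rightarrow> 'a set) set" where
  "face_chains r \<Phi> A = (case \<Phi> of (V, H) \<Rightarrow>
     {F. F (DIM('a)) = A \<and>
         (\<forall>j\<in>{r..<DIM('a)}. F j \<in> facets (F (Suc j)) \<and> aff_dim (F j) = int j \<and> F j \<subseteq> V j) \<and>
         (\<forall>j. j \<notin> {r..DIM('a)} \<longrightarrow> F j = {})})"

definition chain_sign :: "'a::euclidean_space flag \<Rightarrow> (nat \<Rightarrow> 'a set) \<Rightarrow> nat \<Rightarrow> real" where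
  "chain_sign \<Phi> F j = (if adjoins_from (F (Suc j)) (F j) (snd \<Phi> j) then 1 else -1)"

definition flag_weight :: "nat \<Rightarrow> 'a::euclidean_space flag \<Rightarrow> 'a set \<Rightarrow> real" where
  "flag_weight r \<Phi> A =
     (\<Sum>F\<in>face_chains r \<Phi> A. (\<Prod>j=r..<DIM('a). chain_sign \<Phi> F j) * rel_volume (F r))"

text \<open>For a polytope \<open>A\<close> only finitely many terms of the sum are non-zero.\<close>

definition hadwiger :: "nat \<Rightarrow> 'a::euclidean_space flag \<Rightarrow> 'a set \<Rightarrow> 'a set \<Rightarrow> real" where
  "hadwiger r \<Phi> A L = (\<Sum>\<^sub>\<infinity>\<Psi>\<in>(\<lambda>l. translate_flag l \<Phi>) ` L. flag_weight r \<Psi> A)"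

end

theory Submission
  imports Defs
begin

text \<open>
  Write \<open>f\<close> for the multiplicity function of the translates of \<open>A\<close>; it is locally a finite sum of
  indicator functions, hence constant on the cells of a locally finite hyperplane arrangement. The
  jump of such a function across a hyperplane with normal \<open>n\<close>, which is \<open>u (x + t n) - u (x - t n)\<close>
  for small \<open>t > 0\<close>, is of the same kind. Iterating jumps along a flag turns \<open>indicator A\<close> into the
  signed sum of the indicators of the faces of dimension \<open>r\<close> that end the face chains, up to
  lower-dimensional sets. So a Hadwiger functional is the integral, over a slice of \<open>V r\<close> modulo the
  lattice vectors parallel to it, of the iterated jump of \<open>f\<close>.

  If \<open>f\<close> is constant almost everywhere then all these jumps vanish generically. Conversely, by
  induction on \<open>r\<close> the iterated jump of \<open>f\<close> along an \<open>r\<close>-flag has no jumps across hyperplanes of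
  \<open>V r\<close> and is therefore generically constant, and the vanishing of the functional forces the
  constant to be 0 if \<open>r < d\<close>; for \<open>r = d\<close> this says that \<open>f\<close> itself is constant.
\<close>

section \<open>Functions constant on the cells of a hyperplane arrangement\<close>

datatype 'a affine_functional = Affine_Functional (gradient: 'a) (offset: real)

definition height :: "'a::real_inner affine_functional \<Rightarrow> 'a \<Rightarrow> real" where
  "height h x = gradient h \<bullet> x - offset h"

definition shift_functional :: "'a::real_inner \<Rightarrow> 'a affine_functional \<Rightarrow> 'a affine_functional" where
  "shift_functional l h = Affine_Functional (gradient h) (offset h - gradient h \<bullet> l)"

definition same_side :: "'a::real_inner affine_functional set \<Rightarrow> 'a \<Rightarrow> 'a \<Rightarrow> bool" where
  "same_side \<Sigma> x y \<longleftrightarrow> (\<forall>h\<in>\<Sigma>. sgn (height h x) = sgn (height h y))"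

definition cell :: "'a::real_inner affine_functional set \<Rightarrow> 'a \<Rightarrow> 'a set" where
  "cell \<Sigma> x = {y. same_side \<Sigma> x y}"

definition adapted_on ::
    "'a::real_inner affine_functional set \<Rightarrow> 'a set \<Rightarrow> ('a \<Rightarrow> 'b) \<Rightarrow> bool" where
  "adapted_on \<Sigma> X u \<longleftrightarrow> (\<forall>x\<in>X. \<forall>y\<in>X. same_side \<Sigma> x y \<longrightarrow> u x = u y)"

abbreviation adapted :: "'a::real_inner affine_functional set \<Rightarrow> 'a set \<Rightarrow> bool" where
  "adapted \<Sigma> S \<equiv> adapted_on \<Sigma> UNIV (\<lambda>x. x \<in> S)"

definition locally_adapted :: "('a::real_inner \<Rightarrow> 'b) \<Rightarrow> bool" where
  "locally_adapted u \<longleftrightarrow> (\<forall>R. \<exists>\<Sigma>. finite \<Sigma> \<and> adapted_on \<Sigma> (ball 0 R) u)"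

definition polyhedral :: "'a::real_inner set \<Rightarrow> bool" where
  "polyhedral S \<longleftrightarrow> (\<exists>\<Sigma>. finite \<Sigma> \<and> adapted \<Sigma> S)"

lemma height_add: "height h (x + z) = height h x + gradient h \<bullet> z"
  by (simp add: height_def inner_add_right)

lemma height_diff: "height h x - height h y = gradient h \<bullet> (x - y)"
  by (simp add: height_def inner_diff_right)

lemma height_line: "height h (x + t *\<^sub>R (y - x)) = (1 - t) * height h x + t * height h y"
  by (simp add: height_def inner_add_right inner_diff_right algebra_simps)

lemma height_shift_functional [simp]: "height (shift_functional l h) x = height h (x + l)"
  by (simp add: shift_functional_def height_def inner_add_right)

lemma continuous_on_height [continuous_intros]: "continuous_on S (height h)"
  unfolding height_def by (intro continuous_intros)

lemma eventually_sgn_height: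
  assumes "height h x \<noteq> 0"
  shows "\<forall>\<^sub>F y in nhds x. sgn (height h y) = sgn (height h x)"
proof -
  have "((\<lambda>y. height h y * height h x) \<longlongrightarrow> height h x * height h x) (nhds x)"
    using continuous_on_height[of UNIV h]
    by (intro tendsto_mult_right) (simp add: continuous_on_def tendsto_at_iff_tendsto_nhds)
  moreover have "height h x * height h x > 0"
    using assms by (metis not_real_square_gt_zero)
  ultimately have "\<forall>\<^sub>F y in nhds x. height h y * height h x > 0"
    by (rule order_tendstoD(1))
  then show ?thesis
    by eventually_elim (auto simp: zero_less_mult_iff)
qed

lemma same_side_refl [simp]: "same_side \<Sigma> x x"
  by (simp add: same_side_def)

lemma same_side_sym: "same_side \<Sigma> x y \<Longrightarrow> same_side \<Sigma> y x"
  by (simp add: same_side_def)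

lemma same_side_trans: "same_side \<Sigma> x y \<Longrightarrow> same_side \<Sigma> y z \<Longrightarrow> same_side \<Sigma> x z"
  by (simp add: same_side_def)

lemma same_side_mono: "same_side \<Sigma>' x y \<Longrightarrow> \<Sigma> \<subseteq> \<Sigma>' \<Longrightarrow> same_side \<Sigma> x y"
  by (auto simp: same_side_def)

lemma eventually_same_side_translate:
  assumes "finite \<Sigma>" "same_side \<Sigma> x y"
  shows "\<forall>\<^sub>F z in nhds 0. same_side \<Sigma> (x + z) (y + z)"
  unfolding same_side_def
proof (rule eventually_ball_finite[OF assms(1)], rule ballI)
  fix h
  assume "h \<in> \<Sigma>"
  then have sgn_eq: "sgn (height h x) = sgn (height h y)"
    using assms(2) by (simp add: same_side_def)
  have shift: "((\<lambda>z. w + z) \<longlongrightarrow> w) (nhds 0)" for w :: 'a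
    using tendsto_add[OF tendsto_const[of w] filterlim_ident[of "nhds 0"]] by simp
  show "\<forall>\<^sub>F z in nhds 0. sgn (height h (x + z)) = sgn (height h (y + z))"
  proof (cases "height h x = 0")
    case True
    with sgn_eq have "height h y = 0"
      by (metis sgn_0_0)
    with True show ?thesis
      by (simp add: height_add)
  next
    case False
    with sgn_eq have "height h y \<noteq> 0"
      by (metis sgn_0_0)
    from False have "\<forall>\<^sub>F z in nhds 0. sgn (height h (x + z)) = sgn (height h x)"
      by (rule eventually_compose_filterlim[OF eventually_sgn_height shift])
    moreover from \<open>height h y \<noteq> 0\<close>
    have "\<forall>\<^sub>F z in nhds 0. sgn (height h (y + z)) = sgn (height h y)"
      by (rule eventually_compose_filterlim[OF eventually_sgn_height shift])
    ultimately show ?thesis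
      by eventually_elim (simp add: sgn_eq)
  qed
qed

lemma cell_eq_iff: "cell \<Sigma> x = cell \<Sigma> y \<longleftrightarrow> same_side \<Sigma> x y"
  unfolding cell_def using same_side_refl same_side_sym same_side_trans by blast

lemma mem_cell_self [simp]: "x \<in> cell \<Sigma> x"
  by (simp add: cell_def)

lemma cell_eq_INT: "cell \<Sigma> x = (\<Inter>h\<in>\<Sigma>. {y. sgn (height h x) = sgn (height h y)})"
  by (auto simp: cell_def same_side_def)

lemma convex_cell: "convex (cell \<Sigma> x)"
proof -
  have "convex {y. sgn (height h x) = sgn (height h y)}" for h
  proof -
    consider (pos) "height h x > 0" | (zero) "height h x = 0" | (neg) "height h x < 0"
      by linarith
    then show ?thesis
    proof cases
      case pos
      then have "{y. sgn (height h x) = sgn (height h y)} = {y. gradient h \<bullet> y > offset h}"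
        by (auto simp: height_def sgn_real_def split: if_splits)
      then show ?thesis
        by (simp add: convex_halfspace_gt)
    next
      case zero
      then have "{y. sgn (height h x) = sgn (height h y)} = {y. gradient h \<bullet> y = offset h}"
        by (auto simp: height_def sgn_real_def split: if_splits)
      then show ?thesis
        by (simp add: convex_hyperplane)
    next
      case neg
      then have "{y. sgn (height h x) = sgn (height h y)} = {y. gradient h \<bullet> y < offset h}"
        by (auto simp: height_def sgn_real_def split: if_splits)
      then show ?thesis
        by (simp add: convex_halfspace_lt)
    qed
  qed
  then show ?thesis
    unfolding cell_eq_INT by (simp add: convex_INT)
qed

lemma borel_cell:
  assumes "finite \<Sigma>"
  shows "cell \<Sigma> x \<in> sets borel"
proof -
  have [measurable]: "height h \<in> borel_measurable borel" for h :: "'a affine_functional"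
    by (intro borel_measurable_continuous_onI continuous_on_height)
  have "cell \<Sigma> x = {y \<in> space borel. \<forall>h\<in>\<Sigma>. sgn (height h x) = sgn (height h y)}"
    by (auto simp: cell_def same_side_def)
  also have "\<dots> \<in> sets borel"
    using assms by measurable
  finally show ?thesis .
qed

lemma finite_cells:
  assumes "finite \<Sigma>"
  shows "finite (range (cell \<Sigma>))"
proof -
  define region where "region s = {y. \<forall>h\<in>\<Sigma>. s h = sgn (height h y)}"
    for s :: "'a affine_functional \<Rightarrow> real"
  have "cell \<Sigma> x \<in> region ` (\<Sigma> \<rightarrow>\<^sub>E {-1, 0, 1})" for x
  proof
    show "cell \<Sigma> x = region (\<lambda>h\<in>\<Sigma>. sgn (height h x))"
      by (auto simp: cell_def region_def same_side_def)
    show "(\<lambda>h\<in>\<Sigma>. sgn (height h x)) \<in> \<Sigma> \<rightarrow>\<^sub>E {-1, 0, 1}"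
      by (auto simp: sgn_real_def)
  qed
  then have "range (cell \<Sigma>) \<subseteq> region ` (\<Sigma> \<rightarrow>\<^sub>E {-1, 0, 1})"
    by blast
  then show ?thesis
    by (rule finite_subset) (simp add: assms finite_PiE)
qed

lemma adapted_onD: "adapted_on \<Sigma> X u \<Longrightarrow> x \<in> X \<Longrightarrow> y \<in> X \<Longrightarrow> same_side \<Sigma> x y \<Longrightarrow> u x = u y"
  unfolding adapted_on_def by blast

lemma adapted_on_mono: "adapted_on \<Sigma> X u \<Longrightarrow> \<Sigma> \<subseteq> \<Sigma>' \<Longrightarrow> X' \<subseteq> X \<Longrightarrow> adapted_on \<Sigma>' X' u"
  unfolding adapted_on_def using same_side_mono by blast

lemma adapted_on_comp: "adapted_on \<Sigma> X u \<Longrightarrow> adapted_on \<Sigma> X (\<lambda>x. f (u x))"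
  unfolding adapted_on_def by metis

lemma adapted_on_sum:
  assumes "\<And>i. i \<in> I \<Longrightarrow> adapted_on (\<Sigma> i) X (u i)"
  shows "adapted_on (\<Union>i\<in>I. \<Sigma> i) X (\<lambda>x. \<Sum>i\<in>I. u i x)"
  unfolding adapted_on_def
proof (intro ballI impI sum.cong[OF refl])
  fix x y i
  assume "x \<in> X" "y \<in> X" "same_side (\<Union>i\<in>I. \<Sigma> i) x y" "i \<in> I"
  then show "u i x = u i y"
    using adapted_onD[OF assms] same_side_mono by (metis UN_upper)
qed

lemma adapted_on_translate:
  assumes "adapted_on \<Sigma> X u" "\<And>x. x \<in> Y \<Longrightarrow> x + l \<in> X"
  shows "adapted_on (shift_functional l ` \<Sigma>) Y (\<lambda>x. u (x + l))"
  unfolding adapted_on_def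
proof (intro ballI impI)
  fix x y
  assume "x \<in> Y" "y \<in> Y" "same_side (shift_functional l ` \<Sigma>) x y"
  moreover from this have "same_side \<Sigma> (x + l) (y + l)"
    by (simp add: same_side_def)
  ultimately show "u (x + l) = u (y + l)"
    using adapted_onD[OF assms(1)] assms(2) by blast
qed

lemma adapted_on_factors_through_cell:
  assumes "adapted_on \<Sigma> UNIV u"
  obtains f where "u = f \<circ> cell \<Sigma>"
proof -
  have "\<forall>x y. cell \<Sigma> x = cell \<Sigma> y \<longrightarrow> u x = u y"
    using adapted_onD[OF assms] by (simp add: cell_eq_iff)
  then show thesis
    using that unfolding function_factors_left by blast
qed

lemma adapted_on_finite_range:
  assumes "finite \<Sigma>" "adapted_on \<Sigma> UNIV u"
  shows "finite (range u)"
proof -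
  obtain f where "u = f \<circ> cell \<Sigma>"
    using adapted_on_factors_through_cell[OF assms(2)] .
  then have "range u = f ` range (cell \<Sigma>)"
    by (simp add: image_comp)
  then show ?thesis
    by (simp add: finite_cells[OF assms(1)])
qed

lemma adapted_on_borel_measurable:
  fixes u :: "'a::real_inner \<Rightarrow> 'b::topological_space"
  assumes "finite \<Sigma>" "adapted_on \<Sigma> UNIV u"
  shows "u \<in> borel_measurable borel"
proof (rule measurable_piecewise_restrict)
  show "countable (range (cell \<Sigma>))"
    by (intro countable_finite finite_cells assms)
  show "space borel \<subseteq> \<Union> (range (cell \<Sigma>))"
    using mem_cell_self by blast
  fix C
  assume "C \<in> range (cell \<Sigma>)"
  then obtain x where C: "C = cell \<Sigma> x"
    by blast
  show "C \<inter> space borel \<in> sets borel"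
    using borel_cell[OF assms(1)] by (simp add: C)
  have "u y = u x" if "y \<in> C" for y
    using that adapted_onD[OF assms(2), of x y] by (simp add: C cell_def)
  then have "u \<in> borel_measurable (restrict_space borel C) \<longleftrightarrow>
    (\<lambda>_. u x) \<in> borel_measurable (restrict_space borel C)"
    by (intro measurable_cong) (simp add: space_restrict_space)
  then show "u \<in> borel_measurable (restrict_space borel C)"
    by simp
qed

lemma adapted_on_imp_locally_adapted: "finite \<Sigma> \<Longrightarrow> adapted_on \<Sigma> UNIV u \<Longrightarrow> locally_adapted u"
  unfolding locally_adapted_def by (meson adapted_on_mono order_refl subset_UNIV)

lemma locally_adaptedE:
  assumes "locally_adapted u"
  obtains \<Sigma> where "finite \<Sigma>" "adapted_on \<Sigma> (ball 0 R) u"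
  using assms unfolding locally_adapted_def by blast

lemma locally_adapted_comp: "locally_adapted u \<Longrightarrow> locally_adapted (\<lambda>x. f (u x))"
  unfolding locally_adapted_def using adapted_on_comp by blast

lemma locally_adaptedI:
  assumes "\<And>R. \<exists>v. locally_adapted v \<and> (\<forall>x\<in>ball 0 R. u x = v x)"
  shows "locally_adapted u"
  unfolding locally_adapted_def
proof
  fix R
  obtain v where v: "locally_adapted v" "\<forall>x\<in>ball 0 R. u x = v x"
    using assms by blast
  obtain \<Sigma> where "finite \<Sigma>" "adapted_on \<Sigma> (ball 0 R) v"
    using locally_adaptedE[OF v(1)] .
  moreover from this have "adapted_on \<Sigma> (ball 0 R) u"
    using v(2) unfolding adapted_on_def by metis
  ultimately show "\<exists>\<Sigma>. finite \<Sigma> \<and> adapted_on \<Sigma> (ball 0 R) u"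
    by blast
qed

lemma locally_adapted_translate:
  assumes "locally_adapted u"
  shows "locally_adapted (\<lambda>x. u (x + l))"
  unfolding locally_adapted_def
proof
  fix R
  obtain \<Sigma> where \<Sigma>: "finite \<Sigma>" "adapted_on \<Sigma> (ball 0 (R + norm l)) u"
    using locally_adaptedE[OF assms] .
  have "adapted_on (shift_functional l ` \<Sigma>) (ball 0 R) (\<lambda>x. u (x + l))"
    by (rule adapted_on_translate[OF \<Sigma>(2)]) (auto intro: norm_triangle_lt)
  then show "\<exists>\<Sigma>. finite \<Sigma> \<and> adapted_on \<Sigma> (ball 0 R) (\<lambda>x. u (x + l))"
    using \<Sigma>(1) by blast
qed

lemma locally_adapted_sum:
  assumes "finite I" "\<And>i. i \<in> I \<Longrightarrow> locally_adapted (u i)"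
  shows "locally_adapted (\<lambda>x. \<Sum>i\<in>I. u i x)"
  unfolding locally_adapted_def
proof
  fix R
  have "\<forall>i\<in>I. \<exists>\<Sigma>. finite \<Sigma> \<and> adapted_on \<Sigma> (ball 0 R) (u i)"
    using assms(2) unfolding locally_adapted_def by blast
  then obtain \<Sigma> where "\<And>i. i \<in> I \<Longrightarrow> finite (\<Sigma> i)" "\<And>i. i \<in> I \<Longrightarrow> adapted_on (\<Sigma> i) (ball 0 R) (u i)"
    by metis
  then show "\<exists>\<Sigma>. finite \<Sigma> \<and> adapted_on \<Sigma> (ball 0 R) (\<lambda>x. \<Sum>i\<in>I. u i x)"
    using adapted_on_sum[of I \<Sigma>] assms(1) by blast
qed

lemma adaptedI:
  "(\<And>x y. x \<in> S \<Longrightarrow> same_side \<Sigma> x y \<Longrightarrow> y \<in> S) \<Longrightarrow> adapted \<Sigma> S"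
  unfolding adapted_on_def using same_side_sym by blast

lemma adaptedD: "adapted \<Sigma> S \<Longrightarrow> same_side \<Sigma> x y \<Longrightarrow> x \<in> S \<longleftrightarrow> y \<in> S"
  unfolding adapted_on_def by blast

lemma adapted_on_indicator: "adapted \<Sigma> S \<Longrightarrow> adapted_on \<Sigma> UNIV (indicator S)"
  unfolding indicator_def by (rule adapted_on_comp)

lemma finite_adapted_sets:
  assumes "finite \<Sigma>"
  shows "finite {S. adapted \<Sigma> S}"
proof (rule finite_subset)
  show "{S. adapted \<Sigma> S} \<subseteq> Union ` Pow (range (cell \<Sigma>))"
  proof
    fix S :: "'a set"
    assume "S \<in> {S. adapted \<Sigma> S}"
    then have "S = \<Union> (cell \<Sigma> ` S)"
      using adaptedD by (force simp: cell_def)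
    then show "S \<in> Union ` Pow (range (cell \<Sigma>))"
      by blast
  qed
  show "finite (Union ` Pow (range (cell \<Sigma>)))"
    by (simp add: assms finite_cells)
qed

lemma adapted_closure:
  assumes "finite \<Sigma>" "adapted \<Sigma> S"
  shows "adapted \<Sigma> (closure S)"
proof (rule adaptedI)
  fix x y
  assume x: "x \<in> closure S" and xy: "same_side \<Sigma> x y"
  obtain d where d: "d > 0" "\<And>z. norm z < d \<Longrightarrow> same_side \<Sigma> (x + z) (y + z)"
    using eventually_same_side_translate[OF assms(1) xy] by (auto simp: eventually_nhds_metric)
  show "y \<in> closure S"
    unfolding closure_approachable
  proof (intro allI impI)
    fix e :: real
    assume "e > 0"
    with x d(1) obtain s where s: "s \<in> S" "dist s x < min d e"
      unfolding closure_approachable by (metis min_less_iff_conj)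
    then have "same_side \<Sigma> s (y + (s - x))"
      using d(2)[of "s - x"] by (simp add: dist_norm)
    then have "y + (s - x) \<in> S"
      using adaptedD[OF assms(2)] s(1) by blast
    moreover have "dist (y + (s - x)) y < e"
      using s(2) by (simp add: dist_norm)
    ultimately show "\<exists>z\<in>S. dist z y < e"
      by blast
  qed
qed

lemma adapted_component:
  assumes "adapted \<Sigma> S" "C \<in> components S"
  shows "adapted \<Sigma> C"
proof (rule adaptedI)
  fix x y
  assume x: "x \<in> C" and xy: "same_side \<Sigma> x y"
  have "cell \<Sigma> x \<subseteq> S"
    using adaptedD[OF assms(1)] x in_components_subset[OF assms(2)] by (auto simp: cell_def)
  then have "cell \<Sigma> x \<subseteq> C"
    using components_maximal[OF assms(2) convex_connected[OF convex_cell]] x mem_cell_self by blast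
  then show "y \<in> C"
    using xy by (auto simp: cell_def)
qed

lemma polyhedral_Union:
  assumes "finite T" "\<And>S. S \<in> T \<Longrightarrow> polyhedral S"
  shows "polyhedral (\<Union>T)"
proof -
  obtain \<Sigma> where \<Sigma>: "\<And>S. S \<in> T \<Longrightarrow> finite (\<Sigma> S)" "\<And>S. S \<in> T \<Longrightarrow> adapted (\<Sigma> S) S"
    using assms(2) unfolding polyhedral_def by metis
  have "adapted (\<Union>(\<Sigma> ` T)) (\<Union>T)"
    by (rule adaptedI) (meson UN_upper Union_iff \<Sigma>(2) adaptedD same_side_mono)
  then show ?thesis
    unfolding polyhedral_def using assms(1) \<Sigma>(1) by blast
qed

lemma polyhedral_Compl: "polyhedral S \<Longrightarrow> polyhedral (- S)"
  unfolding polyhedral_def by (auto intro: adapted_on_comp[of _ _ _ Not])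

lemma polyhedral_Inter:
  assumes "finite T" "\<And>S. S \<in> T \<Longrightarrow> polyhedral S"
  shows "polyhedral (\<Inter>T)"
proof -
  have "polyhedral (\<Union>(uminus ` T))"
    using assms by (intro polyhedral_Union) (auto intro: polyhedral_Compl)
  then have "polyhedral (- \<Union>(uminus ` T))"
    by (rule polyhedral_Compl)
  then show ?thesis
    by (simp add: Compl_UN)
qed

lemma polyhedral_halfspace_le: "polyhedral {x. a \<bullet> x \<le> b}"
proof -
  have "adapted {Affine_Functional a b} {x. a \<bullet> x \<le> b}"
    by (rule adaptedI) (auto simp: same_side_def height_def sgn_real_def split: if_splits)
  then show ?thesis
    unfolding polyhedral_def by blast
qed

lemma polyhedron_imp_polyhedral: "polyhedron S \<Longrightarrow> polyhedral S"
  unfolding polyhedron_def using polyhedral_Inter polyhedral_halfspace_le by metis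

lemma general_polytope_imp_polyhedral:
  assumes "general_polytope A"
  shows "polyhedral A"
proof -
  obtain T where T: "finite T" "\<forall>S\<in>T. int DIM('a) simplex S" "A = \<Union>T"
    using assms unfolding general_polytope_def by blast
  then have "polyhedral S" if "S \<in> T" for S
    using that by (meson polyhedron_imp_polyhedral polytope_imp_polyhedron simplex_imp_polytope)
  then show ?thesis
    unfolding T(3) by (intro polyhedral_Union T(1))
qed

section \<open>Generic points of an affine space\<close>

definition vanishes_on :: "'a::real_inner affine_functional \<Rightarrow> 'a set \<Rightarrow> bool" where
  "vanishes_on h W \<longleftrightarrow> (\<forall>x\<in>W. height h x = 0)"

definition regular :: "'a::real_inner affine_functional set \<Rightarrow> 'a set \<Rightarrow> 'a \<Rightarrow> bool" where
  "regular \<Sigma> W x \<longleftrightarrow> (\<forall>h\<in>\<Sigma>. height h x = 0 \<longrightarrow> vanishes_on h W)"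

text \<open>The arrangement to be avoided may grow with the radius \<open>R\<close>, so it need only be locally
  finite.\<close>

definition generic :: "'a::real_inner set \<Rightarrow> 'a filter" where
  "generic W = Abs_filter (\<lambda>P. \<forall>R. \<exists>\<Sigma>. finite \<Sigma> \<and>
     (\<forall>x\<in>W. norm x < R \<longrightarrow> regular \<Sigma> W x \<longrightarrow> P x))"

lemma regular_Un: "regular (\<Sigma> \<union> \<Sigma>') W x \<longleftrightarrow> regular \<Sigma> W x \<and> regular \<Sigma>' W x"
  by (auto simp: regular_def)

lemma eventually_generic:
  "eventually P (generic W) \<longleftrightarrow>
    (\<forall>R. \<exists>\<Sigma>. finite \<Sigma> \<and> (\<forall>x\<in>W. norm x < R \<longrightarrow> regular \<Sigma> W x \<longrightarrow> P x))"
  (is "_ \<longleftrightarrow> ?ev P")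
  unfolding generic_def
proof (rule eventually_Abs_filter, rule is_filter.intro)
  show "?ev (\<lambda>_. True)"
    by blast
next
  fix P Q
  assume PQ: "?ev P" "?ev Q"
  show "?ev (\<lambda>x. P x \<and> Q x)"
  proof
    fix R
    from PQ obtain \<Sigma> \<Sigma>' where "finite \<Sigma>" "\<forall>x\<in>W. norm x < R \<longrightarrow> regular \<Sigma> W x \<longrightarrow> P x"
      "finite \<Sigma>'" "\<forall>x\<in>W. norm x < R \<longrightarrow> regular \<Sigma>' W x \<longrightarrow> Q x"
      by meson
    then show "\<exists>\<Sigma>. finite \<Sigma> \<and> (\<forall>x\<in>W. norm x < R \<longrightarrow> regular \<Sigma> W x \<longrightarrow> P x \<and> Q x)"
      by (intro exI[of _ "\<Sigma> \<union> \<Sigma>'"]) (auto simp: regular_Un)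
  qed
next
  fix P Q
  assume "\<forall>x. P x \<longrightarrow> Q x" "?ev P"
  then show "?ev Q"
    by meson
qed

lemma eventually_genericE:
  assumes "\<forall>\<^sub>F x in generic W. P x"
  obtains \<Sigma> where "finite \<Sigma>" "\<And>x. x \<in> W \<Longrightarrow> norm x < R \<Longrightarrow> regular \<Sigma> W x \<Longrightarrow> P x"
  using assms unfolding eventually_generic by meson

lemma eventually_generic_mem: "\<forall>\<^sub>F x in generic W. x \<in> W"
  unfolding eventually_generic by blast

lemma eventually_generic_regular: "finite \<Sigma> \<Longrightarrow> \<forall>\<^sub>F x in generic W. regular \<Sigma> W x"
  unfolding eventually_generic by blast

lemma eventually_generic_boundedI:
  assumes "\<And>R. \<forall>\<^sub>F x in generic W. norm x < R \<longrightarrow> P x"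
  shows "\<forall>\<^sub>F x in generic W. P x"
  unfolding eventually_generic
proof
  fix R
  obtain \<Sigma> where "finite \<Sigma>" "\<And>x. x \<in> W \<Longrightarrow> norm x < R \<Longrightarrow> regular \<Sigma> W x \<Longrightarrow> norm x < R \<longrightarrow> P x"
    using eventually_genericE[OF assms[of R]] by blast
  then show "\<exists>\<Sigma>. finite \<Sigma> \<and> (\<forall>x\<in>W. norm x < R \<longrightarrow> regular \<Sigma> W x \<longrightarrow> P x)"
    by blast
qed

lemma eventually_generic_translate:
  assumes "\<forall>\<^sub>F x in generic ((+) l ` W). P x"
  shows "\<forall>\<^sub>F x in generic W. P (x + l)"
proof (rule eventually_generic_boundedI)
  fix R
  obtain \<Sigma> where \<Sigma>: "finite \<Sigma>" "\<And>x. x \<in> (+) l ` W \<Longrightarrow> norm x < R + norm l \<Longrightarrow>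
      regular \<Sigma> ((+) l ` W) x \<Longrightarrow> P x"
    using eventually_genericE[OF assms] by blast
  have "\<forall>\<^sub>F x in generic W. regular (shift_functional l ` \<Sigma>) W x"
    by (intro eventually_generic_regular finite_imageI \<Sigma>(1))
  then show "\<forall>\<^sub>F x in generic W. norm x < R \<longrightarrow> P (x + l)"
    using eventually_generic_mem
  proof eventually_elim
    case (elim x)
    have "regular \<Sigma> ((+) l ` W) (x + l)"
      using elim(1) by (auto simp: regular_def vanishes_on_def add.commute)
    then show ?case
      using \<Sigma>(2)[of "x + l"] elim(2) norm_triangle_ineq[of x l] by (force simp: add.commute)
  qed
qed

lemma eventually_at_right_line:
  fixes x n :: "'a::real_normed_vector"
  assumes "\<forall>\<^sub>F z in nhds x. P z"
  shows "\<forall>\<^sub>F t in at_right 0. P (x + t *\<^sub>R n)"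
proof (rule eventually_compose_filterlim[OF assms])
  have "((\<lambda>t::real. x + t *\<^sub>R n) \<longlongrightarrow> x + 0 *\<^sub>R n) (at_right 0)"
    by (intro tendsto_intros)
  then show "((\<lambda>t::real. x + t *\<^sub>R n) \<longlongrightarrow> x) (at_right 0)"
    by simp
qed

lemma eventually_at_right_line_in_open:
  fixes x n :: "'a::real_normed_vector"
  assumes "open X" "x \<in> X"
  shows "\<forall>\<^sub>F t in at_right 0. x + t *\<^sub>R n \<in> X" "\<forall>\<^sub>F t in at_right 0. x - t *\<^sub>R n \<in> X"
  using eventually_at_right_line[OF eventually_nhds_in_open[OF assms], of n]
    eventually_at_right_line[OF eventually_nhds_in_open[OF assms], of "- n"] by simp_all

lemma eventually_at_right_happens:
  assumes "\<forall>\<^sub>F t in at_right (0::real). P t"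
  obtains t where "t > 0" "P t"
proof -
  have "\<forall>\<^sub>F t in at_right (0::real). t > 0 \<and> P t"
    using eventually_at_right_less[of 0] assms by eventually_elim simp
  then show thesis
    using that eventually_happens'[OF trivial_limit_at_right_real] by blast
qed

lemma affine_line_mem: "affine W \<Longrightarrow> x \<in> W \<Longrightarrow> y \<in> W \<Longrightarrow> x + t *\<^sub>R (y - x) \<in> W"
  using mem_affine_3_minus[of W x y x t] by simp

lemma eventually_height_line_nonzero:
  assumes "height h x \<noteq> 0 \<or> height h y \<noteq> 0"
  shows "\<forall>\<^sub>F t in at_right 0. height h (x + t *\<^sub>R (y - x)) \<noteq> 0"
proof (cases "height h x = 0")
  case True
  have "\<forall>\<^sub>F t in at_right (0::real). t > 0"
    by (rule eventually_at_right_less)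
  then show ?thesis
    by eventually_elim (use True assms in \<open>simp add: height_line\<close>)
next
  case False
  then show ?thesis
    using eventually_at_right_line[OF eventually_sgn_height[OF False], of "y - x"]
    by (auto elim: eventually_mono simp: sgn_0_0)
qed

lemma regular_dense:
  assumes "affine W" "x \<in> W" "e > 0" "finite \<Sigma>"
  shows "\<exists>y\<in>W \<inter> ball x e. regular \<Sigma> W y"
  using assms(4)
proof (induction \<Sigma> rule: finite_induct)
  case empty
  then show ?case
    using assms(2,3) by (auto simp: regular_def)
next
  case (insert h \<Sigma>)
  then obtain y where y: "y \<in> W \<inter> ball x e" "regular \<Sigma> W y"
    by blast
  show ?case
  proof (cases "vanishes_on h W")
    case True
    then show ?thesis
      using y by (auto simp: regular_def)
  next
    case False
    then obtain w where w: "w \<in> W" "height h w \<noteq> 0"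
      by (auto simp: vanishes_on_def)
    define z where "z t = y + t *\<^sub>R (w - y)" for t
    have "\<forall>\<^sub>F t in at_right 0. \<forall>k\<in>insert h {k\<in>\<Sigma>. height k y \<noteq> 0}. height k (z t) \<noteq> 0"
      unfolding z_def using insert.hyps(1) w(2)
      by (intro eventually_ball_finite ballI eventually_height_line_nonzero) auto
    moreover have "\<forall>\<^sub>F t in at_right 0. z t \<in> ball x e"
      unfolding z_def using y(1) by (intro eventually_at_right_line_in_open) auto
    ultimately have "\<forall>\<^sub>F t in at_right 0. z t \<in> ball x e \<and> regular (insert h \<Sigma>) W (z t)"
      by eventually_elim (use y(2) in \<open>auto simp: regular_def\<close>)
    then obtain t where "z t \<in> ball x e" "regular (insert h \<Sigma>) W (z t)"
      using eventually_at_right_happens by blast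
    moreover have "z t \<in> W"
      unfolding z_def using affine_line_mem[OF assms(1)] y(1) w(1) by blast
    ultimately show ?thesis
      by blast
  qed
qed

lemma regular_dense_in_convex:
  assumes "convex S" "finite \<Sigma>" "x \<in> S" "regular \<Sigma> W x" "p \<in> S" "e > 0"
  shows "\<exists>z\<in>S. dist p z < e \<and> regular \<Sigma> W z"
proof -
  define z where "z t = p + t *\<^sub>R (x - p)" for t
  have "\<forall>\<^sub>F t in at_right 0. \<forall>k\<in>{k\<in>\<Sigma>. height k x \<noteq> 0}. height k (z t) \<noteq> 0"
    unfolding z_def using assms(2)
    by (intro eventually_ball_finite ballI eventually_height_line_nonzero) auto
  moreover have "\<forall>\<^sub>F t in at_right 0. z t \<in> ball p e"
    unfolding z_def using assms(6) by (intro eventually_at_right_line_in_open) auto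
  moreover have "\<forall>\<^sub>F t in at_right (0::real). t < 1"
    by (rule eventually_at_right_real[THEN eventually_mono]) auto
  ultimately have "\<forall>\<^sub>F t in at_right 0. t < 1 \<and> z t \<in> ball p e \<and> regular \<Sigma> W (z t)"
    by eventually_elim (use assms(4) in \<open>auto simp: regular_def\<close>)
  then obtain t where t: "0 < t" "t < 1" "z t \<in> ball p e" "regular \<Sigma> W (z t)"
    using eventually_at_right_happens by blast
  have "z t = (1 - t) *\<^sub>R p + t *\<^sub>R x"
    by (simp add: z_def algebra_simps)
  then have "z t \<in> S"
    using convexD_alt[OF assms(1,5,3)] t by simp
  then show ?thesis
    using t by auto
qed

lemma eventually_generic_dense:
  assumes "affine W" "x \<in> W" "e > 0" "\<forall>\<^sub>F y in generic W. P y"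
  obtains y where "y \<in> W" "dist x y < e" "P y"
proof -
  obtain \<Sigma> where \<Sigma>: "finite \<Sigma>"
    "\<And>y. y \<in> W \<Longrightarrow> norm y < norm x + e \<Longrightarrow> regular \<Sigma> W y \<Longrightarrow> P y"
    using eventually_genericE[OF assms(4)] by blast
  obtain y where y: "y \<in> W" "dist x y < e" "regular \<Sigma> W y"
    using regular_dense[OF assms(1-3) \<Sigma>(1)] by auto
  have "norm y < norm x + e"
    using y(2) norm_triangle_ineq2[of y x] by (simp add: dist_norm norm_minus_commute)
  then show thesis
    using that \<Sigma>(2) y by blast
qed

lemma locally_const_at_regular_point:
  assumes "finite \<Sigma>" "adapted_on \<Sigma> X u" "open X" "p \<in> W" "p \<in> X" "regular \<Sigma> W p"
  shows "\<forall>\<^sub>F z in nhds p. z \<in> W \<longrightarrow> u z = u p"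
proof -
  have "\<forall>\<^sub>F z in nhds p. \<forall>h\<in>\<Sigma>. height h p \<noteq> 0 \<longrightarrow> sgn (height h z) = sgn (height h p)"
    using eventually_sgn_height by (intro eventually_ball_finite assms ballI)
      (auto elim: eventually_mono)
  moreover have "\<forall>\<^sub>F z in nhds p. z \<in> X"
    by (rule eventually_nhds_in_open[OF assms(3,5)])
  ultimately show ?thesis
  proof eventually_elim
    case (elim z)
    have "same_side \<Sigma> z p" if "z \<in> W"
      using elim(1) that assms(4,6) unfolding same_side_def regular_def vanishes_on_def by metis
    then show ?case
      using adapted_onD[OF assms(2)] elim(2) assms(5) by blast
  qed
qed

section \<open>Jumps across a hyperplane\<close>

definition wall :: "'a::real_inner set \<Rightarrow> 'a affine_functional \<Rightarrow> 'a set" where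
  "wall W h = {x \<in> W. height h x = 0}"

definition upper_half :: "'a::real_inner set \<Rightarrow> 'a affine_functional \<Rightarrow> 'a set" where
  "upper_half W h = {x \<in> W. height h x \<ge> 0}"

definition opposite :: "'a::real_inner affine_functional \<Rightarrow> 'a affine_functional" where
  "opposite h = Affine_Functional (- gradient h) (- offset h)"

lemma mem_wall_iff [simp]: "x \<in> wall W h \<longleftrightarrow> x \<in> W \<and> height h x = 0"
  by (simp add: wall_def)

lemma mem_upper_half_iff [simp]: "x \<in> upper_half W h \<longleftrightarrow> x \<in> W \<and> height h x \<ge> 0"
  by (simp add: upper_half_def)

lemma height_opposite [simp]: "height (opposite h) x = - height h x"
  by (simp add: height_def opposite_def)

lemma wall_opposite [simp]: "wall W (opposite h) = wall W h"
  by auto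

lemma affine_wall: "affine W \<Longrightarrow> affine (wall W h)"
proof -
  assume "affine W"
  moreover have "wall W h = W \<inter> {x. gradient h \<bullet> x = offset h}"
    by (auto simp: height_def)
  ultimately show ?thesis
    by (simp add: affine_Int affine_hyperplane)
qed

locale crossing =
  fixes W :: "'a::real_inner set" and h :: "'a affine_functional" and n :: 'a
  assumes affine: "affine W" and wall_nonempty: "wall W h \<noteq> {}"
    and direction: "x \<in> W \<Longrightarrow> x + n \<in> W" and upwards: "gradient h \<bullet> n > 0"
begin

lemma line_mem: "x \<in> W \<Longrightarrow> x + t *\<^sub>R n \<in> W" "x \<in> W \<Longrightarrow> x - t *\<^sub>R n \<in> W"
  using affine_line_mem[OF affine _ direction, of x x t]
    affine_line_mem[OF affine _ direction, of x x "- t"] by auto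

lemma height_line_from_wall:
  assumes "x \<in> wall W h"
  shows "height h (x + t *\<^sub>R n) = t * (gradient h \<bullet> n)"
    "height h (x - t *\<^sub>R n) = - t * (gradient h \<bullet> n)"
  using assms height_add[of h x "t *\<^sub>R n"] height_add[of h x "- (t *\<^sub>R n)"] by auto

lemma height_not_vanishing: "\<not> vanishes_on h W"
proof -
  obtain x where x: "x \<in> wall W h"
    using wall_nonempty by blast
  then have "height h (x + 1 *\<^sub>R n) \<noteq> 0"
    using height_line_from_wall(1)[OF x, of 1] upwards by simp
  moreover have "x + 1 *\<^sub>R n \<in> W"
    using x line_mem(1)[of x 1] by simp
  ultimately show ?thesis
    unfolding vanishes_on_def by blast
qed

lemma crossing_opposite: "crossing W (opposite h) (- n)"
proof
  show "x + - n \<in> W" if "x \<in> W" for x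
    using line_mem(2)[OF that, of 1] by simp
  show "gradient (opposite h) \<bullet> - n > 0"
    using upwards by (simp add: opposite_def)
qed (use affine wall_nonempty in simp_all)

lemma vanishes_on_wall_imp_proportional:
  assumes "vanishes_on k (wall W h)"
  obtains \<kappa> where "\<And>w. w \<in> W \<Longrightarrow> height k w = \<kappa> * height h w"
proof -
  have "height k w = (gradient k \<bullet> n / (gradient h \<bullet> n)) * height h w" if w: "w \<in> W" for w
  proof -
    define t where "t = - (height h w / (gradient h \<bullet> n))"
    have "height h (w + t *\<^sub>R n) = 0"
      using upwards unfolding height_add by (simp add: t_def)
    then have "height k (w + t *\<^sub>R n) = 0"
      using assms line_mem(1)[OF w] by (simp add: vanishes_on_def)
    then show ?thesis
      unfolding height_add by (simp add: t_def)
  qed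
  then show thesis
    by (rule that)
qed

lemma eventually_ray_off_hyperplane:
  assumes "p \<in> wall W h" "regular {k} (wall W h) p" "\<not> vanishes_on k W"
  shows "\<forall>\<^sub>F t in at_right 0. height k (p + t *\<^sub>R n) \<noteq> 0"
proof (cases "height k p = 0")
  case True
  with assms(2) obtain \<kappa> where \<kappa>: "\<And>w. w \<in> W \<Longrightarrow> height k w = \<kappa> * height h w"
    using vanishes_on_wall_imp_proportional by (auto simp: regular_def)
  have "\<kappa> \<noteq> 0"
    using \<kappa> assms(3) by (auto simp: vanishes_on_def)
  have "\<forall>\<^sub>F t in at_right (0::real). t > 0"
    by (rule eventually_at_right_less)
  then show ?thesis
  proof eventually_elim
    case (elim t)
    then show ?case
      using \<kappa>[OF line_mem(1)] height_line_from_wall(1)[OF assms(1)] assms(1) \<open>\<kappa> \<noteq> 0\<close> upwards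
      by simp
  qed
next
  case False
  then show ?thesis
    using eventually_height_line_nonzero[of k p "p + n"] by simp
qed

lemma eventually_generic_ray:
  assumes "\<forall>\<^sub>F x in generic W. P x"
  shows "\<forall>\<^sub>F p in generic (wall W h). \<forall>\<^sub>F t in at_right 0. P (p + t *\<^sub>R n)"
proof (rule eventually_generic_boundedI)
  fix R
  obtain \<Sigma> where \<Sigma>: "finite \<Sigma>" "\<And>x. x \<in> W \<Longrightarrow> norm x < R \<Longrightarrow> regular \<Sigma> W x \<Longrightarrow> P x"
    using eventually_genericE[OF assms] by blast
  show "\<forall>\<^sub>F p in generic (wall W h). norm p < R \<longrightarrow> (\<forall>\<^sub>F t in at_right 0. P (p + t *\<^sub>R n))"
    using eventually_generic_regular[OF \<Sigma>(1)] eventually_generic_mem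
  proof eventually_elim
    case (elim p)
    show ?case
    proof
      assume "norm p < R"
      then have "\<forall>\<^sub>F t in at_right 0. p + t *\<^sub>R n \<in> ball 0 R"
        by (intro eventually_at_right_line_in_open) auto
      moreover have "\<forall>\<^sub>F t in at_right 0. \<forall>k\<in>{k\<in>\<Sigma>. \<not> vanishes_on k W}. height k (p + t *\<^sub>R n) \<noteq> 0"
        using elim \<Sigma>(1)
        by (intro eventually_ball_finite ballI eventually_ray_off_hyperplane)
          (auto simp: regular_def)
      ultimately show "\<forall>\<^sub>F t in at_right 0. P (p + t *\<^sub>R n)"
        by eventually_elim (rule \<Sigma>(2), use elim(2) line_mem(1) in \<open>auto simp: regular_def\<close>)
    qed
  qed
qed

lemma same_side_near_regular_point:
  assumes "finite \<Sigma>" "regular \<Sigma> (wall W h) p"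
  obtains e where "e > 0"
    "\<And>x y. x \<in> W \<Longrightarrow> y \<in> W \<Longrightarrow> dist p x < e \<Longrightarrow> dist p y < e \<Longrightarrow>
      sgn (height h x) = sgn (height h y) \<Longrightarrow> same_side \<Sigma> x y"
proof -
  have "\<forall>\<^sub>F z in nhds p. \<forall>k\<in>\<Sigma>. height k p \<noteq> 0 \<longrightarrow> sgn (height k z) = sgn (height k p)"
    using eventually_sgn_height by (intro eventually_ball_finite assms(1) ballI)
      (auto elim: eventually_mono)
  then obtain e where e: "e > 0" and near: "\<And>z k. dist z p < e \<Longrightarrow> k \<in> \<Sigma> \<Longrightarrow> height k p \<noteq> 0 \<Longrightarrow>
      sgn (height k z) = sgn (height k p)"
    unfolding eventually_nhds_metric by blast
  have "same_side \<Sigma> x y" if xy: "x \<in> W" "y \<in> W" "dist p x < e" "dist p y < e"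
    "sgn (height h x) = sgn (height h y)" for x y
    unfolding same_side_def
  proof
    fix k
    assume k: "k \<in> \<Sigma>"
    show "sgn (height k x) = sgn (height k y)"
    proof (cases "height k p = 0")
      case True
      then obtain \<kappa> where "\<And>w. w \<in> W \<Longrightarrow> height k w = \<kappa> * height h w"
        using vanishes_on_wall_imp_proportional assms(2) k unfolding regular_def by blast
      then show ?thesis
        using xy by (simp add: sgn_mult)
    next
      case False
      then show ?thesis
        using near[OF _ k] xy by (simp add: dist_commute)
    qed
  qed
  then show thesis
    using that e by blast
qed

lemma adapted_on_two_sided:
  assumes "finite \<Sigma>" "adapted_on \<Sigma> X u" "open X" "p \<in> X" "p \<in> wall W h"
    and "regular \<Sigma> (wall W h) p"
  obtains e a b where "e > 0" "ball p e \<subseteq> X"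
    "\<And>z. z \<in> W \<Longrightarrow> dist p z < e \<Longrightarrow> height h z > 0 \<Longrightarrow> u z = a"
    "\<And>z. z \<in> W \<Longrightarrow> dist p z < e \<Longrightarrow> height h z < 0 \<Longrightarrow> u z = b"
proof -
  obtain d where d: "d > 0" "\<And>x y. x \<in> W \<Longrightarrow> y \<in> W \<Longrightarrow> dist p x < d \<Longrightarrow> dist p y < d \<Longrightarrow>
      sgn (height h x) = sgn (height h y) \<Longrightarrow> same_side \<Sigma> x y"
    using same_side_near_regular_point[OF assms(1,6)] by blast
  obtain d' where "d' > 0" "ball p d' \<subseteq> X"
    using assms(3,4) open_contains_ball by blast
  define e where "e = min d d'"
  have e: "e > 0" "ball p e \<subseteq> X" "e \<le> d"
    using d(1) \<open>d' > 0\<close> \<open>ball p d' \<subseteq> X\<close> by (auto simp: e_def)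
  have const: "u x = u y" if "x \<in> W" "y \<in> W" "dist p x < e" "dist p y < e"
    "sgn (height h x) = sgn (height h y)" for x y
  proof (rule adapted_onD[OF assms(2)])
    show "same_side \<Sigma> x y"
      using that e(3) by (intro d(2)) auto
  qed (use that e(2) in auto)
  have "\<forall>\<^sub>F t in at_right 0. p + t *\<^sub>R n \<in> ball p e \<and> p - t *\<^sub>R n \<in> ball p e"
    using e(1) by (intro eventually_conj eventually_at_right_line_in_open) auto
  then obtain t where t: "t > 0" "p + t *\<^sub>R n \<in> ball p e" "p - t *\<^sub>R n \<in> ball p e"
    using eventually_at_right_happens by blast
  show thesis
  proof (rule that[OF e(1,2)])
    fix z
    assume z: "z \<in> W" "dist p z < e"
    show "u z = u (p + t *\<^sub>R n)" if "height h z > 0"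
      using that t z assms(5) upwards height_line_from_wall(1)[OF assms(5), of t]
      by (intro const line_mem) auto
    show "u z = u (p - t *\<^sub>R n)" if "height h z < 0"
      using that t z assms(5) upwards height_line_from_wall(2)[OF assms(5), of t]
      by (intro const line_mem) auto
  qed
qed

end

definition jump :: "'a::real_normed_vector \<Rightarrow> ('a \<Rightarrow> 'b::{t2_space,ab_group_add}) \<Rightarrow> 'a \<Rightarrow> 'b" where
  "jump n u x = Lim (at_right 0) (\<lambda>t. u (x + t *\<^sub>R n) - u (x - t *\<^sub>R n))"

lemma jump_eqI:
  assumes "\<forall>\<^sub>F t in at_right 0. u (x + t *\<^sub>R n) - u (x - t *\<^sub>R n) = c"
  shows "jump n u x = c"
  unfolding jump_def by (intro tendsto_Lim tendsto_eventually assms) simp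

lemma jump_cong:
  assumes "\<forall>\<^sub>F t in at_right 0.
    u (x + t *\<^sub>R n) - u (x - t *\<^sub>R n) = v (y + t *\<^sub>R n) - v (y - t *\<^sub>R n)"
  shows "jump n u x = jump n v y"
  unfolding jump_def Topological_Spaces.Lim_def using tendsto_cong[OF assms] by simp

lemma jump_cong_open:
  assumes "open X" "x \<in> X" "\<And>y. y \<in> X \<Longrightarrow> u y = v y"
  shows "jump n u x = jump n v x"
proof (rule jump_cong)
  show "\<forall>\<^sub>F t in at_right 0. u (x + t *\<^sub>R n) - u (x - t *\<^sub>R n) = v (x + t *\<^sub>R n) - v (x - t *\<^sub>R n)"
    using eventually_at_right_line_in_open[OF assms(1,2), of n]
    by eventually_elim (use assms(3) in simp)
qed

lemma jump_translate: "jump n (\<lambda>x. u (x + l)) x = jump n u (x + l)"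
  unfolding jump_def by (simp add: algebra_simps)

lemma jump_const [simp]: "jump n (\<lambda>_. c) = (\<lambda>_. 0)"
  by (intro ext jump_eqI) simp

lemma adapted_on_jump:
  assumes "finite \<Sigma>" "open X" "adapted_on \<Sigma> X u"
  shows "adapted_on \<Sigma> X (jump n u)"
  unfolding adapted_on_def
proof (intro ballI impI jump_cong)
  fix x y
  assume xy: "x \<in> X" "y \<in> X" "same_side \<Sigma> x y"
  have "\<forall>\<^sub>F t in at_right 0. u (x + t *\<^sub>R m) = u (y + t *\<^sub>R m)" for m
    using eventually_at_right_line[OF eventually_same_side_translate[OF assms(1) xy(3)], of m]
      eventually_at_right_line_in_open(1)[OF assms(2) xy(1), of m]
      eventually_at_right_line_in_open(1)[OF assms(2) xy(2), of m]
    by eventually_elim (use assms(3) in \<open>auto intro: adapted_onD\<close>)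
  from this[of n] this[of "- n"]
  show "\<forall>\<^sub>F t in at_right 0. u (x + t *\<^sub>R n) - u (x - t *\<^sub>R n) = u (y + t *\<^sub>R n) - u (y - t *\<^sub>R n)"
    by eventually_elim simp
qed

lemma locally_adapted_jump: "locally_adapted u \<Longrightarrow> locally_adapted (jump n u)"
  using adapted_on_jump unfolding locally_adapted_def by (metis open_ball)

lemma locally_adapted_eventually_const:
  assumes "locally_adapted u"
  shows "\<exists>c. \<forall>\<^sub>F t in at_right 0. u (x + t *\<^sub>R n) = c"
proof -
  obtain \<Sigma> where \<Sigma>: "finite \<Sigma>" "adapted_on \<Sigma> (ball 0 (norm x + 1)) u"
    using locally_adaptedE[OF assms] .
  have "\<exists>s. \<forall>\<^sub>F t in at_right 0. sgn (height h (x + t *\<^sub>R n)) = s" for h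
  proof (cases "height h x = 0")
    case True
    have "\<forall>\<^sub>F t in at_right (0::real). t > 0"
      by (rule eventually_at_right_less)
    then have "\<forall>\<^sub>F t in at_right 0. sgn (height h (x + t *\<^sub>R n)) = sgn (gradient h \<bullet> n)"
      by eventually_elim (simp add: True height_add sgn_mult)
    then show ?thesis
      by blast
  next
    case False
    then show ?thesis
      using eventually_at_right_line[OF eventually_sgn_height[OF False]] by blast
  qed
  then obtain s where "\<And>h. \<forall>\<^sub>F t in at_right 0. sgn (height h (x + t *\<^sub>R n)) = s h"
    by metis
  then have ev: "\<forall>\<^sub>F t in at_right 0. x + t *\<^sub>R n \<in> ball 0 (norm x + 1) \<and>
      (\<forall>h\<in>\<Sigma>. sgn (height h (x + t *\<^sub>R n)) = s h)"
    using \<Sigma>(1)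
    by (intro eventually_conj eventually_ball_finite eventually_at_right_line_in_open) auto
  then obtain t0 where t0: "x + t0 *\<^sub>R n \<in> ball 0 (norm x + 1)"
    "\<forall>h\<in>\<Sigma>. sgn (height h (x + t0 *\<^sub>R n)) = s h"
    using eventually_at_right_happens by blast
  from ev have "\<forall>\<^sub>F t in at_right 0. u (x + t *\<^sub>R n) = u (x + t0 *\<^sub>R n)"
    by eventually_elim (rule adapted_onD[OF \<Sigma>(2)], use t0 in \<open>simp_all add: same_side_def\<close>)
  then show ?thesis
    by blast
qed

lemma eventually_eq_jump:
  assumes "locally_adapted u"
  shows "\<forall>\<^sub>F t in at_right 0. u (x + t *\<^sub>R n) - u (x - t *\<^sub>R n) = jump n u x"
proof -
  obtain c d where "\<forall>\<^sub>F t in at_right 0. u (x + t *\<^sub>R n) = c"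
    "\<forall>\<^sub>F t in at_right 0. u (x + t *\<^sub>R (- n)) = d"
    using locally_adapted_eventually_const[OF assms] by blast
  then have ev: "\<forall>\<^sub>F t in at_right 0. u (x + t *\<^sub>R n) - u (x - t *\<^sub>R n) = c - d"
    by eventually_elim simp
  then show ?thesis
    by (simp add: jump_eqI[OF ev])
qed

lemma jump_sum:
  assumes "finite I" "\<And>i. i \<in> I \<Longrightarrow> locally_adapted (u i)"
  shows "jump n (\<lambda>x. \<Sum>i\<in>I. u i x) x = (\<Sum>i\<in>I. jump n (u i) x)"
proof (rule jump_eqI)
  have "\<forall>\<^sub>F t in at_right 0. \<forall>i\<in>I. u i (x + t *\<^sub>R n) - u i (x - t *\<^sub>R n) = jump n (u i) x"
    by (intro eventually_ball_finite ballI assms eventually_eq_jump)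
  then show "\<forall>\<^sub>F t in at_right 0. (\<Sum>i\<in>I. u i (x + t *\<^sub>R n)) - (\<Sum>i\<in>I. u i (x - t *\<^sub>R n)) =
      (\<Sum>i\<in>I. jump n (u i) x)"
    by eventually_elim (simp flip: sum_subtractf)
qed

lemma jump_cmult:
  fixes u :: "'a::real_inner \<Rightarrow> 'b::{t2_space,ring}"
  assumes "locally_adapted u"
  shows "jump n (\<lambda>x. c * u x) x = c * jump n u x"
proof (rule jump_eqI)
  show "\<forall>\<^sub>F t in at_right 0. c * u (x + t *\<^sub>R n) - c * u (x - t *\<^sub>R n) = c * jump n u x"
    using eventually_eq_jump[OF assms, of x n] by eventually_elim (simp flip: right_diff_distrib)
qed

context crossing
begin

lemma eventually_jump_cong:
  fixes u v :: "'a \<Rightarrow> 'b::{t2_space,ab_group_add}"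
  assumes "\<forall>\<^sub>F x in generic W. u x = v x"
  shows "\<forall>\<^sub>F p in generic (wall W h). jump n u p = jump n v p"
proof -
  interpret opp: crossing W "opposite h" "- n"
    by (rule crossing_opposite)
  have "\<forall>\<^sub>F p in generic (wall W h). \<forall>\<^sub>F t in at_right 0. u (p + t *\<^sub>R n) = v (p + t *\<^sub>R n)"
    by (rule eventually_generic_ray[OF assms])
  moreover have "\<forall>\<^sub>F p in generic (wall W h).
      \<forall>\<^sub>F t in at_right 0. u (p - t *\<^sub>R n) = v (p - t *\<^sub>R n)"
    using opp.eventually_generic_ray[OF assms] by simp
  ultimately show ?thesis
  proof eventually_elim
    case (elim p)
    then show ?case
      by (intro jump_cong) (auto elim: eventually_elim2)
  qed
qed

lemma jump_eq_two_sided: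
  fixes u :: "'a \<Rightarrow> 'b::{t2_space,ab_group_add}"
  assumes "p \<in> wall W h" "e > 0"
    and "\<And>z. z \<in> W \<Longrightarrow> dist p z < e \<Longrightarrow> height h z > 0 \<Longrightarrow> u z = a"
    and "\<And>z. z \<in> W \<Longrightarrow> dist p z < e \<Longrightarrow> height h z < 0 \<Longrightarrow> u z = b"
  shows "jump n u p = a - b"
proof (rule jump_eqI)
  have "\<forall>\<^sub>F t in at_right 0. p + t *\<^sub>R n \<in> ball p e" "\<forall>\<^sub>F t in at_right 0. p - t *\<^sub>R n \<in> ball p e"
    using assms(2) by (intro eventually_at_right_line_in_open; simp)+
  with eventually_at_right_less[of "0::real"]
  show "\<forall>\<^sub>F t in at_right 0. u (p + t *\<^sub>R n) - u (p - t *\<^sub>R n) = a - b"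
  proof eventually_elim
    case (elim t)
    then show ?case
      using assms(1) upwards assms(3)[OF line_mem(1)] assms(4)[OF line_mem(2)]
        height_line_from_wall[OF assms(1), of t] by simp
  qed
qed

end

definition crosses ::
    "'a::real_inner set \<Rightarrow> 'a set \<Rightarrow> 'a set \<Rightarrow> 'a \<Rightarrow> bool" where
  "crosses W V H n \<longleftrightarrow> (\<exists>h. crossing W h n \<and> V = wall W h \<and> H = upper_half W h)"

lemma crossing_exists:
  assumes "affine W" "wall W h \<noteq> {}" "\<not> vanishes_on h W"
  obtains n where "crossing W h n"
proof -
  obtain x0 where x0: "x0 \<in> W" "height h x0 = 0"
    using assms(2) by auto
  obtain w where w: "w \<in> W" "height h w \<noteq> 0"
    using assms(3) by (auto simp: vanishes_on_def)
  have "crossing W h (height h w *\<^sub>R (w - x0))"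
  proof
    show "x + height h w *\<^sub>R (w - x0) \<in> W" if "x \<in> W" for x
      by (rule mem_affine_3_minus[OF assms(1) that w(1) x0(1)])
    have "gradient h \<bullet> (height h w *\<^sub>R (w - x0)) = height h w * height h w"
      using x0(2) by (simp flip: height_diff)
    then show "gradient h \<bullet> (height h w *\<^sub>R (w - x0)) > 0"
      using w(2) by (metis not_real_square_gt_zero)
  qed (use assms in auto)
  then show thesis
    by (rule that)
qed

section \<open>Functions without jumps\<close>

lemma connected_const_on_dense:
  fixes S :: "'a::metric_space set"
  assumes "connected S"
    and dense: "\<And>p e. p \<in> S \<Longrightarrow> e > 0 \<Longrightarrow> \<exists>z\<in>S. dist p z < e \<and> P z"
    and local: "\<And>p. p \<in> S \<Longrightarrow> \<exists>e>0. \<exists>c. \<forall>z\<in>S. dist p z < e \<longrightarrow> P z \<longrightarrow> u z = c"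
    and xy: "x \<in> S" "y \<in> S" "P x" "P y"
  shows "u x = u y"
proof (rule connected_induction[OF assms(1), where P = P and Q = "\<lambda>z. u x = u z"])
  fix T a
  assume "openin (top_of_set S) T" "a \<in> T"
  then obtain e where "a \<in> S" "e > 0" "\<forall>z\<in>S. dist z a < e \<longrightarrow> z \<in> T"
    unfolding openin_euclidean_subtopology_iff by blast
  then show "\<exists>z. z \<in> T \<and> P z"
    using dense[of a e] by (auto simp: dist_commute)
next
  fix a
  assume "a \<in> S"
  then obtain e c where ec: "e > 0" "\<forall>z\<in>S. dist a z < e \<longrightarrow> P z \<longrightarrow> u z = c"
    using local by blast
  show "\<exists>T. openin (top_of_set S) T \<and> a \<in> T \<and>
      (\<forall>z\<in>T. \<forall>z'\<in>T. P z \<and> P z' \<and> u x = u z \<longrightarrow> u x = u z')"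
  proof (intro exI conjI ballI impI)
    show "openin (top_of_set S) (S \<inter> ball a e)"
      by (simp add: openin_open_Int)
    show "a \<in> S \<inter> ball a e"
      using \<open>a \<in> S\<close> ec(1) by simp
  next
    fix z z'
    assume "z \<in> S \<inter> ball a e" "z' \<in> S \<inter> ball a e" "P z \<and> P z' \<and> u x = u z"
    then show "u x = u z'"
      using ec(2) by auto
  qed
qed (use xy in auto)

text \<open>The functional \<open>cone k\<close> vanishes at \<open>x\<close> and wherever both \<open>h\<close> and \<open>k\<close> do, hence at all \<open>y\<close>
  for which the line through \<open>x\<close> and \<open>y\<close> meets the intersection of their hyperplanes.\<close>

lemma eventually_generic_line_meets_wall:
  assumes "height h x \<noteq> 0" "\<forall>\<^sub>F p in generic (wall W h). P p"
  shows "\<forall>\<^sub>F y in generic W. \<forall>t. x + t *\<^sub>R (y - x) \<in> wall W h \<inter> ball 0 R \<longrightarrow> P (x + t *\<^sub>R (y - x))"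
proof -
  obtain \<Sigma> where \<Sigma>: "finite \<Sigma>"
    "\<And>p. p \<in> wall W h \<Longrightarrow> norm p < R \<Longrightarrow> regular \<Sigma> (wall W h) p \<Longrightarrow> P p"
    using eventually_genericE[OF assms(2)] by blast
  define cone where "cone k = Affine_Functional
      (height h x *\<^sub>R gradient k - height k x *\<^sub>R gradient h)
      (height h x * offset k - height k x * offset h)" for k
  have cone: "height (cone k) z = height h x * height k z - height k x * height h z" for k z
    by (simp add: cone_def height_def inner_diff_left algebra_simps)
  have cone_line: "height (cone k) (x + t *\<^sub>R (y - x)) = t * height (cone k) y" for k t y
    unfolding height_line by (simp add: cone)
  have "\<forall>\<^sub>F y in generic W. regular (cone ` \<Sigma>) W y"
    by (intro eventually_generic_regular finite_imageI \<Sigma>(1))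
  then show ?thesis
  proof eventually_elim
    case (elim y)
    show ?case
    proof (intro allI impI)
      fix t
      assume p: "x + t *\<^sub>R (y - x) \<in> wall W h \<inter> ball 0 R"
      then have "t \<noteq> 0"
        using assms(1) by auto
      have "vanishes_on k (wall W h)" if k: "k \<in> \<Sigma>" "height k (x + t *\<^sub>R (y - x)) = 0" for k
      proof -
        have "height (cone k) (x + t *\<^sub>R (y - x)) = 0"
          using p k(2) unfolding cone by simp
        then have "height (cone k) y = 0"
          using \<open>t \<noteq> 0\<close> unfolding cone_line by simp
        then have "vanishes_on (cone k) W"
          using elim k(1) by (simp add: regular_def)
        then show ?thesis
          using assms(1) unfolding vanishes_on_def cone by force
      qed
      then show "P (x + t *\<^sub>R (y - x))"
        using p \<Sigma>(2) by (auto simp: regular_def)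
    qed
  qed
qed

lemma (in crossing) const_near_jumpless_point:
  fixes u :: "'a \<Rightarrow> 'b::{t2_space,ab_group_add}"
  assumes "finite \<Sigma>" "adapted_on \<Sigma> X u" "open X" "p \<in> X" "p \<in> wall W h"
    and "regular \<Sigma> (wall W h) p" "jump n u p = 0"
  obtains e c where "e > 0" "\<And>z. z \<in> W \<Longrightarrow> dist p z < e \<Longrightarrow> height h z \<noteq> 0 \<Longrightarrow> u z = c"
proof -
  obtain e a b where e: "e > 0"
    and sides: "\<And>z. z \<in> W \<Longrightarrow> dist p z < e \<Longrightarrow> height h z > 0 \<Longrightarrow> u z = a"
      "\<And>z. z \<in> W \<Longrightarrow> dist p z < e \<Longrightarrow> height h z < 0 \<Longrightarrow> u z = b"
    using adapted_on_two_sided[OF assms(1-6)] by metis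
  have "a = b"
    using jump_eq_two_sided[OF assms(5) e sides] assms(7) by simp
  then have "u z = a" if "z \<in> W" "dist p z < e" "height h z \<noteq> 0" for z
    using sides[of z] that \<open>a = b\<close> by (cases "height h z > 0") auto
  then show thesis
    using that e by blast
qed

definition const_near_regular ::
    "'a::real_inner affine_functional set \<Rightarrow> 'a set \<Rightarrow> ('a \<Rightarrow> 'b) \<Rightarrow> 'a \<Rightarrow> bool" where
  "const_near_regular \<Sigma> W u p \<longleftrightarrow>
     (\<exists>e>0. \<exists>c. \<forall>z\<in>W. dist p z < e \<longrightarrow> regular \<Sigma> W z \<longrightarrow> u z = c)"

lemma regular_imp_const_near_regular:
  assumes "finite \<Sigma>" "adapted_on \<Sigma> X u" "open X" "p \<in> W" "p \<in> X" "regular \<Sigma> W p"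
  shows "const_near_regular \<Sigma> W u p"
  using locally_const_at_regular_point[OF assms]
  unfolding const_near_regular_def eventually_nhds_metric by (metis dist_commute)

lemma eventually_generic_wall_const_near_regular:
  fixes u :: "'a::real_inner \<Rightarrow> 'b::{t2_space,ab_group_add}"
  assumes "affine W" "finite \<Sigma>" "adapted_on \<Sigma> X u" "open X" "h \<in> \<Sigma>" "\<not> vanishes_on h W"
    and jumpless: "\<And>n. crossing W h n \<Longrightarrow> \<forall>\<^sub>F p in generic (wall W h). jump n u p = 0"
  shows "\<forall>\<^sub>F p in generic (wall W h). p \<in> X \<longrightarrow> const_near_regular \<Sigma> W u p"
proof (cases "wall W h = {}")
  case True
  then show ?thesis
    using eventually_generic_mem[of "wall W h"] by (auto elim: eventually_mono)
next
  case False
  then obtain n where n: "crossing W h n"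
    using crossing_exists assms(1,6) by blast
  show ?thesis
    using jumpless[OF n] eventually_generic_regular[OF assms(2)] eventually_generic_mem
  proof eventually_elim
    case (elim p)
    show ?case
    proof
      assume "p \<in> X"
      obtain e c where "e > 0" "\<And>z. z \<in> W \<Longrightarrow> dist p z < e \<Longrightarrow> height h z \<noteq> 0 \<Longrightarrow> u z = c"
        using crossing.const_near_jumpless_point[OF n assms(2-4) \<open>p \<in> X\<close> elim(3,2,1)] by blast
      moreover have "height h z \<noteq> 0" if "regular \<Sigma> W z" for z
        using that assms(5,6) by (auto simp: regular_def)
      ultimately show "const_near_regular \<Sigma> W u p"
        unfolding const_near_regular_def by blast
    qed
  qed
qed

lemma const_on_convex_if_const_near_regular:
  fixes S :: "'a::real_inner set"
  assumes "convex S" "S \<subseteq> W" "finite \<Sigma>" "\<And>p. p \<in> S \<Longrightarrow> const_near_regular \<Sigma> W u p"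
    and x: "x \<in> S" "regular \<Sigma> W x" and y: "y \<in> S" "regular \<Sigma> W y"
  shows "u x = u y"
proof (rule connected_const_on_dense[where P = "regular \<Sigma> W"])
  show "connected S"
    using assms(1) by (rule convex_connected)
  show "\<exists>z\<in>S. dist p z < e \<and> regular \<Sigma> W z" if "p \<in> S" "e > 0" for p e
    using regular_dense_in_convex[OF assms(1,3) x that] .
  show "\<exists>e>0. \<exists>c. \<forall>z\<in>S. dist p z < e \<longrightarrow> regular \<Sigma> W z \<longrightarrow> u z = c" if "p \<in> S" for p
    using assms(4)[OF that] assms(2) unfolding const_near_regular_def by (meson subsetD)
qed (use x y in auto)

text \<open>A generic segment issuing from \<open>x\<close> meets the hyperplanes of \<open>\<Sigma>\<close> only in points near which
  the two sides of a single hyperplane carry the same value.\<close>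

lemma jumpless_imp_generically_const_on_ball:
  fixes u :: "'a::real_inner \<Rightarrow> 'b::{t2_space,ab_group_add}"
  assumes "affine W" and \<Sigma>: "finite \<Sigma>" "adapted_on \<Sigma> (ball 0 R) u"
    and jumpless: "\<And>h n. crossing W h n \<Longrightarrow> \<forall>\<^sub>F p in generic (wall W h). jump n u p = 0"
    and x: "x \<in> W" "norm x < R" "regular \<Sigma> W x"
  shows "\<forall>\<^sub>F y in generic W. norm y < R \<longrightarrow> u y = u x"
proof -
  define \<Sigma>' where "\<Sigma>' = {h\<in>\<Sigma>. \<not> vanishes_on h W}"
  have "\<forall>\<^sub>F y in generic W. \<forall>h\<in>\<Sigma>'. \<forall>t. x + t *\<^sub>R (y - x) \<in> wall W h \<inter> ball 0 R \<longrightarrow>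
      x + t *\<^sub>R (y - x) \<in> ball 0 R \<longrightarrow> const_near_regular \<Sigma> W u (x + t *\<^sub>R (y - x))"
    using x(3) \<Sigma>(1) jumpless
    by (intro eventually_ball_finite ballI eventually_generic_line_meets_wall
          eventually_generic_wall_const_near_regular[OF assms(1) \<Sigma>]) (auto simp: \<Sigma>'_def regular_def)
  with eventually_generic_regular[OF \<Sigma>(1)] eventually_generic_mem show ?thesis
  proof eventually_elim
    case (elim y)
    show ?case
    proof
      assume y: "norm y < R"
      have "closed_segment x y \<subseteq> W \<inter> ball 0 R"
        using x elim(2) y
        by (intro closed_segment_subset convex_Int affine_imp_convex assms(1) convex_ball) auto
      then have S: "closed_segment x y \<subseteq> W" "closed_segment x y \<subseteq> ball 0 R"
        by auto
      have "const_near_regular \<Sigma> W u p" if p: "p \<in> closed_segment x y" for p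
      proof (cases "regular \<Sigma> W p")
        case True
        then show ?thesis
          using regular_imp_const_near_regular[OF \<Sigma> open_ball] S p by blast
      next
        case False
        then obtain h where "h \<in> \<Sigma>'" "p \<in> wall W h"
          using S p by (auto simp: regular_def \<Sigma>'_def)
        moreover obtain t where "p = x + t *\<^sub>R (y - x)"
          using p by (auto simp: in_segment algebra_simps)
        ultimately show ?thesis
          using elim(3) S p by blast
      qed
      then show "u y = u x"
        using x(3) elim(1) by (intro const_on_convex_if_const_near_regular[OF _ S(1) \<Sigma>(1)]) auto
    qed
  qed
qed

theorem jumpless_imp_generically_const:
  fixes u :: "'a::real_inner \<Rightarrow> 'b::{t2_space,ab_group_add}"
  assumes "affine W" "W \<noteq> {}" "locally_adapted u"
    and jumpless: "\<And>h n. crossing W h n \<Longrightarrow> \<forall>\<^sub>F p in generic (wall W h). jump n u p = 0"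
  shows "\<exists>c. \<forall>\<^sub>F x in generic W. u x = c"
proof -
  obtain x0 where "x0 \<in> W"
    using assms(2) by blast
  obtain \<Sigma>0 where \<Sigma>0: "finite \<Sigma>0" "adapted_on \<Sigma>0 (ball 0 (norm x0 + 1)) u"
    using locally_adaptedE[OF assms(3)] .
  obtain x1 where x1: "x1 \<in> W" "dist x0 x1 < 1" "regular \<Sigma>0 W x1"
    using eventually_generic_dense[OF assms(1) \<open>x0 \<in> W\<close> zero_less_one
        eventually_generic_regular[OF \<Sigma>0(1)]] by blast
  have "x1 \<in> ball 0 (norm x0 + 1)"
    using x1(2) norm_triangle_ineq2[of x1 x0] by (simp add: dist_norm norm_minus_commute)
  then have "\<forall>\<^sub>F z in nhds x1. z \<in> W \<longrightarrow> u z = u x1"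
    using x1 by (intro locally_const_at_regular_point[OF \<Sigma>0]) auto
  then obtain e where e: "e > 0" "\<And>z. dist x1 z < e \<Longrightarrow> z \<in> W \<Longrightarrow> u z = u x1"
    unfolding eventually_nhds_metric by (metis dist_commute)
  have "\<forall>\<^sub>F y in generic W. norm y < R \<longrightarrow> u y = u x1" for R
  proof -
    define R' where "R' = max R (norm x1 + e)"
    obtain \<Sigma> where \<Sigma>: "finite \<Sigma>" "adapted_on \<Sigma> (ball 0 R') u"
      using locally_adaptedE[OF assms(3)] .
    obtain x where x: "x \<in> W" "dist x1 x < e" "regular \<Sigma> W x"
      using eventually_generic_dense[OF assms(1) x1(1) e(1)
          eventually_generic_regular[OF \<Sigma>(1)]] by blast
    have "norm x < R'"
      using x(2) norm_triangle_ineq2[of x x1] by (simp add: R'_def dist_norm norm_minus_commute)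
    then have "\<forall>\<^sub>F y in generic W. norm y < R' \<longrightarrow> u y = u x"
      using x by (intro jumpless_imp_generically_const_on_ball[OF assms(1) \<Sigma> jumpless]) auto
    then show ?thesis
      by eventually_elim (use e(2) x in \<open>auto simp: R'_def\<close>)
  qed
  then have "\<forall>\<^sub>F y in generic W. u y = u x1"
    by (rule eventually_generic_boundedI)
  then show ?thesis
    by blast
qed

section \<open>Facets\<close>

lemma half_space_of_iff:
  "half_space_of W V H \<longleftrightarrow>
    (\<exists>h. V = wall W h \<and> H = upper_half W h \<and> wall W h \<noteq> {} \<and> \<not> vanishes_on h W)"
proof
  assume "half_space_of W V H"
  then obtain a b where "V \<noteq> {}" "V \<noteq> W" "V = {x\<in>W. a \<bullet> x = b}" "H = {x\<in>W. a \<bullet> x \<ge> b}"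
    unfolding half_space_of_def by blast
  then show "\<exists>h. V = wall W h \<and> H = upper_half W h \<and> wall W h \<noteq> {} \<and> \<not> vanishes_on h W"
    by (intro exI[of _ "Affine_Functional a b"]) (auto simp: height_def vanishes_on_def)
next
  assume "\<exists>h. V = wall W h \<and> H = upper_half W h \<and> wall W h \<noteq> {} \<and> \<not> vanishes_on h W"
  then obtain h where h: "V = wall W h" "H = upper_half W h" "wall W h \<noteq> {}" "\<not> vanishes_on h W"
    by blast
  then have "V = {x\<in>W. gradient h \<bullet> x = offset h}" "H = {x\<in>W. gradient h \<bullet> x \<ge> offset h}" "V \<noteq> W"
    by (auto simp: height_def vanishes_on_def)
  then show "half_space_of W V H"
    unfolding half_space_of_def using h(1,3) by blast
qed

lemma half_space_ofE:
  assumes "half_space_of W V H"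
  obtains h where "V = wall W h" "H = upper_half W h" "wall W h \<noteq> {}" "\<not> vanishes_on h W"
  using assms unfolding half_space_of_iff by blast

lemma half_space_of_imp_affine: "half_space_of W V H \<Longrightarrow> affine W \<Longrightarrow> affine V"
  using affine_wall by (auto elim!: half_space_ofE)

lemma half_space_of_translate:
  assumes "half_space_of W V H"
  shows "half_space_of ((+) l ` W) ((+) l ` V) ((+) l ` H)"
proof -
  obtain h where h: "V = wall W h" "H = upper_half W h" "wall W h \<noteq> {}" "\<not> vanishes_on h W"
    using half_space_ofE[OF assms] .
  have wall: "(+) l ` wall W h = wall ((+) l ` W) (shift_functional (- l) h)"
    by auto
  show ?thesis
    unfolding half_space_of_iff
  proof (intro exI conjI)
    show "(+) l ` V = wall ((+) l ` W) (shift_functional (- l) h)"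
      by (simp add: h(1) wall)
    show "(+) l ` H = upper_half ((+) l ` W) (shift_functional (- l) h)"
      by (auto simp: h(2))
    show "wall ((+) l ` W) (shift_functional (- l) h) \<noteq> {}"
      using h(3) by (simp flip: wall)
    show "\<not> vanishes_on (shift_functional (- l) h) ((+) l ` W)"
      using h(4) by (simp add: vanishes_on_def)
  qed
qed

lemma agree_near_iff_eventually: "agree_near x P Q \<longleftrightarrow> (\<forall>\<^sub>F y in nhds x. y \<in> P \<longleftrightarrow> y \<in> Q)"
  unfolding agree_near_def eventually_nhds_metric set_eq_iff by (auto simp: dist_commute)

lemma agree_near_trans: "agree_near x P Q \<Longrightarrow> agree_near x P Q' \<Longrightarrow> agree_near x Q Q'"
  unfolding agree_near_iff_eventually by (auto elim: eventually_elim2)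

lemma agree_near_imp_mem_iff: "agree_near x P Q \<Longrightarrow> x \<in> P \<longleftrightarrow> x \<in> Q"
  unfolding agree_near_iff_eventually by (rule eventually_nhds_x_imp_x)

lemma eventually_agree_near: "agree_near x P Q \<Longrightarrow> \<forall>\<^sub>F y in nhds x. agree_near y P Q"
  unfolding agree_near_iff_eventually by (simp add: eventually_eventually)

lemma half_space_of_unique_near:
  assumes "affine W" and hs: "half_space_of W V H" "half_space_of W V' H'"
    and x: "x \<in> V" "x \<in> V'" and near: "agree_near x H H'"
  shows "V = V'" "H = H'"
proof -
  obtain h where h: "V = wall W h" "H = upper_half W h"
    using half_space_ofE[OF hs(1)] .
  obtain h' where h': "V' = wall W h'" "H' = upper_half W h'"
    using half_space_ofE[OF hs(2)] .
  have same: "height h w \<ge> 0 \<longleftrightarrow> height h' w \<ge> 0" if w: "w \<in> W" for w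
  proof -
    have "\<forall>\<^sub>F t in at_right 0. x + t *\<^sub>R (w - x) \<in> H \<longleftrightarrow> x + t *\<^sub>R (w - x) \<in> H'"
      using near unfolding agree_near_iff_eventually by (rule eventually_at_right_line)
    then obtain t where "t > 0" "x + t *\<^sub>R (w - x) \<in> H \<longleftrightarrow> x + t *\<^sub>R (w - x) \<in> H'"
      using eventually_at_right_happens by blast
    then show ?thesis
      using x affine_line_mem[OF assms(1) _ w, of x t]
      by (simp add: h h' height_line zero_le_mult_iff)
  qed
  then show "H = H'"
    by (auto simp: h h')
  have "height h w = 0 \<longleftrightarrow> height h' w = 0" if w: "w \<in> W" for w
  proof -
    have "x + (-1) *\<^sub>R (w - x) \<in> W"
      using x w by (intro affine_line_mem[OF assms(1)]) (auto simp: h)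
    from same[OF this] have "height h w \<le> 0 \<longleftrightarrow> height h' w \<le> 0"
      using x unfolding height_line by (simp add: h h')
    then show ?thesis
      using same[OF w] by linarith
  qed
  then show "V = V'"
    by (auto simp: h h')
qed

lemma facet_pointsE:
  assumes "x \<in> facet_points P"
  obtains V H where "half_space_of (affine hull P) V H" "x \<in> V" "agree_near x P H"
  using assms unfolding facet_points_def by blast

lemma facet_pointsI:
  "half_space_of (affine hull P) V H \<Longrightarrow> x \<in> V \<Longrightarrow> agree_near x P H \<Longrightarrow> x \<in> facet_points P"
  unfolding facet_points_def by blast

lemma facet_points_subset: "facet_points P \<subseteq> P"
proof
  fix x
  assume "x \<in> facet_points P"
  then obtain V H where "half_space_of (affine hull P) V H" "x \<in> V" "agree_near x P H"
    by (rule facet_pointsE)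
  then show "x \<in> P"
    using agree_near_imp_mem_iff by (force elim: half_space_ofE)
qed

lemma not_eventually_upper_half_at_wall:
  assumes "affine W" "x \<in> wall W h" "\<not> vanishes_on h W"
  shows "\<not> (\<forall>\<^sub>F z in nhds x. z \<in> W \<longrightarrow> height h z \<ge> 0)"
proof
  assume above: "\<forall>\<^sub>F z in nhds x. z \<in> W \<longrightarrow> height h z \<ge> 0"
  obtain n where "crossing W h n"
    using crossing_exists assms by blast
  then interpret crossing W h n .
  obtain t where "t > 0" "x - t *\<^sub>R n \<in> W \<longrightarrow> height h (x - t *\<^sub>R n) \<ge> 0"
    using eventually_at_right_happens[OF eventually_at_right_line[OF above, of "- n"]] by auto
  moreover have "height h (x - t *\<^sub>R n) < 0"
    unfolding height_line_from_wall(2)[OF assms(2)] using \<open>t > 0\<close> upwards by simp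
  ultimately show False
    using line_mem(2)[of x t] assms(2) by simp
qed

lemma eventually_facet_points_near:
  assumes hs: "half_space_of (affine hull P) V H" and x: "x \<in> V" "agree_near x P H"
  shows "\<forall>\<^sub>F y in nhds x. y \<in> facet_points P \<longrightarrow> y \<in> V \<and> agree_near y P H"
  using eventually_agree_near[OF x(2)]
proof eventually_elim
  case (elim y)
  obtain h where h: "V = wall (affine hull P) h" "H = upper_half (affine hull P) h"
    using half_space_ofE[OF hs] .
  have "y \<in> V" if y: "y \<in> facet_points P"
  proof (rule ccontr)
    assume "y \<notin> V"
    moreover have "y \<in> H"
      using y facet_points_subset agree_near_imp_mem_iff[OF elim] by blast
    ultimately have "height h y > 0"
      by (auto simp: h less_le)
    then have "\<forall>\<^sub>F z in nhds y. sgn (height h z) = 1"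
      using eventually_sgn_height[of h y] by simp
    then have fills: "\<forall>\<^sub>F z in nhds y. z \<in> affine hull P \<longrightarrow> z \<in> H"
      by eventually_elim (auto simp: h sgn_1_pos)
    obtain V' H' where VH': "half_space_of (affine hull P) V' H'" "y \<in> V'" "agree_near y P H'"
      using facet_pointsE[OF y] .
    then obtain h' where h': "V' = wall (affine hull P) h'" "H' = upper_half (affine hull P) h'"
      "\<not> vanishes_on h' (affine hull P)"
      using half_space_ofE[OF VH'(1)] by metis
    have "\<forall>\<^sub>F z in nhds y. z \<in> H \<longleftrightarrow> z \<in> H'"
      using agree_near_trans[OF elim VH'(3)] unfolding agree_near_iff_eventually .
    with fills have "\<forall>\<^sub>F z in nhds y. z \<in> affine hull P \<longrightarrow> height h' z \<ge> 0"
      by eventually_elim (simp add: h'(2))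
    then show False
      using not_eventually_upper_half_at_wall[OF affine_affine_hull] h'(1,3) VH'(2) by metis
  qed
  then show ?case
    using elim by blast
qed

lemma facet_component_same_half_space:
  assumes hs: "half_space_of (affine hull P) V H" and C: "C \<in> components (facet_points P)"
    and x: "x \<in> C" "x \<in> V" "agree_near x P H" and "y \<in> C"
  shows "y \<in> V \<and> agree_near y P H"
proof (rule connected_induction_simple[of C x y])
  show "connected C"
    using C by (rule in_components_connected)
  show "x \<in> C" "y \<in> C" "x \<in> V \<and> agree_near x P H"
    using assms by auto
  fix a
  assume "a \<in> C"
  then have "a \<in> facet_points P"
    using C in_components_subset by blast
  then obtain V' H' where VH': "half_space_of (affine hull P) V' H'" "a \<in> V'" "agree_near a P H'"
    by (rule facet_pointsE)
  obtain U where U: "open U" "a \<in> U"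
    "\<And>z. z \<in> U \<Longrightarrow> z \<in> facet_points P \<Longrightarrow> z \<in> V' \<and> agree_near z P H'"
    using eventually_facet_points_near[OF VH'] unfolding eventually_nhds by blast
  show "\<exists>T. openin (top_of_set C) T \<and> a \<in> T \<and>
      (\<forall>z\<in>T. \<forall>z'\<in>T. z \<in> V \<and> agree_near z P H \<longrightarrow> z' \<in> V \<and> agree_near z' P H)"
  proof (intro exI conjI ballI impI)
    show "openin (top_of_set C) (C \<inter> U)" "a \<in> C \<inter> U"
      using U \<open>a \<in> C\<close> by (auto simp: openin_open_Int)
    fix z z'
    assume z: "z \<in> C \<inter> U" "z' \<in> C \<inter> U" "z \<in> V \<and> agree_near z P H"
    then have near: "z \<in> V' \<and> agree_near z P H'" "z' \<in> V' \<and> agree_near z' P H'"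
      using U(3) C in_components_subset by blast+
    then have "V = V'" "H = H'"
      using half_space_of_unique_near[OF affine_affine_hull hs VH'(1), of z] z(3) agree_near_trans
      by blast+
    then show "z' \<in> V" "agree_near z' P H"
      using near(2) by simp_all
  qed
qed

lemma affine_translate_eq:
  assumes "affine W" "x \<in> W" "y \<in> W"
  shows "(+) (y - x) ` W = W"
proof -
  have sub: "(+) (y - x) ` W \<subseteq> W" if "x \<in> W" "y \<in> W" for x y
    using mem_affine_3_minus[OF assms(1) _ that(2,1), of _ 1] by (auto simp: add.commute)
  have "W = (+) (y - x) ` (+) (x - y) ` W"
    by (simp add: image_image)
  also have "\<dots> \<subseteq> (+) (y - x) ` W"
    by (intro image_mono sub assms)
  finally show ?thesis
    using sub[OF assms(2,3)] by blast
qed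

lemma adapted_facet_points:
  assumes "finite \<Sigma>" "adapted \<Sigma> P"
  shows "adapted \<Sigma> (facet_points P)"
proof (rule adaptedI)
  fix x y
  assume x: "x \<in> facet_points P" and xy: "same_side \<Sigma> x y"
  obtain V H where VH: "half_space_of (affine hull P) V H" "x \<in> V" "agree_near x P H"
    using facet_pointsE[OF x] .
  have "x \<in> affine hull P" "y \<in> affine hull P"
    using x facet_points_subset adaptedD[OF assms(2) xy] hull_subset[of P affine] by blast+
  then have W: "(+) (y - x) ` (affine hull P) = affine hull P"
    by (intro affine_translate_eq affine_affine_hull)
  have shift: "filterlim (\<lambda>w. w - y) (nhds 0) (nhds y)"
    "filterlim (\<lambda>w. x + (w - y)) (nhds x) (nhds y)"
    by (auto intro!: tendsto_eq_intros filterlim_ident)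
  have "\<forall>\<^sub>F w in nhds y. same_side \<Sigma> (x + (w - y)) (y + (w - y))"
    using eventually_same_side_translate[OF assms(1) xy]
    by (rule eventually_compose_filterlim[OF _ shift(1)])
  moreover have "\<forall>\<^sub>F w in nhds y. x + (w - y) \<in> P \<longleftrightarrow> x + (w - y) \<in> H"
    using VH(3) unfolding agree_near_iff_eventually
    by (rule eventually_compose_filterlim[OF _ shift(2)])
  ultimately have "agree_near y P ((+) (y - x) ` H)"
    unfolding agree_near_iff_eventually
  proof eventually_elim
    case (elim w)
    have "w \<in> (+) (y - x) ` H \<longleftrightarrow> x + (w - y) \<in> H"
      by (force simp: image_iff algebra_simps)
    then show ?case
      using elim adaptedD[OF assms(2)] by auto
  qed
  moreover have "y \<in> (+) (y - x) ` V"
    using VH(2) by force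
  ultimately show "y \<in> facet_points P"
    using facet_pointsI half_space_of_translate[OF VH(1), of "y - x"] unfolding W by blast
qed

lemma facetE:
  assumes "F \<in> facets P"
  obtains C where "C \<in> components (facet_points P)" "F = closure C"
  using assms unfolding facets_def by blast

lemma adapted_facet:
  assumes "finite \<Sigma>" "adapted \<Sigma> P" "F \<in> facets P"
  shows "adapted \<Sigma> F"
  using facetE[OF assms(3)]
  by (metis adapted_closure adapted_component adapted_facet_points assms(1,2))

lemma closed_facet: "F \<in> facets P \<Longrightarrow> closed F"
  unfolding facets_def by auto

lemma facet_subset:
  assumes "closed P" "F \<in> facets P"
  shows "F \<subseteq> P"
proof -
  obtain C where C: "C \<in> components (facet_points P)" "F = closure C"
    using facetE[OF assms(2)] .
  have "C \<subseteq> P"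
    using in_components_subset[OF C(1)] facet_points_subset by blast
  then show ?thesis
    unfolding C(2) using assms(1) by (rule closure_minimal)
qed

definition facets_in :: "'a::euclidean_space set \<Rightarrow> 'a set \<Rightarrow> 'a set set" where
  "facets_in P V = {F \<in> facets P. aff_dim F = aff_dim V \<and> F \<subseteq> V}"

definition facet_sign :: "'a::euclidean_space set \<Rightarrow> 'a set \<Rightarrow> 'a set \<Rightarrow> real" where
  "facet_sign P F H = (if adjoins_from P F H then 1 else -1)"

lemma finite_facets_in:
  assumes "finite \<Sigma>" "adapted \<Sigma> P"
  shows "finite (facets_in P V)"
proof (rule finite_subset)
  show "facets_in P V \<subseteq> {S. adapted \<Sigma> S}"
    using adapted_facet[OF assms] by (auto simp: facets_in_def)
qed (rule finite_adapted_sets[OF assms(1)])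

lemma facets_in_point_near:
  assumes "F \<in> facets_in P V" "p \<in> F" "e > 0"
  obtains C q where "C \<in> components (facet_points P)" "F = closure C" "q \<in> C" "q \<in> V" "dist p q < e"
proof -
  obtain C where C: "C \<in> components (facet_points P)" "F = closure C"
    using assms(1) by (auto simp: facets_in_def elim: facetE)
  then obtain q where "q \<in> C" "dist p q < e"
    using assms(2,3) closure_approachable by (metis dist_commute)
  moreover have "q \<in> V"
    using \<open>q \<in> C\<close> C(2) assms(1) closure_subset by (auto simp: facets_in_def)
  ultimately show thesis
    using that C by blast
qed

lemma eventually_wall_in_facet_component:
  assumes hs: "half_space_of (affine hull P) V H" and C: "C \<in> components (facet_points P)"
    and x: "x \<in> C" "x \<in> V" "agree_near x P H"
  shows "\<forall>\<^sub>F y in nhds x. y \<in> V \<longrightarrow> y \<in> C"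
proof -
  have "affine V"
    by (rule half_space_of_imp_affine[OF hs affine_affine_hull])
  have "\<forall>\<^sub>F y in nhds x. y \<in> V \<longrightarrow> y \<in> facet_points P"
    using eventually_agree_near[OF x(3)] by eventually_elim (use hs facet_pointsI in blast)
  then obtain e where e: "e > 0" "V \<inter> ball x e \<subseteq> facet_points P"
    unfolding eventually_nhds_metric by (auto simp: dist_commute subset_iff)
  have "connected (V \<inter> ball x e)"
    by (intro convex_connected convex_Int affine_imp_convex \<open>affine V\<close> convex_ball)
  then have "V \<inter> ball x e \<subseteq> C"
    using e x by (intro components_maximal[OF C]) auto
  then show ?thesis
    unfolding eventually_nhds_metric using e(1) by (auto simp: dist_commute subset_iff)
qed

lemma affine_hull_facet_component:
  assumes hs: "half_space_of (affine hull P) V H" and C: "C \<in> components (facet_points P)"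
    and x: "x \<in> C" "x \<in> V" "agree_near x P H"
  shows "affine hull closure C = V"
proof
  have V: "affine V"
    by (rule half_space_of_imp_affine[OF hs affine_affine_hull])
  have "C \<subseteq> V"
    using facet_component_same_half_space[OF hs C x] by blast
  then have "closure C \<subseteq> V"
    using affine_closed[OF V] by (rule closure_minimal)
  then show "affine hull closure C \<subseteq> V"
    using V by (rule hull_minimal)
  obtain e where e: "e > 0" "V \<inter> ball x e \<subseteq> C"
    using eventually_wall_in_facet_component[OF hs C x]
    unfolding eventually_nhds_metric by (auto simp: dist_commute subset_iff)
  have "affine hull (V \<inter> ball x e) \<subseteq> affine hull closure C"
    using e(2) closure_subset by (intro hull_mono) blast
  moreover have "affine hull (V \<inter> ball x e) = affine hull V"
    using e(1) x(2) by (intro affine_hull_convex_Int_open affine_imp_convex V) auto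
  moreover have "affine hull V = V"
    using V by (simp add: affine_hull_eq)
  ultimately show "V \<subseteq> affine hull closure C"
    by simp
qed

lemma affine_hull_facets_in:
  assumes "affine V" "F \<in> facets_in P V" "F \<noteq> {}"
  shows "affine hull F = V"
proof (rule affine_dim_equal)
  show "affine hull F \<subseteq> V"
    using assms(1,2) by (intro hull_minimal) (auto simp: facets_in_def)
  show "aff_dim (affine hull F) = aff_dim V"
    using assms(2) by (simp add: facets_in_def aff_dim_affine_hull)
qed (use assms in auto)

lemma facets_in_component_half_space:
  assumes "affine V" "closure C \<in> facets_in P V" "C \<in> components (facet_points P)" "q \<in> C"
  obtains H where "half_space_of (affine hull P) V H" "agree_near q P H"
proof -
  have "q \<in> facet_points P"
    using assms(3,4) in_components_subset by blast
  then obtain V' H where VH: "half_space_of (affine hull P) V' H" "q \<in> V'" "agree_near q P H"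
    by (rule facet_pointsE)
  have "closure C \<noteq> {}"
    using assms(4) by auto
  then have "V' = V"
    using affine_hull_facet_component[OF VH(1) assms(3,4) VH(2,3)]
      affine_hull_facets_in[OF assms(1,2)] by simp
  then show thesis
    using that VH by blast
qed

lemma unique_facet_through:
  assumes hs: "half_space_of (affine hull P) V H" and p: "p \<in> V" "agree_near p P H"
  obtains C where "C \<in> components (facet_points P)" "p \<in> C"
    "{F \<in> facets_in P V. p \<in> F} = {closure C}"
proof -
  define C where "C = connected_component_set (facet_points P) p"
  have pf: "p \<in> facet_points P"
    by (rule facet_pointsI[OF hs p])
  then have C: "C \<in> components (facet_points P)" "p \<in> C"
    by (auto simp: C_def components_def)
  have V: "affine V"
    by (rule half_space_of_imp_affine[OF hs affine_affine_hull])
  have "affine hull closure C = V"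
    by (rule affine_hull_facet_component[OF hs C p])
  then have "closure C \<in> facets_in P V"
    using C(1) hull_subset[of "closure C" affine] aff_dim_affine_hull[of "closure C"]
    by (auto simp: facets_in_def facets_def)
  moreover have "F = closure C" if F: "F \<in> facets_in P V" "p \<in> F" for F
  proof -
    obtain e where e: "e > 0" "V \<inter> ball p e \<subseteq> C"
      using eventually_wall_in_facet_component[OF hs C p]
      unfolding eventually_nhds_metric by (auto simp: dist_commute subset_iff)
    obtain C' q where q: "C' \<in> components (facet_points P)" "F = closure C'" "q \<in> C'"
      "q \<in> V" "dist p q < e"
      using facets_in_point_near[OF F e(1)] .
    then have "q \<in> C' \<inter> C"
      using e(2) by auto
    then have "C' = C"
      using q(1) C(1) components_nonoverlap by blast
    then show ?thesis
      using q(2) by simp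
  qed
  moreover have "p \<in> closure C"
    using C(2) closure_subset by blast
  ultimately show thesis
    using that C by blast
qed

lemma adjoins_from_facet_component:
  assumes hs: "half_space_of (affine hull P) V H" and C: "C \<in> components (facet_points P)"
    and p: "p \<in> C" "p \<in> V" "agree_near p P H" and hs': "half_space_of (affine hull P) V H'"
  shows "adjoins_from P (closure C) H' \<longleftrightarrow> H' = H"
proof
  assume "adjoins_from P (closure C) H'"
  then obtain x where "x \<in> closure C" "agree_near x P H'"
    unfolding adjoins_from_def by blast
  then obtain q where q: "q \<in> C" "agree_near q P H'"
    using eventually_agree_near[of x P H'] closure_approachable[of x C]
    unfolding eventually_nhds_metric by blast
  then have "q \<in> V" "agree_near q H' H"
    using facet_component_same_half_space[OF hs C p q(1)] agree_near_trans by blast+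
  then show "H' = H"
    using half_space_of_unique_near[OF affine_affine_hull hs' hs] by blast
next
  assume "H' = H"
  then show "adjoins_from P (closure C) H'"
    using p closure_subset unfolding adjoins_from_def by blast
qed

locale euclidean_crossing = crossing W h n
  for W :: "'a::euclidean_space set" and h n
begin

lemma half_space_of_wall: "half_space_of W (wall W h) (upper_half W h)"
  unfolding half_space_of_iff using wall_nonempty height_not_vanishing by blast

lemma upper_half_opposite_neq: "upper_half W (opposite h) \<noteq> upper_half W h"
proof -
  obtain p where p: "p \<in> wall W h"
    using wall_nonempty by blast
  have "p + 1 *\<^sub>R n \<in> W"
    using p by (intro line_mem) simp
  moreover have "height h (p + 1 *\<^sub>R n) > 0"
    unfolding height_line_from_wall(1)[OF p] using upwards by simp
  ultimately have "p + 1 *\<^sub>R n \<in> upper_half W h - upper_half W (opposite h)"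
    by simp
  then show ?thesis
    by blast
qed

lemma half_space_of_wall_cases:
  assumes "half_space_of W (wall W h) H"
  shows "H = upper_half W h \<or> H = upper_half W (opposite h)"
proof -
  obtain k where k: "wall W h = wall W k" "H = upper_half W k" "\<not> vanishes_on k W"
    using half_space_ofE[OF assms] .
  then have "vanishes_on k (wall W h)"
    by (simp add: vanishes_on_def)
  then obtain \<kappa> where \<kappa>: "\<And>w. w \<in> W \<Longrightarrow> height k w = \<kappa> * height h w"
    using vanishes_on_wall_imp_proportional by blast
  then have "\<kappa> \<noteq> 0"
    using k(3) by (auto simp: vanishes_on_def)
  then show ?thesis
    unfolding k(2) using \<kappa> by (cases "\<kappa> > 0") (auto simp: zero_le_mult_iff)
qed

lemma agree_near_upper_half:
  assumes "closed F" "F \<subseteq> W" "e > 0"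
    and above: "\<And>z. z \<in> W \<Longrightarrow> dist p z < e \<Longrightarrow> height h z > 0 \<Longrightarrow> z \<in> F"
    and below: "\<And>z. z \<in> W \<Longrightarrow> dist p z < e \<Longrightarrow> height h z < 0 \<Longrightarrow> z \<notin> F"
  shows "agree_near p F (upper_half W h)"
proof -
  have wall: "z \<in> F" if z: "z \<in> wall W h" "dist p z < e" for z
  proof (rule ccontr)
    assume "z \<notin> F"
    then have "\<forall>\<^sub>F t in at_right 0. z + t *\<^sub>R n \<in> - F" "\<forall>\<^sub>F t in at_right 0. z + t *\<^sub>R n \<in> ball p e"
      using z(2) assms(1) by (intro eventually_at_right_line_in_open; auto)+
    then have "\<forall>\<^sub>F t in at_right 0. z + t *\<^sub>R n \<in> ball p e - F"
      by eventually_elim simp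
    then obtain t where "t > 0" "z + t *\<^sub>R n \<in> ball p e - F"
      using eventually_at_right_happens by blast
    moreover have "height h (z + t *\<^sub>R n) > 0"
      unfolding height_line_from_wall(1)[OF z(1)] using \<open>t > 0\<close> upwards by simp
    ultimately show False
      using above line_mem(1) z(1) by auto
  qed
  have "z \<in> F \<longleftrightarrow> z \<in> upper_half W h" if z: "dist z p < e" for z
  proof (cases "z \<in> W")
    case True
    then show ?thesis
      using above[of z] below[of z] wall[of z] z
      by (cases "height h z" "0::real" rule: linorder_cases) (auto simp: dist_commute)
  qed (use assms(2) in auto)
  then show ?thesis
    unfolding agree_near_iff_eventually eventually_nhds_metric using assms(3) by blast
qed

lemma not_in_facet_of_equal_sides:
  assumes W: "affine hull F = W" and "p \<in> wall W h" "e > 0" "G \<in> facets_in F (wall W h)"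
    and sides: "\<And>z. z \<in> W \<Longrightarrow> dist p z < e \<Longrightarrow> height h z \<noteq> 0 \<Longrightarrow> z \<in> F \<longleftrightarrow> b"
  shows "p \<notin> G"
proof
  assume "p \<in> G"
  then obtain C q where C: "C \<in> components (facet_points F)" "G = closure C" "q \<in> C"
    and q: "q \<in> wall W h" "dist p q < e"
    using facets_in_point_near[OF assms(4) _ assms(3)] by metis
  obtain H where H: "half_space_of W (wall W h) H" "agree_near q F H"
    using facets_in_component_half_space[OF affine_wall[OF affine] _ C(1,3)] assms(4) C(2) W
    by metis
  have "\<forall>\<^sub>F z in nhds q. (z \<in> F \<longleftrightarrow> z \<in> H) \<and> dist p z < e"
    using H(2) eventually_nhds_in_open[of "ball p e" q] q(2)
    unfolding agree_near_iff_eventually by (simp add: eventually_conj)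
  note ray = eventually_at_right_line[OF this]
  obtain t where "t > 0" and t: "q + t *\<^sub>R n \<in> F \<longleftrightarrow> q + t *\<^sub>R n \<in> H" "dist p (q + t *\<^sub>R n) < e"
    "q - t *\<^sub>R n \<in> F \<longleftrightarrow> q - t *\<^sub>R n \<in> H" "dist p (q - t *\<^sub>R n) < e"
    using eventually_at_right_happens[OF eventually_conj[OF ray[of n] ray[of "- n"]]] by auto
  have W': "q + t *\<^sub>R n \<in> W" "q - t *\<^sub>R n \<in> W"
    using q(1) by (auto intro: line_mem)
  have heights: "height h (q + t *\<^sub>R n) > 0" "height h (q - t *\<^sub>R n) < 0"
    unfolding height_line_from_wall[OF q(1)] using \<open>t > 0\<close> upwards by simp_all
  then have "q + t *\<^sub>R n \<in> H \<longleftrightarrow> q - t *\<^sub>R n \<in> H"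
    using t sides[OF W'(1)] sides[OF W'(2)] by auto
  then show False
    using half_space_of_wall_cases[OF H(1)] heights W' by auto
qed

lemma sum_facets_in_wall:
  assumes W: "affine hull F = W" and p: "p \<in> wall W h" "agree_near p F H"
    and H: "half_space_of W (wall W h) H"
  shows "(\<Sum>G | G \<in> facets_in F (wall W h) \<and> p \<in> G. facet_sign F G (upper_half W h)) =
    (if H = upper_half W h then 1 else -1)"
proof -
  obtain C where C: "C \<in> components (facet_points F)" "p \<in> C"
    "{G \<in> facets_in F (wall W h). p \<in> G} = {closure C}"
    using unique_facet_through[of F, unfolded W, OF H p] .
  have "adjoins_from F (closure C) (upper_half W h) \<longleftrightarrow> upper_half W h = H"
    using adjoins_from_facet_component[of F, unfolded W, OF H C(1,2) p half_space_of_wall] .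
  then show ?thesis
    unfolding C(3) by (auto simp: facet_sign_def)
qed

lemma sum_facets_eq_difference_of_sides:
  fixes above below :: bool
  assumes W: "affine hull F = W" and F: "closed F" and p: "p \<in> wall W h" and e: "e > 0"
    and above: "\<And>z. z \<in> W \<Longrightarrow> dist p z < e \<Longrightarrow> height h z > 0 \<Longrightarrow> z \<in> F \<longleftrightarrow> above"
    and below: "\<And>z. z \<in> W \<Longrightarrow> dist p z < e \<Longrightarrow> height h z < 0 \<Longrightarrow> z \<in> F \<longleftrightarrow> below"
  shows "(\<Sum>G | G \<in> facets_in F (wall W h) \<and> p \<in> G. facet_sign F G (upper_half W h)) =
    of_bool above - of_bool below"
proof -
  interpret opp: euclidean_crossing W "opposite h" "- n"
    unfolding euclidean_crossing_def by (rule crossing_opposite)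
  have FW: "F \<subseteq> W"
    using hull_subset[of F affine] W by simp
  consider (upper) "above" "\<not> below" | (lower) "\<not> above" "below" | (equal) "above \<longleftrightarrow> below"
    by blast
  then show ?thesis
  proof cases
    case upper
    then have "agree_near p F (upper_half W h)"
      using above below by (intro agree_near_upper_half[OF F FW e]) auto
    then show ?thesis
      using sum_facets_in_wall[OF W p _ half_space_of_wall] upper by simp
  next
    case lower
    then have "agree_near p F (upper_half W (opposite h))"
      using above below by (intro opp.agree_near_upper_half[OF F FW e]) auto
    then show ?thesis
      using sum_facets_in_wall[OF W p] opp.half_space_of_wall upper_half_opposite_neq lower
      by simp
  next
    case equal
    have "{G \<in> facets_in F (wall W h). p \<in> G} = {}"
      using not_in_facet_of_equal_sides[OF W p e, of _ above] above below equal
      by (auto simp: neq_iff)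
    then show ?thesis
      unfolding \<open>_ = {}\<close> using equal by simp
  qed
qed

lemma jump_indicator_eq_sum_facets:
  assumes W: "affine hull F = W" and F: "closed F" "finite \<Sigma>" "adapted \<Sigma> F"
    and p: "p \<in> wall W h" "regular \<Sigma> (wall W h) p"
  shows "jump n (indicator F) p =
    (\<Sum>G\<in>facets_in F (wall W h). facet_sign F G (upper_half W h) * indicator G p)"
proof -
  obtain e above below where e: "e > 0"
    and above: "\<And>z. z \<in> W \<Longrightarrow> dist p z < e \<Longrightarrow> height h z > 0 \<Longrightarrow> z \<in> F \<longleftrightarrow> above"
    and below: "\<And>z. z \<in> W \<Longrightarrow> dist p z < e \<Longrightarrow> height h z < 0 \<Longrightarrow> z \<in> F \<longleftrightarrow> below"
    using adapted_on_two_sided[OF F(2,3) open_UNIV UNIV_I p] by metis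
  have "jump n (indicator F :: 'a \<Rightarrow> real) p = of_bool above - of_bool below"
    by (rule jump_eq_two_sided[OF p(1) e]) (use above below in \<open>auto simp: indicator_def\<close>)
  also have "\<dots> = (\<Sum>G | G \<in> facets_in F (wall W h) \<and> p \<in> G. facet_sign F G (upper_half W h))"
    using above below by (intro sum_facets_eq_difference_of_sides[OF W F(1) p(1) e, symmetric]) auto
  also have "\<dots> = (\<Sum>G\<in>facets_in F (wall W h). facet_sign F G (upper_half W h) * indicator G p)"
    unfolding sum.inter_filter[OF finite_facets_in[OF F(2,3)]]
    by (intro sum.cong) (auto simp: indicator_def)
  finally show ?thesis .
qed

end

section \<open>Flags\<close>

lemma
  fixes \<Phi> :: "'a::euclidean_space flag"
  assumes "is_flag r \<Phi>"
  shows flag_affine: "r \<le> j \<Longrightarrow> j \<le> DIM('a) \<Longrightarrow> affine (fst \<Phi> j)"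
    and flag_aff_dim: "r \<le> j \<Longrightarrow> j \<le> DIM('a) \<Longrightarrow> aff_dim (fst \<Phi> j) = int j"
    and flag_top: "fst \<Phi> DIM('a) = UNIV"
    and flag_half_space:
      "r \<le> j \<Longrightarrow> j < DIM('a) \<Longrightarrow> half_space_of (fst \<Phi> (Suc j)) (fst \<Phi> j) (snd \<Phi> j)"
    and flag_subset_Suc: "r \<le> j \<Longrightarrow> j < DIM('a) \<Longrightarrow> fst \<Phi> j \<subseteq> fst \<Phi> (Suc j)"
    and flag_space_unused: "j \<notin> {r..DIM('a)} \<Longrightarrow> fst \<Phi> j = {}"
    and flag_half_space_unused: "j \<notin> {r..<DIM('a)} \<Longrightarrow> snd \<Phi> j = {}"
  using assms unfolding is_flag_def by (auto simp: split_beta)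

lemma flag_nonempty:
  fixes \<Phi> :: "'a::euclidean_space flag"
  assumes "is_flag r \<Phi>" "r \<le> j" "j \<le> DIM('a)"
  shows "fst \<Phi> j \<noteq> {}"
  using flag_aff_dim[OF assms] by auto

lemma flag_mono:
  fixes \<Phi> :: "'a::euclidean_space flag"
  assumes "is_flag r \<Phi>" "r \<le> j" "j \<le> DIM('a)"
  shows "fst \<Phi> r \<subseteq> fst \<Phi> j"
  using assms(2,3)
proof (induction rule: dec_induct)
  case (step i)
  then show ?case
    using flag_subset_Suc[OF assms(1), of i] by auto
qed simp

lemma fst_translate_flag: "fst (translate_flag l \<Phi>) j = (+) l ` fst \<Phi> j"
  and snd_translate_flag: "snd (translate_flag l \<Phi>) j = (+) l ` snd \<Phi> j"
  by (simp_all add: translate_flag_def split_beta)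

lemma is_flag_translate:
  assumes "is_flag r \<Phi>"
  shows "is_flag r (translate_flag l \<Phi>)"
  using assms unfolding is_flag_def translate_flag_def split_beta fst_conv snd_conv
  by (auto simp: affine_translation[symmetric] aff_dim_translation_eq surj_plus
      intro!: half_space_of_translate)

lemma half_space_of_translate_eq:
  assumes "affine W" "half_space_of W V H" "x \<in> V" "y \<in> V"
  shows "(+) (y - x) ` H = H"
proof -
  obtain h where h: "V = wall W h" "H = upper_half W h"
    using half_space_ofE[OF assms(2)] .
  have invariant: "(y - x) + z \<in> H" if "z \<in> H" "x \<in> V" "y \<in> V" for x y z
  proof -
    have "(y - x) + z \<in> (+) (y - x) ` W"
      using that(1) by (simp add: h(2))
    then have "(y - x) + z \<in> W"
      using affine_translate_eq[OF assms(1)] that(2,3) by (simp add: h(1))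
    moreover have "gradient h \<bullet> (y - x) = 0"
      using that(2,3) by (simp add: h(1) flip: height_diff)
    ultimately show ?thesis
      using that(1) height_add[of h z "y - x"] by (simp add: h(2) add.commute)
  qed
  show ?thesis
  proof (intro subset_antisym subsetI)
    fix z
    assume "z \<in> H"
    then have "(y - x) + ((x - y) + z) \<in> (+) (y - x) ` H"
      using invariant[OF _ assms(4,3)] by (intro imageI)
    then show "z \<in> (+) (y - x) ` H"
      by simp
  qed (use invariant[OF _ assms(3,4)] in blast)
qed

lemma translate_flag_eq_iff:
  fixes \<Phi> :: "'a::euclidean_space flag"
  assumes "is_flag r \<Phi>" "r \<le> DIM('a)"
  shows "translate_flag l \<Phi> = translate_flag l' \<Phi> \<longleftrightarrow> (+) l ` fst \<Phi> r = (+) l' ` fst \<Phi> r"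
proof
  assume "translate_flag l \<Phi> = translate_flag l' \<Phi>"
  then show "(+) l ` fst \<Phi> r = (+) l' ` fst \<Phi> r"
    by (metis fst_translate_flag)
next
  assume eq: "(+) l ` fst \<Phi> r = (+) l' ` fst \<Phi> r"
  obtain p where "p \<in> fst \<Phi> r"
    using flag_nonempty[OF assms(1) order_refl assms(2)] by blast
  then obtain q where "q \<in> fst \<Phi> r" "l + p = l' + q"
    using eq by (metis imageE imageI)
  then have q_p: "q - p = l - l'"
    by (simp add: algebra_simps)
  have pq: "p \<in> fst \<Phi> j" "q \<in> fst \<Phi> j" if "r \<le> j" "j \<le> DIM('a)" for j
    using flag_mono[OF assms(1) that] \<open>p \<in> fst \<Phi> r\<close> \<open>q \<in> fst \<Phi> r\<close> by auto
  have shift: "(+) l ` X = (+) l' ` X" if "(+) (q - p) ` X = X" for X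
  proof -
    have "(+) l ` X = (+) l' ` (+) (q - p) ` X"
      by (simp add: image_image q_p)
    then show ?thesis
      using that by simp
  qed
  have "(+) l ` fst \<Phi> j = (+) l' ` fst \<Phi> j" for j
  proof (cases "j \<in> {r..DIM('a)}")
    case True
    then show ?thesis
      by (intro shift affine_translate_eq flag_affine[OF assms(1)] pq) auto
  qed (simp add: flag_space_unused[OF assms(1)])
  moreover have "(+) l ` snd \<Phi> j = (+) l' ` snd \<Phi> j" for j
  proof (cases "j \<in> {r..<DIM('a)}")
    case True
    then show ?thesis
      by (intro shift half_space_of_translate_eq[OF _ flag_half_space[OF assms(1)]]
            flag_affine[OF assms(1)] pq) auto
  qed (simp add: flag_half_space_unused[OF assms(1)])
  ultimately show "translate_flag l \<Phi> = translate_flag l' \<Phi>"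
    by (simp add: prod_eq_iff fun_eq_iff fst_translate_flag snd_translate_flag)
qed

definition flag_directions :: "nat \<Rightarrow> 'a::euclidean_space flag \<Rightarrow> (nat \<Rightarrow> 'a) \<Rightarrow> bool" where
  "flag_directions r \<Phi> n \<longleftrightarrow>
     (\<forall>j\<in>{r..<DIM('a)}. crosses (fst \<Phi> (Suc j)) (fst \<Phi> j) (snd \<Phi> j) (n j))"

lemma flag_directions_crossing:
  fixes \<Phi> :: "'a::euclidean_space flag"
  assumes "flag_directions r \<Phi> n" "r \<le> j" "j < DIM('a)"
  obtains h where "crossing (fst \<Phi> (Suc j)) h (n j)"
    "fst \<Phi> j = wall (fst \<Phi> (Suc j)) h" "snd \<Phi> j = upper_half (fst \<Phi> (Suc j)) h"
  using assms unfolding flag_directions_def crosses_def by (meson atLeastLessThan_iff)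

lemma flag_directions_exist:
  fixes \<Phi> :: "'a::euclidean_space flag"
  assumes "is_flag r \<Phi>"
  obtains n where "flag_directions r \<Phi> n"
proof -
  have "\<exists>m. crosses (fst \<Phi> (Suc j)) (fst \<Phi> j) (snd \<Phi> j) m" if "j \<in> {r..<DIM('a)}" for j
  proof -
    have j: "r \<le> j" "j < DIM('a)"
      using that by auto
    obtain h where h: "fst \<Phi> j = wall (fst \<Phi> (Suc j)) h" "snd \<Phi> j = upper_half (fst \<Phi> (Suc j)) h"
      "wall (fst \<Phi> (Suc j)) h \<noteq> {}" "\<not> vanishes_on h (fst \<Phi> (Suc j))"
      using half_space_ofE[OF flag_half_space[OF assms j]] .
    have "affine (fst \<Phi> (Suc j))"
      using j by (intro flag_affine[OF assms]) auto
    then show ?thesis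
      using crossing_exists[OF _ h(3,4)] h(1,2) unfolding crosses_def by metis
  qed
  then show thesis
    using that unfolding flag_directions_def by metis
qed

lemma crosses_translate:
  assumes "crosses W V H n"
  shows "crosses ((+) l ` W) ((+) l ` V) ((+) l ` H) n"
proof -
  obtain h where "crossing W h n" and VH: "V = wall W h" "H = upper_half W h"
    using assms unfolding crosses_def by blast
  then interpret crossing W h n
    by simp
  have V: "(+) l ` V = wall ((+) l ` W) (shift_functional (- l) h)"
    and H: "(+) l ` H = upper_half ((+) l ` W) (shift_functional (- l) h)"
    by (auto simp: VH)
  have "crossing ((+) l ` W) (shift_functional (- l) h) n"
  proof
    show "affine ((+) l ` W)"
      using affine by (simp flip: affine_translation)
    show "wall ((+) l ` W) (shift_functional (- l) h) \<noteq> {}"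
      using wall_nonempty by (simp flip: V add: VH(1))
    show "x + n \<in> (+) l ` W" if "x \<in> (+) l ` W" for x
      using that direction by (auto simp: add.assoc)
    show "gradient (shift_functional (- l) h) \<bullet> n > 0"
      using upwards by (simp add: shift_functional_def)
  qed
  then show ?thesis
    unfolding crosses_def using V H by blast
qed

lemma flag_directions_translate:
  "flag_directions r \<Phi> n \<Longrightarrow> flag_directions r (translate_flag l \<Phi>) n"
  by (simp add: flag_directions_def fst_translate_flag snd_translate_flag crosses_translate)

definition extend_flag ::
    "nat \<Rightarrow> 'a set \<Rightarrow> 'a set \<Rightarrow> 'a::euclidean_space flag \<Rightarrow> 'a flag" where
  "extend_flag r V H \<Phi> = ((fst \<Phi>)(r := V), (snd \<Phi>)(r := H))"

lemma aff_dim_wall: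
  fixes W :: "'a::euclidean_space set"
  assumes "affine W" "wall W h \<noteq> {}" "\<not> vanishes_on h W"
  shows "aff_dim (wall W h) = aff_dim W - 1"
proof -
  have "wall W h = W \<inter> {x. gradient h \<bullet> x = offset h}"
    by (auto simp: height_def)
  moreover have "\<not> W \<subseteq> {x. gradient h \<bullet> x = offset h}"
    using assms(3) by (auto simp: vanishes_on_def height_def)
  ultimately show ?thesis
    using aff_dim_affine_Int_hyperplane[OF assms(1), of "gradient h" "offset h"] assms(2) by simp
qed

lemma is_flag_extend:
  fixes \<Phi> :: "'a::euclidean_space flag"
  assumes "is_flag (Suc r) \<Phi>" "r < DIM('a)" "half_space_of (fst \<Phi> (Suc r)) V H"
  shows "is_flag r (extend_flag r V H \<Phi>)"
proof -
  have W: "affine (fst \<Phi> (Suc r))" "aff_dim (fst \<Phi> (Suc r)) = int (Suc r)"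
    using flag_affine[OF assms(1)] flag_aff_dim[OF assms(1)] assms(2) by auto
  obtain h where "V = wall (fst \<Phi> (Suc r)) h" "wall (fst \<Phi> (Suc r)) h \<noteq> {}"
    "\<not> vanishes_on h (fst \<Phi> (Suc r))"
    using half_space_ofE[OF assms(3)] .
  then have V: "affine V" "aff_dim V = int r" "V \<subseteq> fst \<Phi> (Suc r)"
    using W affine_wall aff_dim_wall[OF W(1), of h] by auto
  have "j \<in> {r..DIM('a)} \<Longrightarrow> j = r \<or> j \<in> {Suc r..DIM('a)}"
    "j \<in> {r..<DIM('a)} \<Longrightarrow> j = r \<or> j \<in> {Suc r..<DIM('a)}" for j
    by auto
  then show ?thesis
    using assms V flag_affine[OF assms(1)] flag_aff_dim[OF assms(1)] flag_top[OF assms(1)]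
      flag_half_space[OF assms(1)] flag_subset_Suc[OF assms(1)] flag_space_unused[OF assms(1)]
      flag_half_space_unused[OF assms(1)]
    unfolding is_flag_def extend_flag_def by auto
qed

lemma flag_directions_extend:
  fixes \<Phi> :: "'a::euclidean_space flag"
  assumes "flag_directions (Suc r) \<Phi> n" "crosses (fst \<Phi> (Suc r)) V H m"
  shows "flag_directions r (extend_flag r V H \<Phi>) (n(r := m))"
  using assms unfolding flag_directions_def extend_flag_def
  by (auto simp: Suc_le_eq le_less)

section \<open>Iterated jumps and chains of faces\<close>

definition iter_jump ::
    "(nat \<Rightarrow> 'a) \<Rightarrow> nat \<Rightarrow> ('a::euclidean_space \<Rightarrow> 'b::{t2_space,ab_group_add}) \<Rightarrow> 'a \<Rightarrow> 'b" where
  "iter_jump n r u = foldr (\<lambda>j. jump (n j)) [r..<DIM('a)] u"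

lemma iter_jump_top [simp]: "iter_jump n DIM('a) u = u"
  for u :: "'a::euclidean_space \<Rightarrow> 'b::{t2_space,ab_group_add}"
  by (simp add: iter_jump_def)

lemma iter_jump_Suc:
  fixes u :: "'a::euclidean_space \<Rightarrow> 'b::{t2_space,ab_group_add}"
  shows "r < DIM('a) \<Longrightarrow> iter_jump n r u = jump (n r) (iter_jump n (Suc r) u)"
  by (simp add: iter_jump_def upt_conv_Cons)

lemma iter_jump_rel:
  assumes "R u v" "\<And>j u v. R u v \<Longrightarrow> R (jump (n j) u) (jump (n j) v)"
  shows "R (iter_jump n r u) (iter_jump n r v)"
proof -
  have "R (foldr (\<lambda>j. jump (n j)) js u) (foldr (\<lambda>j. jump (n j)) js v)" for js
    by (induction js) (simp_all add: assms)
  then show ?thesis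
    by (simp add: iter_jump_def)
qed

lemma iter_jump_cong_directions:
  "(\<And>j. r \<le> j \<Longrightarrow> n j = n' j) \<Longrightarrow> iter_jump n r u = iter_jump n' r u"
  unfolding iter_jump_def by (rule foldr_cong) auto

lemma adapted_on_iter_jump:
  assumes "finite \<Sigma>" "open X" "adapted_on \<Sigma> X u"
  shows "adapted_on \<Sigma> X (iter_jump n r u)"
  using iter_jump_rel[of "\<lambda>u _. adapted_on \<Sigma> X u"] adapted_on_jump assms by metis

lemma locally_adapted_iter_jump: "locally_adapted u \<Longrightarrow> locally_adapted (iter_jump n r u)"
  using iter_jump_rel[of "\<lambda>u _. locally_adapted u"] locally_adapted_jump by metis

lemma iter_jump_const:
  fixes c :: "'b::{t2_space,ab_group_add}"
  assumes "r < DIM('a::euclidean_space)"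
  shows "iter_jump n r (\<lambda>_::'a. c) = (\<lambda>_. 0)"
proof -
  have "\<exists>c'. iter_jump n (Suc r) (\<lambda>_. c) = (\<lambda>_. c')"
    by (rule iter_jump_rel[of "\<lambda>u _. \<exists>c'. u = (\<lambda>_. c')"]) auto
  then show ?thesis
    using iter_jump_Suc[OF assms, of n "\<lambda>_. c"] by auto
qed

lemma eventually_iter_jump_cong:
  fixes u v :: "'a::euclidean_space \<Rightarrow> 'b::{t2_space,ab_group_add}"
  assumes "is_flag r \<Phi>" "flag_directions r \<Phi> n" "r \<le> DIM('a)" "\<forall>\<^sub>F x in generic UNIV. u x = v x"
  shows "\<forall>\<^sub>F x in generic (fst \<Phi> r). iter_jump n r u x = iter_jump n r v x"
  using assms(3)
proof (induction rule: inc_induct)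
  case base
  then show ?case
    using assms(4) flag_top[OF assms(1)] by simp
next
  case (step j)
  obtain h where h: "crossing (fst \<Phi> (Suc j)) h (n j)" "fst \<Phi> j = wall (fst \<Phi> (Suc j)) h"
    using flag_directions_crossing[OF assms(2) step.hyps] .
  show ?case
    using crossing.eventually_jump_cong[OF h(1) step.IH] step.hyps(2)
    by (simp add: h(2) iter_jump_Suc)
qed

lemma face_chains_iff:
  fixes A :: "'a::euclidean_space set"
  shows "F \<in> face_chains r \<Phi> A \<longleftrightarrow> F DIM('a) = A \<and>
     (\<forall>j\<in>{r..<DIM('a)}. F j \<in> facets (F (Suc j)) \<and> aff_dim (F j) = int j \<and> F j \<subseteq> fst \<Phi> j) \<and>
     (\<forall>j. j \<notin> {r..DIM('a)} \<longrightarrow> F j = {})"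
  unfolding face_chains_def by (simp add: split_beta)

lemma face_chains_top: "face_chains DIM('a) \<Phi> A = {\<lambda>j. if j = DIM('a) then A else {}}"
  for A :: "'a::euclidean_space set"
  by (auto simp: face_chains_iff fun_eq_iff)

lemma face_chains_cons:
  fixes A :: "'a::euclidean_space set"
  assumes "F \<in> face_chains (Suc r) \<Phi> A" "G \<in> facets_in (F (Suc r)) (fst \<Phi> r)"
    and "r < DIM('a)" "aff_dim (fst \<Phi> r) = int r"
  shows "F(r := G) \<in> face_chains r \<Phi> A"
  unfolding face_chains_iff
proof (intro conjI ballI allI impI)
  fix j
  assume "j \<in> {r..<DIM('a)}"
  then have "j = r \<or> j \<in> {Suc r..<DIM('a)}"
    by auto
  then show "(F(r := G)) j \<in> facets ((F(r := G)) (Suc j))"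
    "aff_dim ((F(r := G)) j) = int j" "(F(r := G)) j \<subseteq> fst \<Phi> j"
    using assms by (auto simp: face_chains_iff facets_in_def)
qed (use assms in \<open>auto simp: face_chains_iff\<close>)

lemma face_chains_uncons:
  fixes A :: "'a::euclidean_space set"
  assumes "F \<in> face_chains r \<Phi> A" "r < DIM('a)" "aff_dim (fst \<Phi> r) = int r"
  shows "F(r := {}) \<in> face_chains (Suc r) \<Phi> A" "F r \<in> facets_in (F (Suc r)) (fst \<Phi> r)"
  using assms by (auto simp: face_chains_iff facets_in_def)

definition chain_coeff :: "'a::euclidean_space flag \<Rightarrow> nat \<Rightarrow> (nat \<Rightarrow> 'a set) \<Rightarrow> real" where
  "chain_coeff \<Phi> r F = (\<Prod>j=r..<DIM('a). chain_sign \<Phi> F j)"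

lemma chain_coeff_cons:
  fixes \<Phi> :: "'a::euclidean_space flag"
  assumes "r < DIM('a)"
  shows "chain_coeff \<Phi> r (F(r := G)) = facet_sign (F (Suc r)) G (snd \<Phi> r) * chain_coeff \<Phi> (Suc r) F"
proof -
  have "chain_coeff \<Phi> r (F(r := G)) =
      chain_sign \<Phi> (F(r := G)) r * (\<Prod>j=Suc r..<DIM('a). chain_sign \<Phi> (F(r := G)) j)"
    unfolding chain_coeff_def using assms by (rule prod.atLeast_Suc_lessThan)
  also have "(\<Prod>j=Suc r..<DIM('a). chain_sign \<Phi> (F(r := G)) j) = chain_coeff \<Phi> (Suc r) F"
    unfolding chain_coeff_def by (rule prod.cong) (auto simp: chain_sign_def)
  also have "chain_sign \<Phi> (F(r := G)) r = facet_sign (F (Suc r)) G (snd \<Phi> r)"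
    by (simp add: chain_sign_def facet_sign_def)
  finally show ?thesis .
qed

definition signed_faces :: "nat \<Rightarrow> 'a::euclidean_space flag \<Rightarrow> 'a set \<Rightarrow> 'a \<Rightarrow> real" where
  "signed_faces r \<Phi> A x = (\<Sum>F\<in>face_chains r \<Phi> A. chain_coeff \<Phi> r F * indicator (F r) x)"

locale polyhedral_body =
  fixes A :: "'a::euclidean_space set" and \<Sigma> :: "'a affine_functional set"
  assumes closed_A: "closed A" and finite_\<Sigma>: "finite \<Sigma>" and adapted_A: "adapted \<Sigma> A"
    and hull_A: "affine hull A = UNIV"
begin

lemma face_chain_member:
  assumes "is_flag r0 \<Phi>" "F \<in> face_chains r \<Phi> A" "r0 \<le> r" "r \<le> j" "j \<le> DIM('a)"
  shows "closed (F j)" "F j \<subseteq> A" "adapted \<Sigma> (F j)" "affine hull F j = fst \<Phi> j"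
proof -
  have "closed (F j) \<and> F j \<subseteq> A \<and> adapted \<Sigma> (F j) \<and> affine hull F j = fst \<Phi> j"
    using assms(5)
  proof (induction rule: inc_induct)
    case base
    then show ?case
      using assms(2) closed_A adapted_A hull_A flag_top[OF assms(1)] by (auto simp: face_chains_iff)
  next
    case (step k)
    then have k: "k \<in> {r..<DIM('a)}" "r0 \<le> k" "k \<le> DIM('a)"
      using assms(3,4) by auto
    then have Fk: "F k \<in> facets (F (Suc k))" "aff_dim (F k) = int k" "F k \<subseteq> fst \<Phi> k"
      using assms(2) unfolding face_chains_iff by blast+
    have "F k \<in> facets_in (F (Suc k)) (fst \<Phi> k)"
      using Fk flag_aff_dim[OF assms(1) k(2,3)] by (simp add: facets_in_def)
    moreover have "F k \<noteq> {}"
      using Fk(2) by auto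
    ultimately have "affine hull F k = fst \<Phi> k"
      using flag_affine[OF assms(1) k(2,3)] by (intro affine_hull_facets_in)
    moreover have "F k \<subseteq> A"
      using facet_subset[of "F (Suc k)"] Fk(1) step.IH by blast
    ultimately show ?case
      using closed_facet[OF Fk(1)] adapted_facet[OF finite_\<Sigma> _ Fk(1)] step.IH by blast
  qed
  then show "closed (F j)" "F j \<subseteq> A" "adapted \<Sigma> (F j)" "affine hull F j = fst \<Phi> j"
    by blast+
qed

lemma finite_face_chains:
  assumes "is_flag r0 \<Phi>" "r0 \<le> r"
  shows "finite (face_chains r \<Phi> A)"
proof (rule finite_subset)
  let ?X = "{F. \<forall>j. (j \<in> {r..DIM('a)} \<longrightarrow> F j \<in> {S. adapted \<Sigma> S}) \<and> (j \<notin> {r..DIM('a)} \<longrightarrow> F j = {})}"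
  show "face_chains r \<Phi> A \<subseteq> ?X"
    using face_chain_member(3)[OF assms(1) _ assms(2)] by (auto simp: face_chains_iff)
  show "finite ?X"
    by (rule finite_set_of_finite_funs) (auto simp: finite_adapted_sets finite_\<Sigma>)
qed

lemma sum_face_chains_Suc:
  assumes "is_flag r0 \<Phi>" "r0 \<le> r" "r < DIM('a)"
  shows "(\<Sum>F\<in>face_chains r \<Phi> A. g F) =
    (\<Sum>F\<in>face_chains (Suc r) \<Phi> A. \<Sum>G\<in>facets_in (F (Suc r)) (fst \<Phi> r). g (F(r := G)))"
proof -
  let ?S = "SIGMA F:face_chains (Suc r) \<Phi> A. facets_in (F (Suc r)) (fst \<Phi> r)"
  have dim: "aff_dim (fst \<Phi> r) = int r"
    using assms by (intro flag_aff_dim[OF assms(1)]) auto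
  have "(\<Sum>F\<in>face_chains r \<Phi> A. g F) = (\<Sum>(F, G)\<in>?S. g (F(r := G)))"
  proof (rule sum.reindex_bij_witness[of _ "\<lambda>(F, G). F(r := G)" "\<lambda>F. (F(r := {}), F r)"])
    fix F
    assume "F \<in> face_chains r \<Phi> A"
    then show "(F(r := {}), F r) \<in> ?S"
      using face_chains_uncons[OF _ assms(3) dim] by simp
  next
    fix FG
    assume "FG \<in> ?S"
    then obtain F G where [simp]: "FG = (F, G)"
      and FG: "F \<in> face_chains (Suc r) \<Phi> A" "G \<in> facets_in (F (Suc r)) (fst \<Phi> r)"
      by auto
    show "(case FG of (F, G) \<Rightarrow> F(r := G)) \<in> face_chains r \<Phi> A"
      using face_chains_cons[OF FG assms(3) dim] by simp
    have "F r = {}"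
      using FG(1) by (auto simp: face_chains_iff)
    then show "(\<lambda>F. (F(r := {}), F r)) (case FG of (F, G) \<Rightarrow> F(r := G)) = FG"
      by (simp add: fun_upd_idem)
  qed auto
  also have "\<dots> = (\<Sum>F\<in>face_chains (Suc r) \<Phi> A. \<Sum>G\<in>facets_in (F (Suc r)) (fst \<Phi> r). g (F(r := G)))"
    using finite_face_chains[OF assms(1)] face_chain_member(3)[OF assms(1)] assms(2,3)
    by (intro sum.Sigma[symmetric] ballI finite_facets_in[OF finite_\<Sigma>]) auto
  finally show ?thesis .
qed

lemma jump_signed_faces:
  assumes flag: "is_flag r0 \<Phi>" "flag_directions r0 \<Phi> n" and r: "r0 \<le> r" "r < DIM('a)"
    and p: "p \<in> fst \<Phi> r" "regular \<Sigma> (fst \<Phi> r) p"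
  shows "jump (n r) (signed_faces (Suc r) \<Phi> A) p = signed_faces r \<Phi> A p"
proof -
  obtain h where "crossing (fst \<Phi> (Suc r)) h (n r)"
    and h: "fst \<Phi> r = wall (fst \<Phi> (Suc r)) h" "snd \<Phi> r = upper_half (fst \<Phi> (Suc r)) h"
    using flag_directions_crossing[OF flag(2) r] .
  then interpret euclidean_crossing "fst \<Phi> (Suc r)" h "n r"
    by (simp add: euclidean_crossing_def)
  let ?\<F> = "face_chains (Suc r) \<Phi> A"
  have face: "closed (F (Suc r))" "adapted \<Sigma> (F (Suc r))" "affine hull F (Suc r) = fst \<Phi> (Suc r)"
    if "F \<in> ?\<F>" for F
    using face_chain_member[OF flag(1) that, of "Suc r"] r by auto
  have loc: "locally_adapted (indicator (F (Suc r)) :: 'a \<Rightarrow> real)" if "F \<in> ?\<F>" for F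
    using adapted_on_imp_locally_adapted[OF finite_\<Sigma> adapted_on_indicator[OF face(2)[OF that]]] .
  have "finite ?\<F>"
    using r by (intro finite_face_chains[OF flag(1)]) auto
  then have "jump (n r) (signed_faces (Suc r) \<Phi> A) p =
      (\<Sum>F\<in>?\<F>. jump (n r) (\<lambda>x. chain_coeff \<Phi> (Suc r) F * indicator (F (Suc r)) x) p)"
    unfolding signed_faces_def using loc locally_adapted_comp by (intro jump_sum) blast+
  also have "\<dots> = (\<Sum>F\<in>?\<F>. chain_coeff \<Phi> (Suc r) F * jump (n r) (indicator (F (Suc r))) p)"
    by (intro sum.cong refl jump_cmult loc)
  also have "\<dots> = (\<Sum>F\<in>?\<F>. \<Sum>G\<in>facets_in (F (Suc r)) (fst \<Phi> r).
      chain_coeff \<Phi> r (F(r := G)) * indicator ((F(r := G)) r) p)"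
  proof (intro sum.cong refl)
    fix F
    assume F: "F \<in> ?\<F>"
    have "jump (n r) (indicator (F (Suc r))) p =
        (\<Sum>G\<in>facets_in (F (Suc r)) (fst \<Phi> r). facet_sign (F (Suc r)) G (snd \<Phi> r) * indicator G p)"
      using jump_indicator_eq_sum_facets[OF face(3,1)[OF F] finite_\<Sigma> face(2)[OF F], of p] p
      by (simp add: h)
    then show "chain_coeff \<Phi> (Suc r) F * jump (n r) (indicator (F (Suc r))) p =
        (\<Sum>G\<in>facets_in (F (Suc r)) (fst \<Phi> r).
          chain_coeff \<Phi> r (F(r := G)) * indicator ((F(r := G)) r) p)"
      by (simp add: chain_coeff_cons[OF r(2)] sum_distrib_left mult_ac)
  qed
  also have "\<dots> = signed_faces r \<Phi> A p"
    unfolding signed_faces_def by (rule sum_face_chains_Suc[OF flag(1) r, symmetric])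
  finally show ?thesis .
qed

lemma iter_jump_eq_signed_faces:
  assumes flag: "is_flag r \<Phi>" "flag_directions r \<Phi> n" and r: "r \<le> DIM('a)"
  shows "\<forall>\<^sub>F x in generic (fst \<Phi> r). iter_jump n r (indicator A) x = signed_faces r \<Phi> A x"
  using r
proof (induction rule: inc_induct)
  case base
  show ?case
    by (simp add: signed_faces_def face_chains_top chain_coeff_def)
next
  case (step k)
  obtain h where h: "crossing (fst \<Phi> (Suc k)) h (n k)" "fst \<Phi> k = wall (fst \<Phi> (Suc k)) h"
    using flag_directions_crossing[OF flag(2) step.hyps] .
  have "\<forall>\<^sub>F x in generic (fst \<Phi> k). iter_jump n k (indicator A) x =
      jump (n k) (signed_faces (Suc k) \<Phi> A) x"
    using crossing.eventually_jump_cong[OF h(1) step.IH] step.hyps(2)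
    by (simp add: h(2) iter_jump_Suc)
  then show ?case
    using eventually_generic_mem eventually_generic_regular[OF finite_\<Sigma>]
    by eventually_elim (simp add: jump_signed_faces[OF flag step.hyps])
qed

end

section \<open>Orthonormal coordinates for Lebesgue measure\<close>

lemma nn_integral_translation_invariant:
  fixes M :: "'a::real_normed_vector measure"
  assumes "sets M = sets borel" "\<And>t. distr M borel ((+) t) = M"
    and f: "f \<in> borel_measurable borel"
  shows "(\<integral>\<^sup>+x. f (t + x) \<partial>M) = (\<integral>\<^sup>+x. f x \<partial>M)"
proof -
  have "(\<integral>\<^sup>+x. f x \<partial>M) = (\<integral>\<^sup>+x. f x \<partial>distr M borel ((+) t))"
    by (simp add: assms(2))
  also have "\<dots> = (\<integral>\<^sup>+x. f (t + x) \<partial>M)"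
    using assms(1) f by (subst nn_integral_distr) (auto cong: measurable_cong_sets)
  finally show ?thesis
    by simp
qed

lemma nn_integral_lborel_reflect:
  fixes t :: "'a::euclidean_space"
  assumes "f \<in> borel_measurable borel"
  shows "(\<integral>\<^sup>+x. f (t - x) \<partial>lborel) = (\<integral>\<^sup>+x. f x \<partial>lborel)"
proof -
  have "(lborel :: 'a measure) = distr lborel borel (\<lambda>x. t - x)"
    by (subst lborel_affine[of "-1" t]) (auto simp: density_1 simp flip: one_ennreal_def)
  then have "(\<integral>\<^sup>+x. f x \<partial>lborel) = (\<integral>\<^sup>+x. f x \<partial>distr lborel borel (\<lambda>x. t - x))"
    by simp
  also have "\<dots> = (\<integral>\<^sup>+x. f (t - x) \<partial>lborel)"
    using assms by (subst nn_integral_distr) auto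
  finally show ?thesis
    by simp
qed

text \<open>Both sides are \<open>\<integral>\<integral> indicator A x * indicator B (x + y)\<close>, integrated in the two possible
  orders.\<close>

lemma translation_invariant_measure_proportional:
  fixes M :: "'a::euclidean_space measure"
  assumes "sigma_finite_measure M" and sets: "sets M = sets borel"
    and invariant: "\<And>t. distr M borel ((+) t) = M"
    and A [measurable]: "A \<in> sets borel" and B [measurable]: "B \<in> sets borel"
  shows "emeasure M A * emeasure lborel B = emeasure M B * emeasure lborel A"
proof -
  interpret M: sigma_finite_measure M
    by (rule assms(1))
  interpret pair_sigma_finite lborel M ..
  have [measurable_cong]: "sets M = sets borel"
    by (rule sets)
  have "emeasure M A * emeasure lborel B = (\<integral>\<^sup>+x. indicator A x * emeasure lborel B \<partial>M)"
    using A by (simp add: nn_integral_multc sets)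
  also have "\<dots> = (\<integral>\<^sup>+x. \<integral>\<^sup>+y. indicator A x * indicator B (x + y) \<partial>lborel \<partial>M)"
    using nn_integral_translation_invariant[of lborel "indicator B"]
    by (intro nn_integral_cong) (simp add: nn_integral_cmult lborel_distr_plus)
  also have "\<dots> = (\<integral>\<^sup>+y. \<integral>\<^sup>+x. indicator A x * indicator B (x + y) \<partial>M \<partial>lborel)"
    by (rule Fubini') measurable
  also have "\<dots> = (\<integral>\<^sup>+y. \<integral>\<^sup>+x. indicator A (x - y) * indicator B x \<partial>M \<partial>lborel)"
  proof (rule nn_integral_cong)
    fix y :: 'a
    have "(\<integral>\<^sup>+x. indicator A ((y + x) - y) * indicator B (y + x) \<partial>M) =
        (\<integral>\<^sup>+x. indicator A (x - y) * indicator B x \<partial>M)"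
      by (rule nn_integral_translation_invariant[OF sets invariant]) measurable
    then show "(\<integral>\<^sup>+x. indicator A x * indicator B (x + y) \<partial>M) =
        (\<integral>\<^sup>+x. indicator A (x - y) * indicator B x \<partial>M)"
      by (simp add: add.commute)
  qed
  also have "\<dots> = (\<integral>\<^sup>+x. \<integral>\<^sup>+y. indicator A (x - y) * indicator B x \<partial>lborel \<partial>M)"
    by (rule Fubini'[symmetric]) measurable
  also have "\<dots> = (\<integral>\<^sup>+x. emeasure lborel A * indicator B x \<partial>M)"
    using nn_integral_lborel_reflect[of "indicator A"]
    by (intro nn_integral_cong) (simp add: nn_integral_multc)
  also have "\<dots> = emeasure M B * emeasure lborel A"
    by (subst nn_integral_cmult) (simp_all add: sets mult.commute)
  finally show ?thesis .
qed

lemma emeasure_lborel_ball_nonzero: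
  fixes x :: "'a::euclidean_space"
  assumes "e > 0"
  shows "emeasure lborel (ball x e) \<noteq> 0"
proof
  assume "emeasure lborel (ball x e) = 0"
  then have "negligible (ball x e)"
    by (simp add: negligible_iff_null_sets null_sets_completionI null_sets_def)
  then show False
    using open_not_negligible[of "ball x e"] assms by simp
qed

lemma translation_invariant_measure_eq_lborel:
  fixes M :: "'a::euclidean_space measure"
  assumes "sigma_finite_measure M" "sets M = sets borel" "\<And>t. distr M borel ((+) t) = M"
    and unit_ball: "emeasure M (ball 0 1) = emeasure lborel (ball (0 :: 'a) 1)"
  shows "M = lborel"
proof (rule measure_eqI)
  let ?b = "emeasure lborel (ball (0 :: 'a) 1)"
  fix A
  assume "A \<in> sets M"
  then have "emeasure M A * ?b = emeasure lborel A * ?b"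
    using translation_invariant_measure_proportional[OF assms(1-3), of A "ball 0 1"]
    by (simp add: assms(2) unit_ball mult.commute)
  moreover have "?b \<noteq> 0" "?b \<noteq> \<infinity>"
    using emeasure_lborel_ball_nonzero[of 1 "0::'a"] emeasure_lborel_ball_finite[of "0::'a" 1]
    by simp_all
  ultimately show "emeasure M A = emeasure lborel A"
    by (simp add: mult.commute[of _ ?b] ennreal_mult_cancel_left)
qed (simp add: assms(2))

lemma lborel_distr_orthogonal:
  fixes T :: "'a::euclidean_space \<Rightarrow> 'a"
  assumes T: "orthogonal_transformation T"
  shows "distr lborel borel T = lborel"
proof -
  have continuous: "f \<in> borel_measurable borel" if "orthogonal_transformation f" for f :: "'a \<Rightarrow> 'a"
    using that by (intro borel_measurable_continuous_onI linear_continuous_on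
        linear_conv_bounded_linear[THEN iffD1] orthogonal_transformation_linear)
  have T_meas [measurable]: "T \<in> borel_measurable borel"
    and inv_meas [measurable]: "inv T \<in> borel_measurable borel"
    using T orthogonal_transformation_inv by (auto intro: continuous)
  have inv: "T (inv T x) = x" "inv T (T x) = x" for x
    using orthogonal_transformation_bij[OF T] by (auto simp: bij_def surj_f_inv_f)
  define M where "M = distr lborel borel T"
  have "distr M borel (inv T) = lborel"
    unfolding M_def by (subst distr_distr) (auto simp: comp_def inv distr_id2)
  then have "sigma_finite_measure M"
    by (intro sigma_finite_measure_distr[of M borel "inv T"])
      (auto simp: M_def lborel.sigma_finite_measure_axioms)
  moreover have "distr M borel ((+) t) = M" for t
  proof -
    have "distr M borel ((+) t) = distr lborel borel (T \<circ> (+) (inv T t))"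
      unfolding M_def using linear_add[OF orthogonal_transformation_linear[OF T]]
      by (subst distr_distr) (auto simp: comp_def inv)
    also have "\<dots> = distr (distr lborel borel ((+) (inv T t))) borel T"
      by (subst distr_distr) auto
    finally show ?thesis
      by (simp add: M_def lborel_distr_plus)
  qed
  moreover have "emeasure M (ball 0 1) = emeasure lborel (ball 0 1 :: 'a set)"
  proof -
    have "T -` ball 0 1 = ball 0 1"
      using orthogonal_transformation_norm[OF T] by auto
    then show ?thesis
      unfolding M_def by (subst emeasure_distr) auto
  qed
  ultimately have "M = lborel"
    by (intro translation_invariant_measure_eq_lborel) (simp_all add: M_def)
  then show ?thesis
    by (simp add: M_def)
qed

lemma distr_PiM_reindex_bij:
  assumes "sigma_finite_measure N" "finite I" "bij_betw \<phi> I J"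
  shows "distr (\<Pi>\<^sub>M i\<in>I. N) (\<Pi>\<^sub>M j\<in>J. N) (\<lambda>t. \<lambda>j\<in>J. t (inv_into I \<phi> j)) = (\<Pi>\<^sub>M j\<in>J. N)"
proof -
  interpret product_sigma_finite "\<lambda>_. N"
    using assms(1) by (simp add: product_sigma_finite_def)
  have mem: "\<phi> i \<in> J" "inv_into I \<phi> (\<phi> i) = i" if "i \<in> I" for i
    using assms(3) that by (auto simp: bij_betw_def)
  have mem': "inv_into I \<phi> j \<in> I" "\<phi> (inv_into I \<phi> j) = j" if "j \<in> J" for j
    using assms(3) that by (auto simp: bij_betw_def inv_into_into f_inv_into_f)
  have meas: "(\<lambda>t. \<lambda>j\<in>J. t (inv_into I \<phi> j)) \<in> measurable (\<Pi>\<^sub>M i\<in>I. N) (\<Pi>\<^sub>M j\<in>J. N)"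
    using mem' by (intro measurable_restrict measurable_component_singleton) auto
  have finJ: "finite J"
    using assms(2,3) bij_betw_finite by blast
  show ?thesis
  proof (rule PiM_eqI[OF finJ])
    fix A
    assume A: "\<And>j. j \<in> J \<Longrightarrow> A j \<in> sets N"
    have "(\<forall>j\<in>J. t (inv_into I \<phi> j) \<in> A j) \<longleftrightarrow> (\<forall>i\<in>I. t i \<in> A (\<phi> i))" for t
      using mem mem' by metis
    moreover have "y \<in> space N" if "i \<in> I" "y \<in> A (\<phi> i)" for i y
      using sets.sets_into_space[OF A[OF mem(1)[OF that(1)]]] that(2) by blast
    ultimately have vimage: "(\<lambda>t. \<lambda>j\<in>J. t (inv_into I \<phi> j)) -` Pi\<^sub>E J A \<inter> space (\<Pi>\<^sub>M i\<in>I. N) =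
        Pi\<^sub>E I (\<lambda>i. A (\<phi> i))"
      by (auto simp: space_PiM PiE_iff)
    have "emeasure (distr (\<Pi>\<^sub>M i\<in>I. N) (\<Pi>\<^sub>M j\<in>J. N) (\<lambda>t. \<lambda>j\<in>J. t (inv_into I \<phi> j))) (Pi\<^sub>E J A) =
        emeasure (\<Pi>\<^sub>M i\<in>I. N) (Pi\<^sub>E I (\<lambda>i. A (\<phi> i)))"
      using A finJ by (subst emeasure_distr[OF meas]) (simp_all add: sets_PiM_I_finite vimage)
    also have "\<dots> = (\<Prod>i\<in>I. emeasure N (A (\<phi> i)))"
      using A mem(1) by (intro emeasure_PiM assms(2)) auto
    also have "\<dots> = (\<Prod>j\<in>J. emeasure N (A j))"
      by (rule prod.reindex_bij_betw[OF assms(3)])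
    finally show "emeasure (distr (\<Pi>\<^sub>M i\<in>I. N) (\<Pi>\<^sub>M j\<in>J. N) (\<lambda>t. \<lambda>j\<in>J. t (inv_into I \<phi> j)))
        (Pi\<^sub>E J A) = (\<Prod>j\<in>J. emeasure N (A j))" .
  qed simp
qed

definition orthonormal :: "'a::euclidean_space set \<Rightarrow> bool" where
  "orthonormal C \<longleftrightarrow> pairwise orthogonal C \<and> (\<forall>c\<in>C. norm c = 1)"

lemma orthonormal_inner: "orthonormal C \<Longrightarrow> c \<in> C \<Longrightarrow> d \<in> C \<Longrightarrow> c \<bullet> d = (if c = d then 1 else 0)"
  by (auto simp: orthonormal_def pairwise_def orthogonal_def norm_eq_1)

lemma orthonormal_independent: "orthonormal C \<Longrightarrow> independent C"
  unfolding orthonormal_def using pairwise_orthogonal_independent by fastforce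

lemma orthonormal_finite: "orthonormal C \<Longrightarrow> finite C"
  using orthonormal_independent independent_imp_finite by blast

lemma inner_sum_orthonormal:
  assumes "orthonormal C" "d \<in> C"
  shows "d \<bullet> (\<Sum>c\<in>C. f c *\<^sub>R c) = f d"
proof -
  have "d \<bullet> (\<Sum>c\<in>C. f c *\<^sub>R c) = (\<Sum>c\<in>C. if c = d then f c else 0)"
    unfolding inner_sum_right
    by (rule sum.cong) (use orthonormal_inner[OF assms(1)] assms(2) in auto)
  then show ?thesis
    using assms(2) orthonormal_finite[OF assms(1)] by simp
qed

lemma orthonormal_basis_exists:
  assumes "subspace S"
  obtains B where "orthonormal B" "span B = S"
  using orthonormal_basis_subspace[OF assms] unfolding orthonormal_def by metis

lemma orthogonal_transformation_onto_orthonormal_basis: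
  fixes D :: "'a::euclidean_space set"
  assumes "orthonormal D" "span D = UNIV"
  obtains \<phi> T where "bij_betw \<phi> (Basis :: 'a set) D" "orthogonal_transformation T"
    "\<And>t. T (\<Sum>i\<in>Basis. t i *\<^sub>R i) = (\<Sum>i\<in>Basis. t i *\<^sub>R \<phi> i)"
proof -
  have "card D = DIM('a)"
    using dim_span_eq_card_independent[OF orthonormal_independent[OF assms(1)]] assms(2) by simp
  then obtain \<phi> where \<phi>: "bij_betw \<phi> (Basis :: 'a set) D"
    using finite_same_card_bij[OF finite_Basis orthonormal_finite[OF assms(1)]] by auto
  define T where "T x = (\<Sum>i\<in>Basis. (x \<bullet> i) *\<^sub>R \<phi> i)" for x :: 'a
  have coord: "\<phi> i \<bullet> T y = y \<bullet> i" if "i \<in> Basis" for i y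
  proof -
    have "T y = (\<Sum>d\<in>D. (y \<bullet> inv_into Basis \<phi> d) *\<^sub>R d)"
      unfolding T_def using \<phi>
      by (subst sum.reindex_bij_betw[OF \<phi>, symmetric]) (simp add: bij_betw_def)
    then show ?thesis
      using inner_sum_orthonormal[OF assms(1) bij_betw_apply[OF \<phi> that]] \<phi> that
      by (simp add: bij_betw_def)
  qed
  have "T x \<bullet> T y = x \<bullet> y" for x y
  proof -
    have "T x \<bullet> T y = (\<Sum>i\<in>Basis. (x \<bullet> i) * (\<phi> i \<bullet> T y))"
      by (simp add: T_def[of x] inner_sum_left)
    then show ?thesis
      by (simp add: coord euclidean_inner[of x y])
  qed
  moreover have "linear T"
    unfolding T_def
    by (intro linear_compose_sum ballI linearI) (auto simp: inner_add_left algebra_simps)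
  ultimately have "orthogonal_transformation T"
    by (simp add: orthogonal_transformation_def)
  moreover have "T (\<Sum>i\<in>Basis. t i *\<^sub>R i) = (\<Sum>i\<in>Basis. t i *\<^sub>R \<phi> i)" for t
    by (simp add: T_def)
  ultimately show thesis
    using that \<phi> by blast
qed

lemma lborel_eq_orthonormal:
  fixes D :: "'a::euclidean_space set"
  assumes "orthonormal D" "span D = UNIV"
  shows "lborel = distr (\<Pi>\<^sub>M d\<in>D. lborel) borel (\<lambda>t. \<Sum>d\<in>D. t d *\<^sub>R d)"
proof -
  obtain \<phi> T where \<phi>: "bij_betw \<phi> (Basis :: 'a set) D" and T: "orthogonal_transformation T"
    "\<And>t. T (\<Sum>i\<in>Basis. t i *\<^sub>R i) = (\<Sum>i\<in>Basis. t i *\<^sub>R \<phi> i)"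
    using orthogonal_transformation_onto_orthonormal_basis[OF assms] by blast
  let ?reindex = "\<lambda>t. \<lambda>d\<in>D. t (inv_into Basis \<phi> d)"
  let ?MB = "\<Pi>\<^sub>M i\<in>(Basis :: 'a set). (lborel :: real measure)"
  let ?MD = "\<Pi>\<^sub>M d\<in>D. (lborel :: real measure)"
  have [measurable]: "T \<in> borel_measurable borel"
    using T(1) by (intro borel_measurable_continuous_onI linear_continuous_on
        linear_conv_bounded_linear[THEN iffD1] orthogonal_transformation_linear)
  have reindex [measurable]: "?reindex \<in> measurable ?MB ?MD"
    using \<phi> by (intro measurable_restrict measurable_component_singleton)
      (auto simp: bij_betw_def inv_into_into)
  have sum_reindex: "(\<Sum>d\<in>D. ?reindex t d *\<^sub>R d) = T (\<Sum>i\<in>Basis. t i *\<^sub>R i)" for t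
    unfolding T(2) using \<phi>
    by (subst sum.reindex_bij_betw[OF \<phi>, symmetric]) (auto simp: bij_betw_def intro: sum.cong)
  have "distr ?MD borel (\<lambda>t. \<Sum>d\<in>D. t d *\<^sub>R d) =
      distr (distr ?MB ?MD ?reindex) borel (\<lambda>t. \<Sum>d\<in>D. t d *\<^sub>R d)"
    by (simp only: distr_PiM_reindex_bij[OF lborel.sigma_finite_measure_axioms finite_Basis \<phi>])
  also have "\<dots> = distr ?MB borel ((\<lambda>t. \<Sum>d\<in>D. t d *\<^sub>R d) \<circ> ?reindex)"
    by (rule distr_distr) measurable
  also have "(\<lambda>t. \<Sum>d\<in>D. t d *\<^sub>R d) \<circ> ?reindex = T \<circ> (\<lambda>t. \<Sum>i\<in>Basis. t i *\<^sub>R i)"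
    using sum_reindex by (simp add: fun_eq_iff)
  also have "distr ?MB borel \<dots> = distr (distr ?MB borel (\<lambda>t. \<Sum>i\<in>Basis. t i *\<^sub>R i)) borel T"
    by (rule distr_distr[symmetric]) measurable
  also have "\<dots> = lborel"
    by (simp add: lborel_distr_orthogonal[OF T(1)] flip: lborel_eq)
  finally show ?thesis
    by simp
qed

lemma lborel_eq_orthonormal_Un:
  fixes B C :: "'a::euclidean_space set"
  assumes "orthonormal (B \<union> C)" "span (B \<union> C) = UNIV" "B \<inter> C = {}"
  shows "lborel = distr ((\<Pi>\<^sub>M b\<in>B. lborel) \<Otimes>\<^sub>M (\<Pi>\<^sub>M c\<in>C. lborel)) borel
    (\<lambda>(s, r). (\<Sum>b\<in>B. s b *\<^sub>R b) + (\<Sum>c\<in>C. r c *\<^sub>R c))"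
proof -
  have fin: "finite B" "finite C"
    using orthonormal_finite[OF assms(1)] by auto
  interpret product_sigma_finite "\<lambda>_::'a. lborel :: real measure" ..
  let ?MB = "\<Pi>\<^sub>M b\<in>B. (lborel :: real measure)" and ?MC = "\<Pi>\<^sub>M c\<in>C. (lborel :: real measure)"
  let ?MD = "\<Pi>\<^sub>M d\<in>B \<union> C. (lborel :: real measure)"
  have "lborel = distr (distr (?MB \<Otimes>\<^sub>M ?MC) ?MD (merge B C)) borel (\<lambda>t. \<Sum>d\<in>B \<union> C. t d *\<^sub>R d)"
    unfolding distr_merge[OF assms(3) fin] by (rule lborel_eq_orthonormal[OF assms(1,2)])
  also have "\<dots> = distr (?MB \<Otimes>\<^sub>M ?MC) borel ((\<lambda>t. \<Sum>d\<in>B \<union> C. t d *\<^sub>R d) \<circ> merge B C)"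
    by (rule distr_distr) measurable
  also have "(\<lambda>t. \<Sum>d\<in>B \<union> C. t d *\<^sub>R d) \<circ> merge B C =
      (\<lambda>(s, r). (\<Sum>b\<in>B. s b *\<^sub>R b) + (\<Sum>c\<in>C. r c *\<^sub>R c))"
  proof (intro ext, clarsimp)
    fix s r
    have "(\<Sum>c\<in>C. merge B C (s, r) c *\<^sub>R c) = (\<Sum>c\<in>C. r c *\<^sub>R c)"
      using assms(3) by (intro sum.cong) (auto simp: merge_def)
    moreover have "(\<Sum>b\<in>B. merge B C (s, r) b *\<^sub>R b) = (\<Sum>b\<in>B. s b *\<^sub>R b)"
      by (intro sum.cong) (auto simp: merge_def)
    ultimately show "(\<Sum>d\<in>B \<union> C. merge B C (s, r) d *\<^sub>R d) =
        (\<Sum>b\<in>B. s b *\<^sub>R b) + (\<Sum>c\<in>C. r c *\<^sub>R c)"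
      by (simp add: sum.union_disjoint[OF fin assms(3)])
  qed
  finally show ?thesis .
qed

section \<open>Lebesgue measure on affine subspaces\<close>

definition perp_space :: "'a::euclidean_space \<Rightarrow> 'a set \<Rightarrow> 'a set" where
  "perp_space p C = {x. \<forall>c\<in>C. c \<bullet> (x - p) = 0}"

definition perp_proj :: "'a::euclidean_space \<Rightarrow> 'a set \<Rightarrow> 'a \<Rightarrow> 'a" where
  "perp_proj p C x = x - (\<Sum>c\<in>C. (c \<bullet> (x - p)) *\<^sub>R c)"

definition unit_slab :: "'a::euclidean_space \<Rightarrow> 'a set \<Rightarrow> 'a set" where
  "unit_slab p C = {x. \<forall>c\<in>C. c \<bullet> (x - p) \<in> {0..1}}"

text \<open>The slab over \<open>perp_space p C\<close> has height 1 in all directions of the orthonormal set \<open>C\<close>,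
  so its volume over a subset of \<open>perp_space p C\<close> is the volume of that subset.\<close>

definition perp_measure :: "'a::euclidean_space \<Rightarrow> 'a set \<Rightarrow> 'a measure" where
  "perp_measure p C = distr (density lborel (indicator (unit_slab p C))) borel (perp_proj p C)"

lemma perp_proj_mem: "orthonormal C \<Longrightarrow> perp_proj p C x \<in> perp_space p C"
  by (simp add: perp_proj_def perp_space_def inner_diff_right inner_sum_orthonormal)

lemma perp_proj_translate: "perp_proj (p + l) C (x + l) = perp_proj p C x + l"
  by (simp add: perp_proj_def)

lemma unit_slab_translate: "x + l \<in> unit_slab (p + l) C \<longleftrightarrow> x \<in> unit_slab p C"
  by (simp add: unit_slab_def)

lemma perp_space_translate: "perp_space (p + l) C = (+) l ` perp_space p C"
proof (intro subset_antisym subsetI)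
  fix x
  assume "x \<in> perp_space (p + l) C"
  then have "x - l \<in> perp_space p C"
    by (simp add: perp_space_def algebra_simps)
  then show "x \<in> (+) l ` perp_space p C"
    by (intro image_eqI[of _ _ "x - l"]) auto
qed (auto simp: perp_space_def algebra_simps)

lemma borel_measurable_perp_proj [measurable]: "perp_proj p C \<in> borel_measurable borel"
  unfolding perp_proj_def by (intro borel_measurable_continuous_onI continuous_intros)

lemma closed_inner_constraints:
  assumes "closed S"
  shows "closed {x. \<forall>c\<in>C. c \<bullet> (x - p) \<in> S}"
proof -
  have "closed ((\<lambda>x. c \<bullet> (x - p)) -` S)" for c
    using assms by (intro continuous_closed_vimage) (auto intro!: continuous_intros)
  moreover have "{x. \<forall>c\<in>C. c \<bullet> (x - p) \<in> S} = (\<Inter>c\<in>C. (\<lambda>x. c \<bullet> (x - p)) -` S)"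
    by auto
  ultimately show ?thesis
    by (simp add: closed_INT)
qed

lemma borel_unit_slab [measurable]: "unit_slab p C \<in> sets borel"
  unfolding unit_slab_def by (intro borel_closed closed_inner_constraints) simp

lemma borel_perp_space [measurable]: "perp_space p C \<in> sets borel"
  using closed_inner_constraints[of "{0}" C p] by (simp add: perp_space_def borel_closed)

lemma unit_slab_proj_dist:
  assumes "orthonormal C" "x \<in> unit_slab p C"
  shows "norm x \<le> norm (perp_proj p C x) + real (card C)"
proof -
  have "norm (\<Sum>c\<in>C. (c \<bullet> (x - p)) *\<^sub>R c) \<le> (\<Sum>c\<in>C. 1)"
    by (rule order_trans[OF norm_sum sum_mono])
      (use assms in \<open>auto simp: orthonormal_def unit_slab_def\<close>)
  then show ?thesis
    using norm_triangle_ineq[of "perp_proj p C x" "\<Sum>c\<in>C. (c \<bullet> (x - p)) *\<^sub>R c"]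
    by (simp add: perp_proj_def)
qed

lemma unit_slab_contains_ball:
  assumes "orthonormal C"
  obtains q where "ball q (1/2) \<subseteq> unit_slab p C"
proof
  define q where "q = p + (\<Sum>c\<in>C. (1/2) *\<^sub>R c)"
  show "ball q (1/2) \<subseteq> unit_slab p C"
  proof
    fix x
    assume x: "x \<in> ball q (1/2)"
    have "c \<bullet> (x - p) \<in> {0..1}" if c: "c \<in> C" for c
    proof -
      have "c \<bullet> (x - p) = c \<bullet> (x - q) + 1/2"
        using inner_sum_orthonormal[OF assms c, of "\<lambda>_. 1/2"]
        by (simp add: q_def inner_diff_right inner_add_right)
      moreover have "\<bar>c \<bullet> (x - q)\<bar> \<le> norm (x - q)"
        using Cauchy_Schwarz_ineq2[of c "x - q"] assms c by (simp add: orthonormal_def)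
      moreover have "norm (x - q) < 1/2"
        using x by (simp add: dist_norm norm_minus_commute)
      ultimately show ?thesis
        by auto
    qed
    then show "x \<in> unit_slab p C"
      by (simp add: unit_slab_def)
  qed
qed

lemma affine_eq_perp_space:
  fixes V :: "'a::euclidean_space set"
  assumes "affine V" "p \<in> V"
  obtains C where "orthonormal C" "V = perp_space p C"
proof -
  define T where "T = (\<lambda>x. x - p) ` V"
  have T: "subspace T"
    unfolding T_def by (rule affine_diffs_subspace_subtract[OF assms])
  obtain C where C: "orthonormal C" "span C = T\<^sup>\<bottom>"
    using orthonormal_basis_exists[OF subspace_orthogonal_comp] .
  have "x \<in> T \<longleftrightarrow> (\<forall>c\<in>C. c \<bullet> x = 0)" for x
  proof -
    have "x \<in> T \<longleftrightarrow> (\<forall>y\<in>span C. orthogonal y x)"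
      using orthogonal_comp_self[OF T] by (auto simp: C(2) orthogonal_comp_def)
    also have "\<dots> \<longleftrightarrow> (\<forall>c\<in>C. orthogonal c x)"
      by (metis orthogonal_commute orthogonal_to_span span_base)
    finally show ?thesis
      by (simp add: orthogonal_def)
  qed
  moreover have "x \<in> V \<longleftrightarrow> x - p \<in> T" for x
    by (auto simp: T_def)
  ultimately have "V = perp_space p C"
    by (auto simp: perp_space_def)
  then show thesis
    using that C(1) by blast
qed

lemma sets_perp_measure [simp, measurable_cong]: "sets (perp_measure p C) = sets borel"
  by (simp add: perp_measure_def)

lemma space_perp_measure [simp]: "space (perp_measure p C) = UNIV"
  by (simp add: perp_measure_def)

lemma emeasure_perp_measure:
  assumes [measurable]: "F \<in> sets borel"
  shows "emeasure (perp_measure p C) F = emeasure lborel {x \<in> unit_slab p C. perp_proj p C x \<in> F}"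
proof -
  have "emeasure (perp_measure p C) F =
      emeasure (density lborel (indicator (unit_slab p C))) (perp_proj p C -` F)"
    unfolding perp_measure_def by (subst emeasure_distr) simp_all
  also have "\<dots> = (\<integral>\<^sup>+x. indicator (unit_slab p C) x * indicator (perp_proj p C -` F) x \<partial>lborel)"
    using measurable_sets[OF borel_measurable_perp_proj assms] by (intro emeasure_density) auto
  also have "\<dots> = (\<integral>\<^sup>+x. indicator {x \<in> unit_slab p C. perp_proj p C x \<in> F} x \<partial>lborel)"
    by (intro nn_integral_cong) (simp add: indicator_def)
  also have "\<dots> = emeasure lborel {x \<in> unit_slab p C. perp_proj p C x \<in> F}"
    by (rule nn_integral_indicator) measurable
  finally show ?thesis .
qed

lemma distr_perp_measure_translate:
  "distr (perp_measure p C) borel ((+) l) = perp_measure (p + l) C"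
proof (rule measure_eqI)
  fix F
  assume "F \<in> sets (distr (perp_measure p C) borel ((+) l))"
  then have F [measurable]: "F \<in> sets borel"
    by simp
  have "emeasure (perp_measure (p + l) C) F =
      emeasure (distr lborel borel ((+) l)) {x \<in> unit_slab (p + l) C. perp_proj (p + l) C x \<in> F}"
    by (simp add: emeasure_perp_measure lborel_distr_plus)
  also have "\<dots> = emeasure lborel
      ((+) l -` {x \<in> unit_slab (p + l) C. perp_proj (p + l) C x \<in> F})"
    by (subst emeasure_distr) auto
  also have "(+) l -` {x \<in> unit_slab (p + l) C. perp_proj (p + l) C x \<in> F} =
      {x \<in> unit_slab p C. perp_proj p C x \<in> (+) l -` F}"
    by (auto simp: add.commute[of l] unit_slab_translate perp_proj_translate)
  also have "emeasure lborel \<dots> = emeasure (perp_measure p C) ((+) l -` F)"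
    using measurable_sets[of "(+) l" borel borel F]
    by (intro emeasure_perp_measure[symmetric]) simp
  also have "\<dots> = emeasure (distr (perp_measure p C) borel ((+) l)) F"
    by (subst emeasure_distr) simp_all
  finally show "emeasure (distr (perp_measure p C) borel ((+) l)) F =
      emeasure (perp_measure (p + l) C) F"
    by simp
qed simp

lemma perp_measure_translate_along:
  assumes "\<And>c. c \<in> C \<Longrightarrow> c \<bullet> s = 0"
  shows "distr (perp_measure p C) borel ((+) s) = perp_measure p C"
proof -
  have "unit_slab (p + s) C = unit_slab p C" "perp_proj (p + s) C = perp_proj p C"
    using assms
    by (auto simp: unit_slab_def perp_proj_def fun_eq_iff inner_diff_right inner_add_right)
  then show ?thesis
    unfolding distr_perp_measure_translate by (simp add: perp_measure_def)
qed

lemma emeasure_perp_measure_cball_finite: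
  assumes "orthonormal C"
  shows "emeasure (perp_measure p C) (cball 0 R) < \<infinity>"
proof -
  have "{x \<in> unit_slab p C. perp_proj p C x \<in> cball 0 R} \<subseteq> cball 0 (R + real (card C))"
    using unit_slab_proj_dist[OF assms] by fastforce
  then have "emeasure (perp_measure p C) (cball 0 R) \<le>
      emeasure lborel (cball (0::'a) (R + real (card C)))"
    by (subst emeasure_perp_measure) (auto intro: emeasure_mono)
  then show ?thesis
    using emeasure_lborel_cball_finite by (rule order_le_less_trans)
qed

lemma emeasure_perp_measure_UNIV_nonzero:
  assumes "orthonormal C"
  shows "emeasure (perp_measure p C) UNIV \<noteq> 0"
proof -
  obtain q where "ball q (1/2) \<subseteq> unit_slab p C"
    using unit_slab_contains_ball[OF assms] .
  then have "emeasure lborel (ball q (1/2)) \<le> emeasure (perp_measure p C) UNIV"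
    by (subst emeasure_perp_measure) (auto intro: emeasure_mono)
  then show ?thesis
    using emeasure_lborel_ball_nonzero[of "1/2" q] by auto
qed

lemma AE_perp_measure_mem:
  assumes "orthonormal C"
  shows "AE x in perp_measure p C. x \<in> perp_space p C"
  unfolding perp_measure_def using perp_proj_mem[OF assms] by (subst AE_distr_iff) auto

lemma AE_perp_measure_height_nonzero:
  assumes "\<not> vanishes_on h (perp_space p C)"
  shows "AE x in perp_measure p C. height h x \<noteq> 0"
proof -
  define a where "a = gradient h - (\<Sum>c\<in>C. (gradient h \<bullet> c) *\<^sub>R c)"
  define b where "b = offset h - (\<Sum>c\<in>C. (c \<bullet> p) * (gradient h \<bullet> c))"
  have proj: "height h (perp_proj p C x) = a \<bullet> x - b" for x
    by (simp add: height_def perp_proj_def a_def b_def inner_diff_left inner_diff_right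
        inner_sum_left inner_sum_right sum_subtractf algebra_simps)
  obtain z where z: "z \<in> perp_space p C" "height h z \<noteq> 0"
    using assms by (auto simp: vanishes_on_def)
  then have "perp_proj p C z = z"
    by (simp add: perp_proj_def perp_space_def)
  then have "a \<noteq> 0 \<or> b \<noteq> 0"
    using proj[of z] z(2) by auto
  then have "negligible {x. a \<bullet> x = b}"
    by (rule negligible_hyperplane)
  then have null: "emeasure lborel {x. a \<bullet> x = b} = 0"
    using closed_hyperplane[of a b]
    by (simp add: negligible_iff_null_sets null_sets_completion_iff null_setsD1)
  have "closed {x. height h x = 0}"
    unfolding height_def using closed_hyperplane[of "gradient h" "offset h"] by simp
  then have "emeasure (perp_measure p C) {x. height h x = 0} =
      emeasure lborel {x \<in> unit_slab p C. a \<bullet> x = b}"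
    by (simp add: emeasure_perp_measure borel_closed proj)
  also have "\<dots> \<le> emeasure lborel {x. a \<bullet> x = b}"
    using closed_hyperplane[of a b] by (intro emeasure_mono) (auto simp: borel_closed)
  finally have "{x. height h x = 0} \<in> null_sets (perp_measure p C)"
    using \<open>closed {x. height h x = 0}\<close> null by (simp add: null_sets_def borel_closed)
  from AE_not_in[OF this] show ?thesis
    by simp
qed

lemma eventually_generic_imp_AE_perp_measure:
  assumes C: "orthonormal C" and P: "\<forall>\<^sub>F x in generic (perp_space p C). P x"
  shows "AE x in perp_measure p C. P x"
proof -
  have "AE x in perp_measure p C. norm x < real k \<longrightarrow> P x" for k :: nat
  proof -
    obtain \<Sigma> where \<Sigma>: "finite \<Sigma>" "\<And>x. x \<in> perp_space p C \<Longrightarrow> norm x < real k \<Longrightarrow>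
        regular \<Sigma> (perp_space p C) x \<Longrightarrow> P x"
      using eventually_genericE[OF P] by blast
    have "AE x in perp_measure p C. \<forall>h\<in>{h\<in>\<Sigma>. \<not> vanishes_on h (perp_space p C)}. height h x \<noteq> 0"
      using \<Sigma>(1) by (intro AE_finite_allI AE_perp_measure_height_nonzero) auto
    with AE_perp_measure_mem[OF C] show ?thesis
      by eventually_elim (use \<Sigma>(2) in \<open>auto simp: regular_def\<close>)
  qed
  then have "AE x in perp_measure p C. \<forall>k::nat. norm x < real k \<longrightarrow> P x"
    unfolding AE_all_countable by (rule allI)
  then show ?thesis
    by eventually_elim (use reals_Archimedean2 in blast)
qed

lemma subspace_perp_space: "subspace (perp_space 0 C)"
  by (auto simp: subspace_def perp_space_def inner_add_right)

lemma orthonormal_frame_perp_space_exists: "\<exists>q B. orthonormal_frame (perp_space p C) q B"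
proof -
  obtain B where "orthonormal B" "span B = perp_space 0 C"
    using orthonormal_basis_exists[OF subspace_perp_space] .
  moreover have "perp_space p C = (+) p ` perp_space 0 C"
    using perp_space_translate[of 0 p C] by simp
  ultimately have "orthonormal_frame (perp_space p C) p B"
    by (simp add: orthonormal_frame_def orthonormal_def)
  then show ?thesis
    by blast
qed

lemma orthonormal_frame_perp_space:
  assumes C: "orthonormal C" and frame: "orthonormal_frame (perp_space p C) q B"
  shows "c \<in> C \<Longrightarrow> c \<bullet> (q - p) = 0" "b \<in> B \<Longrightarrow> c \<in> C \<Longrightarrow> b \<bullet> c = 0" "B \<inter> C = {}"
    "orthonormal (B \<union> C)" "span (B \<union> C) = UNIV"
proof -
  have B: "orthonormal B" and V: "perp_space p C = (+) q ` span B"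
    using frame by (auto simp: orthonormal_frame_def orthonormal_def)
  have "q + 0 \<in> perp_space p C"
    unfolding V by (intro imageI span_zero)
  then show qp: "c \<bullet> (q - p) = 0" if "c \<in> C" for c
    using that by (simp add: perp_space_def)
  have span_B: "x \<in> span B \<longleftrightarrow> (\<forall>c\<in>C. c \<bullet> x = 0)" for x
  proof -
    have "x \<in> span B \<longleftrightarrow> q + x \<in> perp_space p C"
      unfolding V by auto
    also have "\<dots> \<longleftrightarrow> (\<forall>c\<in>C. c \<bullet> x + c \<bullet> (q - p) = 0)"
      by (simp add: perp_space_def inner_add_right inner_diff_right algebra_simps)
    finally show ?thesis
      using qp by simp
  qed
  show BC: "b \<bullet> c = 0" if "b \<in> B" "c \<in> C" for b c
    using span_B[of b] span_base[OF that(1)] that(2) by (metis inner_commute)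
  then show "B \<inter> C = {}"
    using orthonormal_inner[OF C] by fastforce
  show "orthonormal (B \<union> C)"
    using B C BC unfolding orthonormal_def pairwise_def orthogonal_def
    by (metis Un_iff inner_commute)
  show "span (B \<union> C) = UNIV"
  proof (rule UNIV_eq_I[symmetric])
    fix x
    have "x - (\<Sum>c\<in>C. (c \<bullet> x) *\<^sub>R c) \<in> span B"
      unfolding span_B by (simp add: inner_diff_right inner_sum_orthonormal[OF C])
    then have "x - (\<Sum>c\<in>C. (c \<bullet> x) *\<^sub>R c) \<in> span (B \<union> C)"
      using span_mono[of B "B \<union> C"] by auto
    moreover have "(\<Sum>c\<in>C. (c \<bullet> x) *\<^sub>R c) \<in> span (B \<union> C)"
      by (intro span_sum span_scale span_base) simp
    ultimately show "x \<in> span (B \<union> C)"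
      using span_add by fastforce
  qed
qed

lemma unit_slab_proj_add:
  assumes C: "orthonormal C" and perp: "\<And>c. c \<in> C \<Longrightarrow> c \<bullet> (q - p) = 0" "\<And>c. c \<in> C \<Longrightarrow> c \<bullet> y = 0"
  shows "perp_proj p C (q + (y + (\<Sum>c\<in>C. r c *\<^sub>R c))) = q + y"
    "q + (y + (\<Sum>c\<in>C. r c *\<^sub>R c)) \<in> unit_slab p C \<longleftrightarrow> (\<forall>c\<in>C. r c \<in> {0..1})"
proof -
  define z where "z = (\<Sum>c\<in>C. r c *\<^sub>R c)"
  have coord: "c \<bullet> (q + (y + z) - p) = r c" if "c \<in> C" for c
  proof -
    have "c \<bullet> (q + (y + z) - p) = c \<bullet> (q - p) + c \<bullet> y + c \<bullet> z"
      by (simp add: inner_add_right inner_diff_right)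
    then show ?thesis
      using perp[OF that] inner_sum_orthonormal[OF C that, of r] by (simp add: z_def)
  qed
  then have "(\<Sum>c\<in>C. (c \<bullet> (q + (y + z) - p)) *\<^sub>R c) = z"
    by (simp add: z_def)
  then show "perp_proj p C (q + (y + (\<Sum>c\<in>C. r c *\<^sub>R c))) = q + y"
    unfolding perp_proj_def z_def[symmetric] by simp
  show "q + (y + (\<Sum>c\<in>C. r c *\<^sub>R c)) \<in> unit_slab p C \<longleftrightarrow> (\<forall>c\<in>C. r c \<in> {0..1})"
    unfolding unit_slab_def mem_Collect_eq z_def[symmetric]
    by (rule ball_cong[OF refl]) (simp only: coord)
qed

lemma emeasure_lborel_orthonormal_Un:
  fixes B C :: "'a::euclidean_space set"
  assumes BC: "orthonormal (B \<union> C)" "span (B \<union> C) = UNIV" "B \<inter> C = {}"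
    and E: "E \<in> sets borel"
  shows "emeasure lborel E = emeasure ((\<Pi>\<^sub>M b\<in>B. lborel) \<Otimes>\<^sub>M (\<Pi>\<^sub>M c\<in>C. lborel))
    {(s, r) \<in> (\<Pi>\<^sub>E b\<in>B. UNIV) \<times> (\<Pi>\<^sub>E c\<in>C. UNIV).
      q + ((\<Sum>b\<in>B. s b *\<^sub>R b) + (\<Sum>c\<in>C. r c *\<^sub>R c)) \<in> E}"
proof -
  let ?M = "(\<Pi>\<^sub>M b\<in>B. lborel :: real measure) \<Otimes>\<^sub>M (\<Pi>\<^sub>M c\<in>C. lborel :: real measure)"
  let ?\<sigma> = "\<lambda>(s, r). (\<Sum>b\<in>B. s b *\<^sub>R b) + (\<Sum>c\<in>C. r c *\<^sub>R c)"
  have "emeasure lborel E = emeasure (distr lborel borel ((+) q)) E"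
    by (simp add: lborel_distr_plus)
  also have "\<dots> = emeasure (distr ?M borel ?\<sigma>) ((+) q -` E)"
    using E by (subst emeasure_distr) (simp_all flip: lborel_eq_orthonormal_Un[OF BC])
  also have "\<dots> = emeasure ?M (?\<sigma> -` ((+) q -` E) \<inter> space ?M)"
    using measurable_sets[of "(+) q" borel borel E] E by (intro emeasure_distr) auto
  also have "?\<sigma> -` ((+) q -` E) \<inter> space ?M = {(s, r) \<in> (\<Pi>\<^sub>E b\<in>B. UNIV) \<times> (\<Pi>\<^sub>E c\<in>C. UNIV).
      q + ((\<Sum>b\<in>B. s b *\<^sub>R b) + (\<Sum>c\<in>C. r c *\<^sub>R c)) \<in> E}"
    by (auto simp: space_pair_measure space_PiM)
  finally show ?thesis .
qed

lemma emeasure_perp_measure_eq_frame: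
  assumes C: "orthonormal C" and frame: "orthonormal_frame (perp_space p C) q B"
    and F [measurable]: "F \<in> sets borel"
  defines "M \<equiv> \<Pi>\<^sub>M b\<in>B. (lborel :: real measure)"
  shows "emeasure (perp_measure p C) F = emeasure M {t \<in> space M. q + (\<Sum>b\<in>B. t b *\<^sub>R b) \<in> F}"
proof -
  note BC = orthonormal_frame_perp_space[OF C frame]
  have fin: "finite B" "finite C"
    using orthonormal_finite[OF BC(4)] by auto
  interpret product_sigma_finite "\<lambda>_::'a. lborel :: real measure" ..
  define N where "N = (\<Pi>\<^sub>M c\<in>C. (lborel :: real measure))"
  interpret N: sigma_finite_measure N
    unfolding N_def by (rule sigma_finite[OF fin(2)])
  define E where "E = {x \<in> unit_slab p C. perp_proj p C x \<in> F}"
  define X where "X = {t \<in> space M. q + (\<Sum>b\<in>B. t b *\<^sub>R b) \<in> F}"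
  define Y where "Y = (\<Pi>\<^sub>E c\<in>C. {0..1::real})"
  have [measurable_cong]: "sets M = sets (\<Pi>\<^sub>M b\<in>B. borel)"
    unfolding M_def by (auto intro!: sets_PiM_cong)
  have X: "X \<in> sets M"
    unfolding X_def by measurable
  have Y: "Y \<in> sets N"
    unfolding Y_def N_def by (rule sets_PiM_I_finite[OF fin(2)]) simp
  have "c \<bullet> (\<Sum>b\<in>B. s b *\<^sub>R b) = 0" if "c \<in> C" for c s
    using BC(2) that by (simp add: inner_sum_right inner_commute)
  then have mem_E: "q + ((\<Sum>b\<in>B. s b *\<^sub>R b) + (\<Sum>c\<in>C. r c *\<^sub>R c)) \<in> E \<longleftrightarrow>
      q + (\<Sum>b\<in>B. s b *\<^sub>R b) \<in> F \<and> (\<forall>c\<in>C. r c \<in> {0..1})" for s r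
    using unit_slab_proj_add[OF C BC(1)] by (auto simp: E_def)
  have "emeasure (perp_measure p C) F = emeasure lborel E"
    unfolding E_def by (rule emeasure_perp_measure[OF F])
  also have "\<dots> = emeasure (M \<Otimes>\<^sub>M N) {(s, r) \<in> (\<Pi>\<^sub>E b\<in>B. UNIV) \<times> (\<Pi>\<^sub>E c\<in>C. UNIV).
      q + ((\<Sum>b\<in>B. s b *\<^sub>R b) + (\<Sum>c\<in>C. r c *\<^sub>R c)) \<in> E}"
    unfolding M_def N_def
    by (rule emeasure_lborel_orthonormal_Un[OF BC(4,5,3)]) (simp add: E_def)
  also have "{(s, r) \<in> (\<Pi>\<^sub>E b\<in>B. UNIV) \<times> (\<Pi>\<^sub>E c\<in>C. UNIV).
      q + ((\<Sum>b\<in>B. s b *\<^sub>R b) + (\<Sum>c\<in>C. r c *\<^sub>R c)) \<in> E} = X \<times> Y"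
    using mem_E by (auto simp: X_def Y_def M_def space_PiM PiE_iff dest: extensional_arb)
  also have "emeasure (M \<Otimes>\<^sub>M N) (X \<times> Y) = emeasure M X * emeasure N Y"
    by (rule N.emeasure_pair_measure_Times[OF X Y])
  also have "emeasure N Y = 1"
    unfolding Y_def N_def by (subst emeasure_PiM[OF fin(2)]) auto
  finally show ?thesis
    by (simp add: X_def)
qed

lemma rel_volume_eq_perp_measure:
  assumes C: "orthonormal C" and hull: "affine hull F = perp_space p C" and F: "F \<in> sets borel"
  shows "rel_volume F = measure (perp_measure p C) F"
proof -
  obtain q B where qB: "(SOME (q, B). orthonormal_frame (affine hull F) q B) = (q, B)"
    by (meson surj_pair)
  have "\<exists>qB. case qB of (q, B) \<Rightarrow> orthonormal_frame (affine hull F) q B"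
    using orthonormal_frame_perp_space_exists[of p C] hull by auto
  from someI_ex[OF this] have "orthonormal_frame (perp_space p C) q B"
    unfolding qB by (simp add: hull)
  from emeasure_perp_measure_eq_frame[OF C this F] show ?thesis
    unfolding rel_volume_def qB by (simp add: Let_def measure_def)
qed

section \<open>Periodization over a discrete subgroup\<close>

definition periodization ::
    "'a::ab_group_add set \<Rightarrow> ('a \<Rightarrow> 'b::{comm_monoid_add,t2_space}) \<Rightarrow> 'a \<Rightarrow> 'b" where
  "periodization L g x = (\<Sum>\<^sub>\<infinity>l\<in>L. g (x + l))"

lemma translate_support_bounded:
  fixes g :: "'a::real_normed_vector \<Rightarrow> 'b::zero"
  assumes "\<And>y. g y \<noteq> 0 \<Longrightarrow> norm y \<le> M" "g (x + l) \<noteq> 0"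
  shows "norm l \<le> norm x + M"
  using assms(1)[OF assms(2)] norm_triangle_ineq4[of "x + l" x] by simp

locale discrete_subgroup =
  fixes L :: "'a::real_normed_vector set"
  assumes zero_mem: "0 \<in> L" and diff_mem: "x \<in> L \<Longrightarrow> y \<in> L \<Longrightarrow> x - y \<in> L"
    and finite_bounded: "finite {l \<in> L. norm l \<le> R}"
begin

lemma uminus_mem: "x \<in> L \<Longrightarrow> - x \<in> L"
  using diff_mem[OF zero_mem] by simp

lemma add_mem: "x \<in> L \<Longrightarrow> y \<in> L \<Longrightarrow> x + y \<in> L"
  using diff_mem[OF _ uminus_mem] by simp

lemma countable_subgroup: "countable L"
proof -
  have "L = (\<Union>k::nat. {l \<in> L. norm l \<le> real k})"
    using real_arch_simple by blast
  moreover have "countable (\<Union>k::nat. {l \<in> L. norm l \<le> real k})"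
    by (rule countable_UN) (auto intro: countable_finite finite_bounded)
  ultimately show ?thesis
    by simp
qed

lemma summable_on_translates:
  assumes "\<And>y. g y \<noteq> 0 \<Longrightarrow> norm y \<le> M"
  shows "(\<lambda>l. g (x + l)) summable_on L"
proof -
  have "(\<lambda>l. g (x + l)) summable_on {l \<in> L. norm l \<le> norm x + M}"
    by (simp add: finite_bounded)
  then show ?thesis
    using translate_support_bounded[of g M x, OF assms]
    by (subst summable_on_cong_neutral[where T = "{l \<in> L. norm l \<le> norm x + M}"]) auto
qed

lemma periodization_eq_sum:
  assumes "\<And>y. g y \<noteq> 0 \<Longrightarrow> norm y \<le> M" "norm x + M \<le> R"
  shows "periodization L g x = (\<Sum>l | l \<in> L \<and> norm l \<le> R. g (x + l))"
proof -
  have "periodization L g x = (\<Sum>\<^sub>\<infinity>l | l \<in> L \<and> norm l \<le> R. g (x + l))"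
    unfolding periodization_def using translate_support_bounded[of g M x, OF assms(1)] assms(2)
    by (intro infsum_cong_neutral) force+
  then show ?thesis
    by (simp add: finite_bounded)
qed

lemma periodization_mult_eq_sum:
  fixes G w :: "'a \<Rightarrow> real"
  assumes "\<And>x. G x \<noteq> 0 \<Longrightarrow> norm x \<le> \<rho>" "\<And>x. w x \<noteq> 0 \<Longrightarrow> norm x \<le> \<rho>"
  shows "periodization L G x * w x = (\<Sum>l | l \<in> L \<and> norm l \<le> 2 * \<rho>. G (x + l) * w x)"
  using assms(2)[of x] periodization_eq_sum[of G \<rho> x "2 * \<rho>", OF assms(1)]
  by (cases "w x = 0") (simp_all flip: sum_distrib_right)

lemma periodization_translate:
  assumes "s \<in> L"
  shows "periodization L g (x + s) = periodization L g x"
proof -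
  have "bij_betw ((+) s) L L"
    by (rule bij_betwI[of _ _ _ "\<lambda>l. l - s"]) (use assms add_mem diff_mem in auto)
  from infsum_reindex_bij_betw[OF this, of "\<lambda>l. g (x + l)"] show ?thesis
    by (simp add: periodization_def add.assoc)
qed

end

lemma jump_support:
  fixes g :: "'a::real_normed_vector \<Rightarrow> 'b::{t2_space,ab_group_add}"
  assumes "\<And>y. g y \<noteq> 0 \<Longrightarrow> norm y \<le> M" "jump n g y \<noteq> 0"
  shows "norm y \<le> M"
proof (rule ccontr)
  assume "\<not> norm y \<le> M"
  have "jump n g y = jump n (\<lambda>_. 0) y"
    by (rule jump_cong_open[of "- cball 0 M"]) (use assms(1) \<open>\<not> norm y \<le> M\<close> in auto)
  then show False
    using assms(2) by simp
qed

lemma iter_jump_support: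
  fixes g :: "'a::euclidean_space \<Rightarrow> 'b::{t2_space,ab_group_add}"
  assumes "\<And>y. g y \<noteq> 0 \<Longrightarrow> norm y \<le> M" "iter_jump n r g y \<noteq> 0"
  shows "norm y \<le> M"
proof -
  have "\<forall>y. iter_jump n r g y \<noteq> 0 \<longrightarrow> norm y \<le> M"
    by (rule iter_jump_rel[of "\<lambda>u _. \<forall>y. u y \<noteq> 0 \<longrightarrow> norm y \<le> M"])
      (use assms(1) jump_support in metis)+
  then show ?thesis
    using assms(2) by blast
qed

context
  fixes L :: "'a::real_inner set" and g :: "'a \<Rightarrow> 'b::{t2_space,ab_group_add}" and M :: real
  assumes L: "discrete_subgroup L" and support: "\<And>y. g y \<noteq> 0 \<Longrightarrow> norm y \<le> M"
    and adapted: "locally_adapted g"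
begin

interpretation discrete_subgroup L
  by (rule L)

lemma locally_adapted_periodization: "locally_adapted (periodization L g)"
proof (rule locally_adaptedI)
  fix R
  let ?v = "\<lambda>x. \<Sum>l | l \<in> L \<and> norm l \<le> R + M. g (x + l)"
  have "locally_adapted ?v"
    by (intro locally_adapted_sum finite_bounded locally_adapted_translate adapted)
  moreover have "periodization L g x = ?v x" if "x \<in> ball 0 R" for x
    using that by (intro periodization_eq_sum[OF support]) auto
  ultimately show "\<exists>v. locally_adapted v \<and> (\<forall>x\<in>ball 0 R. periodization L g x = v x)"
    by blast
qed

lemma jump_periodization: "jump n (periodization L g) x = periodization L (jump n g) x"
proof -
  let ?I = "{l \<in> L. norm l \<le> norm x + 1 + M}"
  have "jump n (periodization L g) x = jump n (\<lambda>x. \<Sum>l\<in>?I. g (x + l)) x"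
  proof (rule jump_cong_open)
    show "periodization L g y = (\<Sum>l\<in>?I. g (y + l))" if "y \<in> ball 0 (norm x + 1)" for y
      using that by (intro periodization_eq_sum[OF support]) auto
  qed auto
  also have "\<dots> = (\<Sum>l\<in>?I. jump n g (x + l))"
    using jump_sum[of ?I "\<lambda>l x. g (x + l)"]
    by (simp add: finite_bounded locally_adapted_translate adapted jump_translate)
  also have "\<dots> = periodization L (jump n g) x"
    by (intro periodization_eq_sum[OF jump_support[OF support], symmetric]) auto
  finally show ?thesis .
qed

end

lemma iter_jump_periodization:
  fixes g :: "'a::euclidean_space \<Rightarrow> 'b::{t2_space,ab_group_add}"
  assumes "discrete_subgroup L" "\<And>y. g y \<noteq> 0 \<Longrightarrow> norm y \<le> M" "locally_adapted g"
  shows "iter_jump n r (periodization L g) = periodization L (iter_jump n r g)"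
proof -
  define R where "R u v \<longleftrightarrow> u = periodization L v \<and> locally_adapted v \<and> (\<forall>y. v y \<noteq> 0 \<longrightarrow> norm y \<le> M)"
    for u v :: "'a \<Rightarrow> 'b"
  have "R (iter_jump n r (periodization L g)) (iter_jump n r g)"
  proof (rule iter_jump_rel)
    show "R (periodization L g) g"
      using assms by (simp add: R_def)
    fix j u v
    assume "R u v"
    then have u: "u = periodization L v" and v: "locally_adapted v" "\<And>y. v y \<noteq> 0 \<Longrightarrow> norm y \<le> M"
      by (auto simp: R_def)
    have "jump (n j) u = periodization L (jump (n j) v)"
      unfolding u by (intro ext jump_periodization[OF assms(1) v(2,1)])
    moreover have "\<forall>y. jump (n j) v y \<noteq> 0 \<longrightarrow> norm y \<le> M"
      using jump_support v(2) by metis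
    ultimately show "R (jump (n j) u) (jump (n j) v)"
      using locally_adapted_jump[OF v(1)] by (simp add: R_def)
  qed
  then show ?thesis
    by (simp add: R_def)
qed

lemma finite_translates_support:
  fixes h :: "'a::real_normed_vector \<Rightarrow> 'b::zero"
  assumes "finite T" "t \<in> T" "\<And>y. h y \<noteq> 0 \<Longrightarrow> norm y \<le> M" "h (y + t) \<noteq> 0"
  shows "norm y \<le> M + (\<Sum>t\<in>T. norm t)"
proof -
  have "norm t \<le> (\<Sum>t\<in>T. norm t)"
    using assms(1,2) by (intro member_le_sum) auto
  then show ?thesis
    using assms(3)[OF assms(4)] norm_triangle_ineq4[of "y + t" t] by simp
qed

lemma (in discrete_subgroup) inj_on_add_transversal:
  assumes "\<And>t t'. t \<in> T \<Longrightarrow> t' \<in> T \<Longrightarrow> t - t' \<in> L \<Longrightarrow> t = t'"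
  shows "inj_on (\<lambda>(s, t). s + t) (L \<times> T)"
proof (rule inj_onI, clarsimp)
  fix s t s' t'
  assume mem: "s \<in> L" "s' \<in> L" "t \<in> T" "t' \<in> T" and eq: "s + t = s' + t'"
  from eq have "t - t' = s' - s"
    by (simp add: algebra_simps)
  then have "t = t'"
    using assms[OF mem(3,4)] diff_mem[OF mem(2,1)] by simp
  then show "s = s' \<and> t = t'"
    using eq by simp
qed

lemma (in discrete_subgroup) periodization_cosets:
  fixes h :: "'a \<Rightarrow> 'b::{comm_monoid_add,t2_space}"
  assumes "discrete_subgroup S" "S \<subseteq> L" "finite T" "T \<subseteq> L"
    and distinct: "\<And>t t'. t \<in> T \<Longrightarrow> t' \<in> T \<Longrightarrow> t - t' \<in> S \<Longrightarrow> t = t'"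
    and support: "\<And>y. h y \<noteq> 0 \<Longrightarrow> norm y \<le> M"
    and contributing: "\<And>l. l \<in> L \<Longrightarrow> h (x + l) \<noteq> 0 \<Longrightarrow> \<exists>t\<in>T. l - t \<in> S"
  shows "periodization L h x = periodization S (\<lambda>y. \<Sum>t\<in>T. h (y + t)) x"
proof -
  interpret S: discrete_subgroup S
    by (rule assms(1))
  let ?add = "\<lambda>(s, t). s + t"
  define M' where "M' = M + (\<Sum>t\<in>T. norm t)"
  define S0 where "S0 = {s \<in> S. norm s \<le> norm x + M'}"
  have support': "norm y \<le> M'" if "t \<in> T" "h (y + t) \<noteq> 0" for y t
    unfolding M'_def using support that(2) by (rule finite_translates_support[OF assms(3) that(1)])
  have inj: "inj_on ?add (S0 \<times> T)"
    using S.inj_on_add_transversal[OF distinct] by (rule inj_on_subset) (auto simp: S0_def)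
  have fin: "finite (S0 \<times> T)"
    using S.finite_bounded assms(3) by (simp add: S0_def)
  have contributing': "l \<in> ?add ` (S0 \<times> T)" if l: "l \<in> L" "h (x + l) \<noteq> 0" for l
  proof -
    obtain t where t: "t \<in> T" "l - t \<in> S"
      using contributing[OF l] by blast
    have "norm (l - t) \<le> norm x + M'"
      using support'[OF t(1)] l(2)
      by (intro translate_support_bounded[of "\<lambda>y. h (y + t)"]) (auto simp: add.assoc)
    then show ?thesis
      using t by (intro image_eqI[of _ _ "(l - t, t)"]) (auto simp: S0_def)
  qed
  have "periodization S (\<lambda>y. \<Sum>t\<in>T. h (y + t)) x = (\<Sum>s\<in>S0. \<Sum>t\<in>T. h (x + s + t))"
    unfolding S0_def
  proof (rule S.periodization_eq_sum)
    show "norm y \<le> M'" if "(\<Sum>t\<in>T. h (y + t)) \<noteq> 0" for y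
      using that support' by (meson sum.neutral)
  qed simp
  also have "\<dots> = (\<Sum>l\<in>?add ` (S0 \<times> T). h (x + l))"
    by (subst sum.reindex[OF inj]) (simp add: sum.cartesian_product split_beta add.assoc)
  also have "\<dots> = (\<Sum>\<^sub>\<infinity>l\<in>?add ` (S0 \<times> T). h (x + l))"
    using fin by simp
  also have "\<dots> = periodization L h x"
    unfolding periodization_def
  proof (rule infsum_cong_neutral)
    show "h (x + l) = 0" if "l \<in> ?add ` (S0 \<times> T) - L" for l
      using that assms(2,4) add_mem by (auto simp: S0_def)
  qed (use contributing' in auto)
  finally show ?thesis
    by simp
qed

lemma integrable_bounded_support:
  fixes f :: "'a::real_normed_vector \<Rightarrow> real"
  assumes "sets \<mu> = sets borel" "\<And>R. emeasure \<mu> (cball 0 R) < \<infinity>"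
    and "f \<in> borel_measurable borel" "\<And>x. \<bar>f x\<bar> \<le> K" "\<And>x. f x \<noteq> 0 \<Longrightarrow> norm x \<le> M"
  shows "integrable \<mu> f"
proof (rule integrableI_bounded_set[where A = "cball 0 M" and B = K])
  show "f \<in> borel_measurable \<mu>"
    using assms(1,3) by (simp cong: measurable_cong_sets)
  show "AE x in \<mu>. x \<notin> cball 0 M \<longrightarrow> f x = 0"
    using assms(5) by (intro AE_I2) auto
qed (use assms in auto)

locale invariant_measure = discrete_subgroup L for L :: "'a::euclidean_space set" +
  fixes \<mu> :: "'a measure"
  assumes sets_\<mu>: "sets \<mu> = sets borel" and invariant: "l \<in> L \<Longrightarrow> distr \<mu> borel ((+) l) = \<mu>"
    and finite_cball: "emeasure \<mu> (cball 0 R) < \<infinity>"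
begin

lemma integral_translate:
  fixes f :: "'a \<Rightarrow> real"
  assumes "l \<in> L" "f \<in> borel_measurable borel"
  shows "(\<integral>x. f (l + x) \<partial>\<mu>) = (\<integral>x. f x \<partial>\<mu>)"
proof -
  have "(\<integral>x. f x \<partial>\<mu>) = (\<integral>x. f x \<partial>distr \<mu> borel ((+) l))"
    by (simp add: invariant[OF assms(1)])
  also have "\<dots> = (\<integral>x. f (l + x) \<partial>\<mu>)"
    using assms(2) sets_\<mu> by (subst integral_distr) (auto cong: measurable_cong_sets)
  finally show ?thesis
    by simp
qed

lemma integral_mult_periodization:
  fixes G w :: "'a \<Rightarrow> real"
  assumes G: "G \<in> borel_measurable borel" "\<And>x. \<bar>G x\<bar> \<le> K" "\<And>x. G x \<noteq> 0 \<Longrightarrow> norm x \<le> \<rho>"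
    and w: "w \<in> borel_measurable borel" "\<And>x. \<bar>w x\<bar> \<le> K'" "\<And>x. w x \<noteq> 0 \<Longrightarrow> norm x \<le> \<rho>"
  shows "(\<integral>x. periodization L G x * w x \<partial>\<mu>) = (\<integral>x. periodization L w x * G x \<partial>\<mu>)"
proof -
  note [measurable] = G(1) w(1)
  define L0 where "L0 = {l \<in> L. norm l \<le> 2 * \<rho>}"
  have L0: "l \<in> L" "- l \<in> L0" if "l \<in> L0" for l
    using that uminus_mem by (auto simp: L0_def)
  have bound: "\<bar>G x * w y\<bar> \<le> K * K'" "\<bar>w y * G x\<bar> \<le> K * K'" for x y
    using mult_mono[OF G(2)[of x] w(2)[of y]] order_trans[OF abs_ge_zero G(2)]
    by (simp_all add: abs_mult mult.commute)
  have int: "integrable \<mu> (\<lambda>x. G (x + l) * w x)" "integrable \<mu> (\<lambda>x. w (x + l) * G x)" for l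
    using bound G(3) w(3)
    by (auto intro!: integrable_bounded_support[OF sets_\<mu> finite_cball, of _ "K * K'" \<rho>])
  have "(\<integral>x. periodization L G x * w x \<partial>\<mu>) = (\<integral>x. (\<Sum>l\<in>L0. G (x + l) * w x) \<partial>\<mu>)"
    unfolding L0_def
    by (intro Bochner_Integration.integral_cong refl periodization_mult_eq_sum G(3) w(3))
  also have "\<dots> = (\<Sum>l\<in>L0. \<integral>x. G (x + l) * w x \<partial>\<mu>)"
    by (rule Bochner_Integration.integral_sum) (rule int)
  also have "\<dots> = (\<Sum>l\<in>L0. \<integral>x. w (x - l) * G x \<partial>\<mu>)"
  proof (intro sum.cong refl)
    fix l
    assume "l \<in> L0"
    then have "(\<integral>x. w ((l + x) - l) * G (l + x) \<partial>\<mu>) = (\<integral>x. w (x - l) * G x \<partial>\<mu>)"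
      by (intro integral_translate[of l "\<lambda>x. w (x - l) * G x"] L0) measurable
    then show "(\<integral>x. G (x + l) * w x \<partial>\<mu>) = (\<integral>x. w (x - l) * G x \<partial>\<mu>)"
      by (simp add: add.commute mult.commute)
  qed
  also have "\<dots> = (\<Sum>l\<in>L0. \<integral>x. w (x + l) * G x \<partial>\<mu>)"
    by (rule sum.reindex_bij_witness[of _ uminus uminus]) (use L0(2) in auto)
  also have "\<dots> = (\<integral>x. (\<Sum>l\<in>L0. w (x + l) * G x) \<partial>\<mu>)"
    by (rule Bochner_Integration.integral_sum[symmetric]) (rule int)
  also have "\<dots> = (\<integral>x. periodization L w x * G x \<partial>\<mu>)"
    unfolding L0_def
    by (intro Bochner_Integration.integral_cong refl periodization_mult_eq_sum[symmetric] G(3) w(3))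
  finally show ?thesis .
qed

lemma partition_of_unity:
  obtains w :: "'a \<Rightarrow> real" where "w \<in> borel_measurable borel" "\<And>x. w x \<in> {0..1}"
    "\<And>x. w x \<noteq> 0 \<longleftrightarrow> norm x \<le> \<rho>" "\<And>x. norm x \<le> \<rho> \<Longrightarrow> periodization L w x = 1"
proof
  define X where "X = cball (0::'a) \<rho>"
  define N where "N x = (\<Sum>l | l \<in> L \<and> norm l \<le> 2 * \<rho>. indicator X (x + l) :: real)" for x
  define w where "w x = indicator X x / N x" for x
  have [measurable]: "X \<in> sets borel"
    by (simp add: X_def)
  have N: "N x = periodization L (indicator X) x" if "norm x \<le> \<rho>" for x
    unfolding N_def using that
    by (intro periodization_eq_sum[of _ \<rho>, symmetric])
      (auto simp: X_def indicator_def split: if_splits)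
  have N_ge: "N x \<ge> 1" if "norm x \<le> \<rho>" for x
  proof -
    have "\<rho> \<ge> 0"
      using that norm_ge_zero order_trans by blast
    then have "(\<Sum>l\<in>{0}. indicator X (x + l)) \<le> N x"
      unfolding N_def using zero_mem finite_bounded by (intro sum_mono2) auto
    then show ?thesis
      using that by (simp add: X_def)
  qed
  show support: "w x \<noteq> 0 \<longleftrightarrow> norm x \<le> \<rho>" for x
    using N_ge[of x] by (auto simp: w_def X_def indicator_def split: if_splits)
  show "w x \<in> {0..1}" for x
    using N_ge[of x] by (auto simp: w_def X_def indicator_def split: if_splits)
  show "w \<in> borel_measurable borel"
    unfolding w_def N_def by measurable
  show "periodization L w x = 1" if x: "norm x \<le> \<rho>" for x
  proof -
    have "w (x + l) = indicator X (x + l) / N x" if "l \<in> L" for l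
      using N[OF x] N[of "x + l"] periodization_translate[OF that, of "indicator X" x]
      by (cases "x + l \<in> X") (auto simp: w_def X_def)
    then have "(\<Sum>l | l \<in> L \<and> norm l \<le> 2 * \<rho>. w (x + l)) =
        (\<Sum>l | l \<in> L \<and> norm l \<le> 2 * \<rho>. indicator X (x + l) / N x)"
      by simp
    also have "\<dots> = N x / N x"
      by (simp only: N_def sum_divide_distrib)
    finally show ?thesis
      using periodization_eq_sum[of w \<rho> x "2 * \<rho>"] support x N_ge[OF x] by simp
  qed
qed

lemma cball_emeasure_nonzero:
  assumes "emeasure \<mu> UNIV \<noteq> 0"
  obtains \<rho> where "\<rho> \<ge> M" "emeasure \<mu> (cball 0 \<rho>) \<noteq> 0"
proof -
  obtain k :: nat where k: "emeasure \<mu> (cball 0 (real k)) \<noteq> 0"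
  proof (rule ccontr)
    assume "\<not> thesis"
    then have "emeasure \<mu> (\<Union>k::nat. cball 0 (real k)) = 0"
      using that by (intro emeasure_UN_eq_0) (auto simp: sets_\<mu>)
    moreover have "(\<Union>k::nat. cball (0::'a) (real k)) = UNIV"
      using real_arch_simple by auto
    ultimately show False
      using assms by simp
  qed
  have "emeasure \<mu> (cball 0 (real k)) \<le> emeasure \<mu> (cball 0 (max M (real k)))"
    by (intro emeasure_mono) (auto simp: sets_\<mu>)
  then have "emeasure \<mu> (cball 0 (max M (real k))) \<noteq> 0"
    using k by (metis le_zero_eq)
  then show thesis
    using that[of "max M (real k)"] by simp
qed

lemma integral_pos_of_nonzero_on_cball:
  fixes w :: "'a \<Rightarrow> real"
  assumes "integrable \<mu> w" "\<And>x. w x \<ge> 0" "\<And>x. norm x \<le> \<rho> \<Longrightarrow> w x \<noteq> 0"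
    and "emeasure \<mu> (cball 0 \<rho>) \<noteq> 0"
  shows "(\<integral>x. w x \<partial>\<mu>) > 0"
proof -
  have "(\<integral>x. w x \<partial>\<mu>) \<noteq> 0"
  proof
    assume "(\<integral>x. w x \<partial>\<mu>) = 0"
    then have "AE x in \<mu>. w x = 0"
      using integral_nonneg_eq_0_iff_AE[OF assms(1)] assms(2) by simp
    then have "AE x in \<mu>. x \<notin> cball 0 \<rho>"
      by eventually_elim (use assms(3) in auto)
    then show False
      using assms(4) AE_iff_null_sets[of "cball 0 \<rho>" \<mu>] by (simp add: sets_\<mu> null_sets_def)
  qed
  moreover have "(\<integral>x. w x \<partial>\<mu>) \<ge> 0"
    using assms(2) by (intro integral_nonneg_AE AE_I2) simp
  ultimately show ?thesis
    by simp
qed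

lemma integral_eq_mult_periodization:
  fixes G :: "'a \<Rightarrow> real"
  assumes nonzero: "emeasure \<mu> UNIV \<noteq> 0"
    and G: "G \<in> borel_measurable borel" "\<And>x. \<bar>G x\<bar> \<le> K" "\<And>x. G x \<noteq> 0 \<Longrightarrow> norm x \<le> M"
    and const: "AE x in \<mu>. periodization L G x = c"
  obtains \<kappa> where "\<kappa> > 0" "(\<integral>x. G x \<partial>\<mu>) = c * \<kappa>"
proof -
  obtain \<rho> where \<rho>: "\<rho> \<ge> M" "emeasure \<mu> (cball 0 \<rho>) \<noteq> 0"
    using cball_emeasure_nonzero[OF nonzero] .
  obtain w :: "'a \<Rightarrow> real" where w: "w \<in> borel_measurable borel" "\<And>x. w x \<in> {0..1}"
    "\<And>x. w x \<noteq> 0 \<longleftrightarrow> norm x \<le> \<rho>" "\<And>x. norm x \<le> \<rho> \<Longrightarrow> periodization L w x = 1"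
    using partition_of_unity by blast
  have [measurable_cong]: "sets \<mu> = sets borel"
    by (rule sets_\<mu>)
  note [measurable] = G(1) w(1)
  have w_bound: "\<bar>w x\<bar> \<le> 1" for x
    using w(2)[of x] by simp
  have G_support: "norm x \<le> \<rho>" if "G x \<noteq> 0" for x
    using G(3)[OF that] \<rho>(1) by simp
  have "(\<integral>x. G x \<partial>\<mu>) = (\<integral>x. periodization L w x * G x \<partial>\<mu>)"
    using w(4) G_support
    by (intro Bochner_Integration.integral_cong refl) (metis mult_cancel_right1 mult_zero_right)
  also have "\<dots> = (\<integral>x. periodization L G x * w x \<partial>\<mu>)"
    using integral_mult_periodization[OF G(1,2) G_support w(1) w_bound] w(3) by simp
  also have "\<dots> = (\<integral>x. c * w x \<partial>\<mu>)"
  proof (rule integral_cong_AE)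
    have "(\<lambda>x. periodization L G x * w x) = (\<lambda>x. \<Sum>l | l \<in> L \<and> norm l \<le> 2 * \<rho>. G (x + l) * w x)"
      by (intro ext periodization_mult_eq_sum) (auto simp: w(3) dest: G_support)
    then show "(\<lambda>x. periodization L G x * w x) \<in> borel_measurable \<mu>"
      by simp
    show "AE x in \<mu>. periodization L G x * w x = c * w x"
      using const by eventually_elim simp
  qed measurable
  also have "\<dots> = c * (\<integral>x. w x \<partial>\<mu>)"
    by simp
  finally have "(\<integral>x. G x \<partial>\<mu>) = c * (\<integral>x. w x \<partial>\<mu>)" .
  moreover have "integrable \<mu> w"
    using integrable_bounded_support[OF sets_\<mu> finite_cball w(1) w_bound] w(3) by blast
  then have "(\<integral>x. w x \<partial>\<mu>) > 0"
    using w(2,3) \<rho>(2) by (intro integral_pos_of_nonzero_on_cball) auto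
  ultimately show thesis
    using that by blast
qed

end

lemma group_closure_integer_coordinates:
  assumes "independent B" "x \<in> group_closure B"
  shows "x \<in> span B \<and> (\<forall>b. representation B x b \<in> \<int>)"
  using assms(2)
proof induction
  case (base s)
  then show ?case
    using assms(1) by (auto simp: representation_zero representation_basis span_zero span_base)
next
  case (diff s t)
  then show ?case
    using assms(1) by (auto simp: representation_diff span_diff)
qed

lemma representation_bounded_by_norm:
  fixes B :: "'a::euclidean_space set"
  assumes "independent B" "span B = UNIV"
  obtains K where "\<And>b x. \<bar>representation B x b\<bar> \<le> norm x * K b" "\<And>b. K b > 0"
proof -
  have "linear (\<lambda>x. representation B x b)" for b
    using assms representation_add[OF assms(1)] representation_scale[OF assms(1)]
    by (intro linearI) simp_all
  then have "\<exists>K>0. \<forall>x. \<bar>representation B x b\<bar> \<le> norm x * K" for b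
    using bounded_linear.pos_bounded[of "\<lambda>x. representation B x b"]
    by (simp add: linear_conv_bounded_linear)
  then show thesis
    using that by metis
qed

lemma lattice_discrete_subgroup:
  fixes L :: "'a::euclidean_space set"
  assumes "is_lattice L"
  shows "discrete_subgroup L"
proof
  obtain B where B: "independent B" "card B = DIM('a)" "L = group_closure B"
    using assms unfolding is_lattice_def by blast
  show "0 \<in> L" "\<And>x y. x \<in> L \<Longrightarrow> y \<in> L \<Longrightarrow> x - y \<in> L"
    unfolding B(3) by (auto intro: group_closure.diff)
  have finB: "finite B"
    using B(1) by (rule independent_imp_finite)
  have spanB: "span B = UNIV"
    using card_ge_dim_independent[of B UNIV] B(1,2) by auto
  obtain K where K: "\<And>b x. \<bar>representation B x b\<bar> \<le> norm x * K b" "\<And>b. K b > 0"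
    using representation_bounded_by_norm[OF B(1) spanB] by blast
  fix R
  let ?box = "\<Pi>\<^sub>E b\<in>B. {k \<in> \<int>. \<bar>k\<bar> \<le> R * K b}"
  have "{l \<in> L. norm l \<le> R} \<subseteq> (\<lambda>z. \<Sum>b\<in>B. z b *\<^sub>R b) ` ?box"
  proof
    fix l
    assume l: "l \<in> {l \<in> L. norm l \<le> R}"
    then have "representation B l b \<in> \<int>" for b
      using group_closure_integer_coordinates[OF B(1)] B(3) by blast
    moreover have "\<bar>representation B l b\<bar> \<le> R * K b" for b
      using l K(2)[of b] by (intro order_trans[OF K(1)] mult_right_mono) auto
    ultimately have "(\<lambda>b\<in>B. representation B l b) \<in> ?box"
      by auto
    moreover have "l = (\<Sum>b\<in>B. (\<lambda>b\<in>B. representation B l b) b *\<^sub>R b)"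
      using sum_representation_eq[OF B(1) _ finB order_refl, of l] by (simp add: spanB)
    ultimately show "l \<in> (\<lambda>z. \<Sum>b\<in>B. z b *\<^sub>R b) ` ?box"
      by blast
  qed
  moreover have "finite ((\<lambda>z. \<Sum>b\<in>B. z b *\<^sub>R b) ` ?box)"
    by (intro finite_imageI finite_PiE finB finite_abs_int_segment)
  ultimately show "finite {l \<in> L. norm l \<le> R}"
    by (rule finite_subset)
qed

section \<open>Hadwiger functionals and tilings\<close>

lemma perp_space_translate_eq_iff:
  "(+) l ` perp_space p C = (+) l' ` perp_space p C \<longleftrightarrow> (\<forall>c\<in>C. c \<bullet> (l - l') = 0)"
proof
  assume "(+) l ` perp_space p C = (+) l' ` perp_space p C"
  then have "perp_space (p + l) C = perp_space (p + l') C"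
    by (simp add: perp_space_translate)
  moreover have "p + l \<in> perp_space (p + l) C"
    by (simp add: perp_space_def)
  ultimately have "p + l \<in> perp_space (p + l') C"
    by simp
  then show "\<forall>c\<in>C. c \<bullet> (l - l') = 0"
    by (simp add: perp_space_def)
next
  assume "\<forall>c\<in>C. c \<bullet> (l - l') = 0"
  then have "perp_space (p + l) C = perp_space (p + l') C"
    by (auto simp: perp_space_def inner_diff_right inner_add_right)
  then show "(+) l ` perp_space p C = (+) l' ` perp_space p C"
    by (simp add: perp_space_translate)
qed

definition perp_subgroup :: "'a::euclidean_space set \<Rightarrow> 'a set \<Rightarrow> 'a set" where
  "perp_subgroup L C = {l \<in> L. \<forall>c\<in>C. c \<bullet> l = 0}"

lemma perp_subgroup_subset: "perp_subgroup L C \<subseteq> L"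
  by (auto simp: perp_subgroup_def)

lemma invariant_measure_perp_subgroup:
  assumes "discrete_subgroup L" and C: "orthonormal C"
  shows "invariant_measure (perp_subgroup L C) (perp_measure p C)"
proof -
  interpret discrete_subgroup L
    by (rule assms(1))
  show ?thesis
  proof unfold_locales
    show "0 \<in> perp_subgroup L C"
      using zero_mem by (simp add: perp_subgroup_def)
    show "x - y \<in> perp_subgroup L C" if "x \<in> perp_subgroup L C" "y \<in> perp_subgroup L C" for x y
      using that diff_mem by (simp add: perp_subgroup_def inner_diff_right)
    show "finite {x \<in> perp_subgroup L C. norm x \<le> R}" for R
      by (rule finite_subset[OF _ finite_bounded[of R]]) (use perp_subgroup_subset in auto)
    show "distr (perp_measure p C) borel ((+) l) = perp_measure p C"
      if "l \<in> perp_subgroup L C" for l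
      using that by (intro perp_measure_translate_along) (simp add: perp_subgroup_def)
    show "emeasure (perp_measure p C) (cball 0 R) < \<infinity>" for R
      by (rule emeasure_perp_measure_cball_finite[OF C])
  qed simp
qed

lemma AE_eq_const_imp_eventually_generic:
  assumes "locally_adapted u" "AE x in lebesgue. u x = c"
  shows "\<forall>\<^sub>F x in generic UNIV. u x = c"
proof (rule eventually_generic_boundedI)
  fix R
  obtain \<Sigma> where \<Sigma>: "finite \<Sigma>" "adapted_on \<Sigma> (ball 0 R) u"
    using locally_adaptedE[OF assms(1)] .
  show "\<forall>\<^sub>F x in generic UNIV. norm x < R \<longrightarrow> u x = c"
    using eventually_generic_regular[OF \<Sigma>(1)]
  proof eventually_elim
    case (elim x)
    show ?case
    proof
      assume "norm x < R"
      then have "\<forall>\<^sub>F z in nhds x. u z = u x"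
        using locally_const_at_regular_point[OF \<Sigma> open_ball, of x UNIV] elim by simp
      then obtain e where e: "e > 0" "\<And>z. z \<in> ball x e \<Longrightarrow> u z = u x"
        unfolding eventually_nhds_metric by (auto simp: dist_commute)
      have "\<not> negligible (ball x e)"
        using e(1) by (intro open_not_negligible) auto
      then have "\<not> (AE z in lebesgue. z \<notin> ball x e)"
        by (simp add: AE_iff_null_sets negligible_iff_null_sets)
      then obtain z where "z \<in> ball x e" "u z = c"
        using AE_mp[OF assms(2), of "\<lambda>z. z \<notin> ball x e"] AE_I2[of lebesgue] by blast
      then show "u x = c"
        using e(2) by simp
    qed
  qed
qed

lemma perp_measure_empty: "perp_measure p {} = lborel"
  by (rule measure_eqI) (simp_all add: emeasure_perp_measure unit_slab_def perp_proj_def)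

lemma eventually_generic_UNIV_imp_AE_lebesgue:
  fixes P :: "'a::euclidean_space \<Rightarrow> bool"
  assumes "\<forall>\<^sub>F x in generic UNIV. P x"
  shows "AE x in lebesgue. P x"
proof -
  have "perp_space 0 {} = (UNIV :: 'a set)"
    by (simp add: perp_space_def)
  then have "AE x in perp_measure 0 {}. P x"
    using assms by (intro eventually_generic_imp_AE_perp_measure) (simp_all add: orthonormal_def)
  then show ?thesis
    unfolding perp_measure_empty by (rule AE_completion)
qed

locale periodized_body = polyhedral_body A \<Sigma> + discrete_subgroup L
  for A L :: "'a::euclidean_space set" and \<Sigma> +
  fixes M :: real
  assumes A_bounded: "A \<subseteq> cball 0 M"
begin

abbreviation count :: "'a \<Rightarrow> real" where
  "count \<equiv> periodization L (indicator A)"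

lemma indicator_A_support: "indicator A y \<noteq> (0::real) \<Longrightarrow> norm y \<le> M"
  using A_bounded by (auto simp: indicator_def split: if_splits)

lemma adapted_on_iter_jump_A: "adapted_on \<Sigma> UNIV (iter_jump n r (indicator A :: 'a \<Rightarrow> real))"
  by (intro adapted_on_iter_jump finite_\<Sigma> open_UNIV adapted_on_indicator adapted_A)

lemma locally_adapted_indicator_A: "locally_adapted (indicator A :: 'a \<Rightarrow> real)"
  by (intro adapted_on_imp_locally_adapted[OF finite_\<Sigma>] adapted_on_indicator adapted_A)

lemma iter_jump_A_measurable: "iter_jump n r (indicator A :: 'a \<Rightarrow> real) \<in> borel_measurable borel"
  by (rule adapted_on_borel_measurable[OF finite_\<Sigma> adapted_on_iter_jump_A])

lemma iter_jump_A_support: "iter_jump n r (indicator A :: 'a \<Rightarrow> real) x \<noteq> 0 \<Longrightarrow> norm x \<le> M"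
  by (rule iter_jump_support[OF indicator_A_support])

lemma iter_jump_A_bounded:
  obtains K where "\<And>x. \<bar>iter_jump n r (indicator A :: 'a \<Rightarrow> real) x\<bar> \<le> K"
proof -
  have "bounded (range (iter_jump n r (indicator A :: 'a \<Rightarrow> real)))"
    by (intro finite_imp_bounded adapted_on_finite_range[OF finite_\<Sigma> adapted_on_iter_jump_A])
  then show thesis
    using that unfolding bounded_iff by auto
qed

lemma iter_jump_count: "iter_jump n r count = periodization L (iter_jump n r (indicator A))"
  by (rule iter_jump_periodization[OF discrete_subgroup_axioms indicator_A_support
        locally_adapted_indicator_A])

lemma flag_weight_eq_integral:
  assumes flag: "is_flag r \<Phi>" "flag_directions r \<Phi> n" "r \<le> DIM('a)"
    and C: "orthonormal C" and V: "fst \<Phi> r = perp_space p C"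
  shows "flag_weight r \<Phi> A = (\<integral>x. iter_jump n r (indicator A) x \<partial>perp_measure p C)"
proof -
  let ?\<F> = "face_chains r \<Phi> A" and ?\<mu> = "perp_measure p C"
  have face: "F r \<in> sets borel" "F r \<subseteq> A" "affine hull F r = perp_space p C" if "F \<in> ?\<F>" for F
    using face_chain_member[OF flag(1) that order_refl order_refl flag(3)] V
    by (auto simp: borel_closed)
  have int: "integrable ?\<mu> (indicator (F r) :: 'a \<Rightarrow> real)" if "F \<in> ?\<F>" for F
    using face(1,2)[OF that] A_bounded
    by (intro integrable_bounded_support[OF sets_perp_measure
          emeasure_perp_measure_cball_finite[OF C], of _ 1 M])
      (auto simp: indicator_def split: if_splits)
  have "flag_weight r \<Phi> A = (\<Sum>F\<in>?\<F>. chain_coeff \<Phi> r F * (\<integral>x. indicator (F r) x \<partial>?\<mu>))"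
    unfolding flag_weight_def chain_coeff_def
    using face rel_volume_eq_perp_measure[OF C] by (intro sum.cong) auto
  also have "\<dots> = (\<integral>x. signed_faces r \<Phi> A x \<partial>?\<mu>)"
    unfolding signed_faces_def using int by simp
  also have "\<dots> = (\<integral>x. iter_jump n r (indicator A) x \<partial>?\<mu>)"
  proof (rule integral_cong_AE)
    have "AE x in ?\<mu>. iter_jump n r (indicator A) x = signed_faces r \<Phi> A x"
      using iter_jump_eq_signed_faces[OF flag] V
      by (intro eventually_generic_imp_AE_perp_measure[OF C]) simp
    then show "AE x in ?\<mu>. signed_faces r \<Phi> A x = iter_jump n r (indicator A) x"
      by eventually_elim simp
    show "signed_faces r \<Phi> A \<in> borel_measurable ?\<mu>"
      unfolding signed_faces_def using face(1) by simp
    show "(iter_jump n r (indicator A) :: 'a \<Rightarrow> real) \<in> borel_measurable ?\<mu>"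
      using iter_jump_A_measurable by (simp cong: measurable_cong_sets)
  qed
  finally show ?thesis .
qed

lemma finite_translates_with_chains:
  assumes flag: "is_flag r \<Phi>" "r \<le> DIM('a)"
  shows "finite {\<Psi> \<in> range (\<lambda>l. translate_flag l \<Phi>). face_chains r \<Psi> A \<noteq> {}}" (is "finite ?X")
proof (rule finite_imageD)
  show "finite ((\<lambda>\<Psi>. fst \<Psi> r) ` ?X)"
  proof (rule finite_subset)
    show "(\<lambda>\<Psi>. fst \<Psi> r) ` ?X \<subseteq> (\<lambda>S. affine hull S) ` {S. adapted \<Sigma> S}"
    proof (rule image_subsetI)
      fix \<Psi>
      assume "\<Psi> \<in> ?X"
      then obtain F where "is_flag r \<Psi>" and F: "F \<in> face_chains r \<Psi> A"
        using is_flag_translate[OF flag(1)] by auto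
      from face_chain_member[OF this order_refl order_refl flag(2)]
      show "fst \<Psi> r \<in> (\<lambda>S. affine hull S) ` {S. adapted \<Sigma> S}"
        by (intro image_eqI[of _ _ "F r"]) auto
    qed
  qed (simp add: finite_adapted_sets finite_\<Sigma>)
  show "inj_on (\<lambda>\<Psi>. fst \<Psi> r) ?X"
  proof (rule inj_onI)
    fix \<Psi> \<Psi>'
    assume "\<Psi> \<in> ?X" "\<Psi>' \<in> ?X" and eq: "fst \<Psi> r = fst \<Psi>' r"
    then obtain l l' where "\<Psi> = translate_flag l \<Phi>" "\<Psi>' = translate_flag l' \<Phi>"
      by blast
    then show "\<Psi> = \<Psi>'"
      using eq translate_flag_eq_iff[OF flag] by (simp add: fst_translate_flag)
  qed
qed

lemma hadwiger_eq_sum: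
  assumes flag: "is_flag r \<Phi>" "r \<le> DIM('a)"
  obtains T where "finite T" "T \<subseteq> L" "inj_on (\<lambda>l. translate_flag l \<Phi>) T"
    "\<forall>l\<in>L. face_chains r (translate_flag l \<Phi>) A \<noteq> {} \<longrightarrow>
      translate_flag l \<Phi> \<in> (\<lambda>l. translate_flag l \<Phi>) ` T"
    "hadwiger r \<Phi> A L = (\<Sum>t\<in>T. flag_weight r (translate_flag t \<Phi>) A)"
proof -
  define X where "X = {\<Psi> \<in> (\<lambda>l. translate_flag l \<Phi>) ` L. face_chains r \<Psi> A \<noteq> {}}"
  have "X \<subseteq> (\<lambda>l. translate_flag l \<Phi>) ` L"
    by (auto simp: X_def)
  then obtain T where T: "T \<subseteq> L" "inj_on (\<lambda>l. translate_flag l \<Phi>) T"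
    "X = (\<lambda>l. translate_flag l \<Phi>) ` T"
    unfolding subset_image_inj by blast
  have "finite X"
    by (rule finite_subset[OF _ finite_translates_with_chains[OF flag]]) (auto simp: X_def)
  then have "finite T"
    using T(2,3) finite_imageD by blast
  have "hadwiger r \<Phi> A L = (\<Sum>\<^sub>\<infinity>\<Psi>\<in>X. flag_weight r \<Psi> A)"
    unfolding hadwiger_def by (rule infsum_cong_neutral) (auto simp: X_def flag_weight_def)
  also have "\<dots> = (\<Sum>t\<in>T. flag_weight r (translate_flag t \<Phi>) A)"
    using \<open>finite X\<close> by (simp add: T(3) sum.reindex[OF T(2)])
  finally have "hadwiger r \<Phi> A L = (\<Sum>t\<in>T. flag_weight r (translate_flag t \<Phi>) A)" .
  moreover have "\<forall>l\<in>L. face_chains r (translate_flag l \<Phi>) A \<noteq> {} \<longrightarrow>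
      translate_flag l \<Phi> \<in> (\<lambda>l. translate_flag l \<Phi>) ` T"
    unfolding T(3)[symmetric] by (simp add: X_def)
  ultimately show thesis
    using that \<open>finite T\<close> T(1,2) by blast
qed

lemma flag_weight_translate_eq_integral:
  assumes flag: "is_flag r \<Phi>" "flag_directions r \<Phi> n" "r \<le> DIM('a)"
    and C: "orthonormal C" and V: "fst \<Phi> r = perp_space p C"
  shows "flag_weight r (translate_flag t \<Phi>) A =
    (\<integral>x. iter_jump n r (indicator A) (x + t) \<partial>perp_measure p C)"
proof -
  have "fst (translate_flag t \<Phi>) r = perp_space (p + t) C"
    by (simp add: fst_translate_flag V perp_space_translate)
  then have "flag_weight r (translate_flag t \<Phi>) A =
      (\<integral>x. iter_jump n r (indicator A) x \<partial>perp_measure (p + t) C)"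
    by (intro flag_weight_eq_integral is_flag_translate flag_directions_translate flag C)
  also have "\<dots> = (\<integral>x. iter_jump n r (indicator A) x \<partial>distr (perp_measure p C) borel ((+) t))"
    by (simp add: distr_perp_measure_translate)
  also have "\<dots> = (\<integral>x. iter_jump n r (indicator A) (t + x) \<partial>perp_measure p C)"
    by (rule integral_distr) (simp_all add: iter_jump_A_measurable)
  finally show ?thesis
    by (simp add: add.commute)
qed

lemma AE_contributing_coset:
  assumes flag: "is_flag r \<Phi>" "flag_directions r \<Phi> n" "r \<le> DIM('a)"
    and C: "orthonormal C" and V: "fst \<Phi> r = perp_space p C"
  shows "AE x in perp_measure p C. \<forall>l\<in>L. iter_jump n r (indicator A) (x + l) \<noteq> (0::real) \<longrightarrow>
    face_chains r (translate_flag l \<Phi>) A \<noteq> {}"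
proof (rule AE_ball_countable'[OF _ countable_subgroup])
  fix l
  have "\<forall>\<^sub>F x in generic (fst (translate_flag l \<Phi>) r).
      iter_jump n r (indicator A) x = signed_faces r (translate_flag l \<Phi>) A x"
    by (intro iter_jump_eq_signed_faces is_flag_translate flag_directions_translate flag)
  then have "\<forall>\<^sub>F x in generic (perp_space p C).
      iter_jump n r (indicator A) (x + l) = signed_faces r (translate_flag l \<Phi>) A (x + l)"
    unfolding fst_translate_flag V by (rule eventually_generic_translate)
  from eventually_generic_imp_AE_perp_measure[OF C this]
  show "AE x in perp_measure p C. iter_jump n r (indicator A) (x + l) \<noteq> (0::real) \<longrightarrow>
      face_chains r (translate_flag l \<Phi>) A \<noteq> {}"
    by eventually_elim (auto simp: signed_faces_def)
qed

lemma translate_flag_eq_iff_diff_mem: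
  assumes flag: "is_flag r \<Phi>" "r \<le> DIM('a)" and V: "fst \<Phi> r = perp_space p C"
    and "l \<in> L" "l' \<in> L"
  shows "translate_flag l \<Phi> = translate_flag l' \<Phi> \<longleftrightarrow> l - l' \<in> perp_subgroup L C"
  using diff_mem[OF assms(4,5)]
  by (simp add: translate_flag_eq_iff[OF flag] V perp_space_translate_eq_iff perp_subgroup_def)

lemma AE_iter_jump_count_eq_periodization:
  assumes flag: "is_flag r \<Phi>" "flag_directions r \<Phi> n" "r \<le> DIM('a)"
    and C: "orthonormal C" and V: "fst \<Phi> r = perp_space p C"
    and T: "finite T" "T \<subseteq> L" "inj_on (\<lambda>l. translate_flag l \<Phi>) T"
    and chains: "\<forall>l\<in>L. face_chains r (translate_flag l \<Phi>) A \<noteq> {} \<longrightarrow>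
      translate_flag l \<Phi> \<in> (\<lambda>l. translate_flag l \<Phi>) ` T"
  shows "AE x in perp_measure p C. iter_jump n r count x =
    periodization (perp_subgroup L C) (\<lambda>y. \<Sum>t\<in>T. iter_jump n r (indicator A) (y + t)) x"
  using AE_contributing_coset[OF flag C V]
proof eventually_elim
  case (elim x)
  interpret S: invariant_measure "perp_subgroup L C" "perp_measure p C"
    by (rule invariant_measure_perp_subgroup[OF discrete_subgroup_axioms C])
  note coset = translate_flag_eq_iff_diff_mem[OF flag(1,3) V]
  show ?case
    unfolding iter_jump_count
  proof (rule periodization_cosets[OF S.discrete_subgroup_axioms perp_subgroup_subset T(1,2)])
    show "t = t'" if "t \<in> T" "t' \<in> T" "t - t' \<in> perp_subgroup L C" for t t'
      using that coset[of t t'] T(2,3) by (auto dest: inj_onD)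
    show "norm y \<le> M" if "iter_jump n r (indicator A :: 'a \<Rightarrow> real) y \<noteq> 0" for y
      using that by (rule iter_jump_A_support)
    fix l
    assume l: "l \<in> L" "iter_jump n r (indicator A :: 'a \<Rightarrow> real) (x + l) \<noteq> 0"
    then obtain t where "t \<in> T" "translate_flag l \<Phi> = translate_flag t \<Phi>"
      using chains elim l by blast
    then show "\<exists>t\<in>T. l - t \<in> perp_subgroup L C"
      using coset[OF l(1)] T(2) by blast
  qed
qed

lemma sum_flag_weight_eq_integral:
  assumes flag: "is_flag r \<Phi>" "flag_directions r \<Phi> n" "r \<le> DIM('a)"
    and C: "orthonormal C" and V: "fst \<Phi> r = perp_space p C" and T: "finite T"
  shows "(\<Sum>t\<in>T. flag_weight r (translate_flag t \<Phi>) A) =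
    (\<integral>x. (\<Sum>t\<in>T. iter_jump n r (indicator A) (x + t)) \<partial>perp_measure p C)"
proof -
  obtain K where K: "\<And>x. \<bar>iter_jump n r (indicator A :: 'a \<Rightarrow> real) x\<bar> \<le> K"
    using iter_jump_A_bounded by blast
  have "integrable (perp_measure p C) (\<lambda>x. iter_jump n r (indicator A) (x + t) :: real)"
    if "t \<in> T" for t
  proof (rule integrable_bounded_support[OF sets_perp_measure
        emeasure_perp_measure_cball_finite[OF C] _ K])
    show "(\<lambda>x. iter_jump n r (indicator A) (x + t) :: real) \<in> borel_measurable borel"
      using iter_jump_A_measurable by simp
    show "norm x \<le> M + (\<Sum>t\<in>T. norm t)"
      if "iter_jump n r (indicator A :: 'a \<Rightarrow> real) (x + t) \<noteq> 0" for x
      using iter_jump_A_support that by (rule finite_translates_support[OF T \<open>t \<in> T\<close>])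
  qed
  then show ?thesis
    by (simp add: flag_weight_translate_eq_integral[OF flag C V])
qed

lemma hadwiger_eq_mult_const:
  assumes flag: "is_flag r \<Phi>" "flag_directions r \<Phi> n" "r \<le> DIM('a)"
    and const: "\<forall>\<^sub>F x in generic (fst \<Phi> r). iter_jump n r count x = c"
  obtains \<kappa> where "\<kappa> > 0" "hadwiger r \<Phi> A L = c * \<kappa>"
proof -
  obtain p where "p \<in> fst \<Phi> r"
    using flag_nonempty[OF flag(1) order_refl flag(3)] by blast
  then obtain C where C: "orthonormal C" and V: "fst \<Phi> r = perp_space p C"
    using affine_eq_perp_space flag_affine[OF flag(1) order_refl flag(3)] by blast
  interpret S: invariant_measure "perp_subgroup L C" "perp_measure p C"
    by (rule invariant_measure_perp_subgroup[OF discrete_subgroup_axioms C])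
  obtain T where T: "finite T" "T \<subseteq> L" "inj_on (\<lambda>l. translate_flag l \<Phi>) T"
    "\<forall>l\<in>L. face_chains r (translate_flag l \<Phi>) A \<noteq> {} \<longrightarrow>
      translate_flag l \<Phi> \<in> (\<lambda>l. translate_flag l \<Phi>) ` T"
    and hadwiger: "hadwiger r \<Phi> A L = (\<Sum>t\<in>T. flag_weight r (translate_flag t \<Phi>) A)"
    using hadwiger_eq_sum[OF flag(1,3)] .
  define G where "G = (\<lambda>x. \<Sum>t\<in>T. iter_jump n r (indicator A) (x + t) :: real)"
  obtain K where K: "\<And>x. \<bar>iter_jump n r (indicator A :: 'a \<Rightarrow> real) x\<bar> \<le> K"
    using iter_jump_A_bounded by blast
  have "AE x in perp_measure p C. periodization (perp_subgroup L C) G x = c"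
    using AE_iter_jump_count_eq_periodization[OF flag C V T]
      eventually_generic_imp_AE_perp_measure[OF C const[unfolded V]]
    unfolding G_def by eventually_elim simp
  moreover have "\<bar>G x\<bar> \<le> real (card T) * K" for x
    unfolding G_def by (rule order_trans[OF sum_abs sum_bounded_above]) (rule K)
  moreover have "norm x \<le> M + (\<Sum>t\<in>T. norm t)" if nonzero: "G x \<noteq> 0" for x
  proof -
    obtain t where t: "t \<in> T" "iter_jump n r (indicator A :: 'a \<Rightarrow> real) (x + t) \<noteq> 0"
      using nonzero unfolding G_def by (meson sum.neutral)
    show ?thesis
      using iter_jump_A_support t(2) by (rule finite_translates_support[OF T(1) t(1)])
  qed
  moreover have "G \<in> borel_measurable borel"
    unfolding G_def using iter_jump_A_measurable by simp
  ultimately obtain \<kappa> where "\<kappa> > 0" "(\<integral>x. G x \<partial>perp_measure p C) = c * \<kappa>"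
    using S.integral_eq_mult_periodization emeasure_perp_measure_UNIV_nonzero[OF C] by metis
  then show thesis
    using that by (simp add: hadwiger sum_flag_weight_eq_integral[OF flag C V T(1)] G_def)
qed

lemma tiles_at_level_iff: "tiles_at_level A L k \<longleftrightarrow> (AE x in lebesgue. count x = real k)"
proof -
  have "((\<lambda>l. indicator A (x - l) :: real) has_sum real k) L \<longleftrightarrow> count x = real k" for x
  proof -
    have "bij_betw uminus L L"
      by (rule bij_betwI[of _ _ _ uminus]) (use uminus_mem in auto)
    from has_sum_reindex_bij_betw[OF this, of "\<lambda>l. indicator A (x - l)" "real k"]
    have "((\<lambda>l. indicator A (x - l)) has_sum real k) L \<longleftrightarrow>
        ((\<lambda>l. indicator A (x + l)) has_sum real k) L"
      by simp
    also have "\<dots> \<longleftrightarrow> count x = real k"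
      using summable_on_translates[of "indicator A :: 'a \<Rightarrow> real" M x, OF indicator_A_support]
      by (simp add: has_sum_iff periodization_def)
    finally show ?thesis .
  qed
  then show ?thesis
    by (simp add: tiles_at_level_def)
qed

lemma count_natural:
  obtains k :: nat where "count x = real k" "x \<in> A \<Longrightarrow> k > 0"
proof
  define I where "I = {l \<in> L. norm l \<le> norm x + M}"
  have "finite I"
    unfolding I_def by (rule finite_bounded)
  have "count x = (\<Sum>l\<in>I. indicator A (x + l))"
    unfolding I_def by (rule periodization_eq_sum[OF indicator_A_support]) auto
  also have "\<dots> = real (card {l \<in> I. x + l \<in> A})"
    using \<open>finite I\<close> by (simp add: indicator_def sum.If_cases Int_def of_bool_def)
  finally show "count x = real (card {l \<in> I. x + l \<in> A})" .
  assume "x \<in> A"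
  then have "norm x + M \<ge> 0"
    using A_bounded order_trans[OF norm_ge_zero, of x M] by auto
  then have "0 \<in> {l \<in> I. x + l \<in> A}"
    using zero_mem \<open>x \<in> A\<close> by (simp add: I_def)
  then show "card {l \<in> I. x + l \<in> A} > 0"
    using \<open>finite I\<close> by (auto simp: card_gt_0_iff)
qed

lemma locally_adapted_count: "locally_adapted count"
  by (rule locally_adapted_periodization[OF discrete_subgroup_axioms indicator_A_support
        locally_adapted_indicator_A])

theorem tiling_imp_hadwiger_zero:
  assumes "tiles_at_level A L k" and flag: "is_flag r \<Phi>" and r: "r < DIM('a)"
  shows "hadwiger r \<Phi> A L = 0"
proof -
  obtain n where n: "flag_directions r \<Phi> n"
    using flag_directions_exist[OF flag] .
  have "\<forall>\<^sub>F x in generic UNIV. count x = real k"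
    using assms(1) by (intro AE_eq_const_imp_eventually_generic locally_adapted_count)
      (simp add: tiles_at_level_iff)
  from eventually_iter_jump_cong[OF flag n less_imp_le[OF r] this]
  have "\<forall>\<^sub>F x in generic (fst \<Phi> r). iter_jump n r count x = 0"
    by (simp add: iter_jump_const[OF r])
  then show ?thesis
    using hadwiger_eq_mult_const[OF flag n less_imp_le[OF r]] by (metis mult_zero_left)
qed

lemma hadwiger_zero_imp_jump_zero:
  fixes \<Phi> :: "'a flag"
  assumes zero: "\<And>\<Psi>. is_flag r \<Psi> \<Longrightarrow> hadwiger r \<Psi> A L = 0"
    and const: "\<And>\<Psi> n. is_flag r \<Psi> \<Longrightarrow> flag_directions r \<Psi> n \<Longrightarrow>
      \<exists>c. \<forall>\<^sub>F x in generic (fst \<Psi> r). iter_jump n r count x = c"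
    and flag: "is_flag (Suc r) \<Phi>" "flag_directions (Suc r) \<Phi> n" and r: "r < DIM('a)"
    and crossing: "crossing (fst \<Phi> (Suc r)) h m"
  shows "\<forall>\<^sub>F x in generic (wall (fst \<Phi> (Suc r)) h). jump m (iter_jump n (Suc r) count) x = 0"
proof -
  define V H where "V = wall (fst \<Phi> (Suc r)) h" and "H = upper_half (fst \<Phi> (Suc r)) h"
  define \<Psi> where "\<Psi> = extend_flag r V H \<Phi>"
  have "half_space_of (fst \<Phi> (Suc r)) V H" "crosses (fst \<Phi> (Suc r)) V H m"
    unfolding V_def H_def crosses_def using crossing
    by (auto intro!: euclidean_crossing.half_space_of_wall[of _ _ m] simp: euclidean_crossing_def)
  then have \<Psi>: "is_flag r \<Psi>" "flag_directions r \<Psi> (n(r := m))"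
    unfolding \<Psi>_def using flag r by (auto intro: is_flag_extend flag_directions_extend)
  then obtain c where c: "\<forall>\<^sub>F x in generic (fst \<Psi> r). iter_jump (n(r := m)) r count x = c"
    using const by blast
  obtain \<kappa> where "\<kappa> > 0" "hadwiger r \<Psi> A L = c * \<kappa>"
    using hadwiger_eq_mult_const[OF \<Psi> less_imp_le[OF r] c] .
  then have "c = 0"
    using zero[OF \<Psi>(1)] by simp
  have "iter_jump (n(r := m)) (Suc r) count = iter_jump n (Suc r) count"
    by (rule iter_jump_cong_directions) simp
  then have "iter_jump (n(r := m)) r count = jump m (iter_jump n (Suc r) count)"
    by (simp add: iter_jump_Suc[OF r])
  then show ?thesis
    using c \<open>c = 0\<close> by (simp add: \<Psi>_def V_def extend_flag_def)
qed

lemma hadwiger_zero_imp_generically_const: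
  assumes zero: "\<And>r \<Phi>. r < DIM('a) \<Longrightarrow> is_flag r \<Phi> \<Longrightarrow> hadwiger r \<Phi> A L = 0"
    and "is_flag r \<Phi>" "flag_directions r \<Phi> n" "r \<le> DIM('a)"
  shows "\<exists>c. \<forall>\<^sub>F x in generic (fst \<Phi> r). iter_jump n r count x = c"
  using assms(2-4)
proof (induction r arbitrary: \<Phi> n)
  case 0
  have "aff_dim (fst \<Phi> 0) = 0"
    using flag_aff_dim[OF 0(1), of 0] by simp
  then obtain a where "fst \<Phi> 0 = {a}"
    using aff_dim_eq_0 by blast
  then have "\<forall>\<^sub>F x in generic (fst \<Phi> 0). iter_jump n 0 count x = iter_jump n 0 count a"
    using eventually_generic_mem[of "{a}"] by (auto elim: eventually_mono)
  then show ?case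
    by blast
next
  case (Suc r)
  have r: "r < DIM('a)" "r \<le> DIM('a)"
    using Suc.prems(3) by auto
  show ?case
  proof (rule jumpless_imp_generically_const)
    show "affine (fst \<Phi> (Suc r))" "fst \<Phi> (Suc r) \<noteq> {}"
      using flag_affine[OF Suc.prems(1)] flag_nonempty[OF Suc.prems(1)] Suc.prems(3) by auto
    show "locally_adapted (iter_jump n (Suc r) count)"
      by (rule locally_adapted_iter_jump[OF locally_adapted_count])
    show "\<forall>\<^sub>F x in generic (wall (fst \<Phi> (Suc r)) h). jump m (iter_jump n (Suc r) count) x = 0"
      if "crossing (fst \<Phi> (Suc r)) h m" for h m
      using zero[OF r(1)] Suc.IH[OF _ _ r(2)] Suc.prems(1,2) r(1) that
      by (rule hadwiger_zero_imp_jump_zero)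
  qed
qed

theorem hadwiger_zero_imp_tiling:
  assumes zero: "\<And>r \<Phi>. r < DIM('a) \<Longrightarrow> is_flag r \<Phi> \<Longrightarrow> hadwiger r \<Phi> A L = 0"
    and interior: "interior A \<noteq> {}"
  shows "\<exists>k>0. tiles_at_level A L k"
proof -
  define \<Phi> :: "'a flag" where "\<Phi> = (\<lambda>j. if j = DIM('a) then UNIV else {}, \<lambda>_. {})"
  have "is_flag DIM('a) \<Phi>"
    by (auto simp: is_flag_def \<Phi>_def)
  moreover have "flag_directions DIM('a) \<Phi> (\<lambda>_. 0)"
    by (simp add: flag_directions_def)
  ultimately obtain c where c: "\<forall>\<^sub>F x in generic UNIV. count x = c"
    using hadwiger_zero_imp_generically_const[OF zero, of "DIM('a)" \<Phi> "\<lambda>_. 0"]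
    by (auto simp: \<Phi>_def)
  obtain x e where "e > 0" "ball x e \<subseteq> A"
    using interior by (meson mem_interior ex_in_conv)
  moreover obtain y where "dist x y < e" "count y = c"
    using eventually_generic_dense[OF affine_UNIV UNIV_I \<open>e > 0\<close> c] .
  ultimately have y: "y \<in> A" "count y = c"
    by auto
  obtain k where "count y = real k" "k > 0"
    using count_natural[of y] y(1) by blast
  then have "tiles_at_level A L k"
    using eventually_generic_UNIV_imp_AE_lebesgue[OF c] y(2) by (simp add: tiles_at_level_iff)
  then show ?thesis
    using \<open>k > 0\<close> by blast
qed

end

lemma general_polytope_compact: "general_polytope A \<Longrightarrow> compact A"
  unfolding general_polytope_def
  by (elim exE conjE) (auto intro: compact_Union dest: compact_simplex)

lemma general_polytope_interior_nonempty:
  fixes A :: "'a::euclidean_space set"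
  assumes "general_polytope A"
  shows "interior A \<noteq> {}"
proof -
  obtain S where S: "int DIM('a) simplex S" "S \<subseteq> A"
    using assms unfolding general_polytope_def by blast
  have "affine hull S = UNIV"
    using aff_dim_simplex[OF S(1)] aff_dim_eq_full by blast
  then have "interior S \<noteq> {}"
    using S(1) aff_dim_simplex[OF S(1)] rel_interior_interior[of S]
      rel_interior_eq_empty[OF convex_simplex[OF S(1)]] by auto
  then show ?thesis
    using interior_mono[OF S(2)] by blast
qed

lemma general_polytope_periodized_body:
  fixes A L :: "'a::euclidean_space set"
  assumes "general_polytope A" "is_lattice L"
  obtains \<Sigma> M where "periodized_body A L \<Sigma> M"
proof -
  obtain \<Sigma> where \<Sigma>: "finite \<Sigma>" "adapted \<Sigma> A"
    using general_polytope_imp_polyhedral[OF assms(1)] unfolding polyhedral_def by blast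
  have "compact A"
    by (rule general_polytope_compact[OF assms(1)])
  then obtain M where "\<forall>x\<in>A. norm x \<le> M"
    using compact_imp_bounded bounded_iff by metis
  then have "A \<subseteq> cball 0 M"
    by auto
  moreover have "closed A" "affine hull A = UNIV"
    using \<open>compact A\<close> compact_imp_closed affine_hull_nonempty_interior
      general_polytope_interior_nonempty[OF assms(1)] by auto
  ultimately have "periodized_body A L \<Sigma> M"
    using \<Sigma> lattice_discrete_subgroup[OF assms(2)]
    by (simp add: periodized_body_def polyhedral_body_def periodized_body_axioms_def)
  then show thesis
    by (rule that)
qed

theorem theorem1p1:
  fixes A L :: "(real ^ 'n) set"
  assumes "general_polytope A" and "is_lattice L"
  shows "(\<exists>k>0. tiles_at_level A L k) \<longleftrightarrow>
         (\<forall>r \<Phi>. r \<le> CARD('n) - 1 \<and> is_flag r \<Phi> \<longrightarrow> hadwiger r \<Phi> A L = 0)"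
proof -
  obtain \<Sigma> M where "periodized_body A L \<Sigma> M"
    using general_polytope_periodized_body[OF assms] .
  then interpret periodized_body A L \<Sigma> M .
  have "CARD('n) > 0"
    by simp
  then have dim: "r \<le> CARD('n) - 1 \<longleftrightarrow> r < DIM(real ^ 'n)" for r
    unfolding DIM_cart DIM_real mult_1_right by linarith
  show ?thesis
    unfolding dim using tiling_imp_hadwiger_zero
      hadwiger_zero_imp_tiling[OF _ general_polytope_interior_nonempty[OF assms(1)]] by blast
qed

end
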